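(* Let $G$ be a non-elementary GBS group, and let $\beta=\beta(G)$ be the first Betti number of any labelled graph representing $G$. \begin{itemize} \item If $\beta=0$, then $G$ has no quotient isomorphic to a Baumslag-Solitar group, except possibly $K=BS(1,-1)$. \item If $\beta\ge1$, then $G$ has a quotient isomorphic to a Baumslag-Solitar group. Moreover, in this case, there exists an elliptic-friendly epimorphism from $G$ to a Baumslag-Solitar group if and only if the image of the modular homomorphism $\Delta_G$ is cyclic (possibly trivial). \end{itemize}
   Context: For nonzero integers $m,n$, the Baumslag-Solitar group is $BS(m,n)=\langle a,t\mid ta^mt^{-1}=a^n\rangle$. A generalized Baumslag-Solitar (GBS) group is a finitely generated group acting on a tree (without inversions) with all vertex and edge stabilizers infinite cyclic. A GBS group is elementary if it is isomorphic to $\mathbb{Z}$, $\mathbb{Z}^2$, or the Klein bottle group $K=BS(1,-1)$. A labelled graph is a finite graph $\Gamma$ in which each oriented edge $e$ carries a label $\lambda_e$, a nonzero integer. A connected labelled graph represents the GBS group which is the fundamental group of the graph of groups with all vertex and edge groups $\mathbb{Z}$, where the inclusion from the edge group of $e$ into the vertex group of the origin of $e$ is multiplication by $\lambda_e$. If $G\neq K$, all labelled graphs representing $G$ have the same first Betti number, denoted $\beta(G)$. Let $G$ be a non-elementary GBS group. An element is elliptic if it fixes a point in a tree on which $G$ acts with infinite cyclic vertex and edge stabilizers (this does not depend on the tree). A homomorphism $f$ from $G$ to a torsion-free group is elliptic-friendly if $\ker f$ contains no non-trivial elliptic element. The modular homomorphism $\Delta_G:G\to\mathbb{Q}^*$ is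 defined as follows: given $g\in G$ and any non-trivial elliptic element $a$, there is a relation $ga^mg^{-1}=a^n$ with $m,n\ne0$, and $\Delta_G(g)=\frac mn$ (independent of choices). *)

theory Defs
  imports "HOL-Algebra.Algebra" "Graph_Theory.Graph_Theory"
begin

section \<open>Groups given by presentations\<close>

text \<open>The letter \<open>(x, True)\<close> stands for the generator \<open>x\<close>, and \<open>(x, False)\<close> for its inverse.\<close>

type_synonym 'x word = "('x \<times> bool) list"

definition words :: "'x set \<Rightarrow> 'x word set" where
  "words S = {w. fst ` set w \<subseteq> S}"

text \<open>A pair \<open>(l, r)\<close> in \<open>R\<close> is the defining relation \<open>l = r\<close>.\<close>

inductive word_eq :: "('x word \<times> 'x word) set \<Rightarrow> 'x word \<Rightarrow> 'x word \<Rightarrow> bool"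
  for R where
  refl: "word_eq R u u"
| sym: "word_eq R u v \<Longrightarrow> word_eq R v u"
| trans: "word_eq R u v \<Longrightarrow> word_eq R v w \<Longrightarrow> word_eq R u w"
| cancel: "word_eq R (u @ [(x, b), (x, \<not> b)] @ v) (u @ v)"
| relation: "(l, r) \<in> R \<Longrightarrow> word_eq R (u @ l @ v) (u @ r @ v)"

definition word_rel :: "'x set \<Rightarrow> ('x word \<times> 'x word) set \<Rightarrow> ('x word \<times> 'x word) set" where
  "word_rel S R = {(u, v). u \<in> words S \<and> v \<in> words S \<and> word_eq R u v}"

definition presented_group :: "'x set \<Rightarrow> ('x word \<times> 'x word) set \<Rightarrow> 'x word set monoid" where
  "presented_group S R =
    \<lparr>carrier = words S // word_rel S R,
     monoid.mult = (\<lambda>A B. \<Union>u\<in>A. \<Union>v\<in>B. word_rel S R `` {u @ v}),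
     one = word_rel S R `` {[]}\<rparr>"

definition gen_pow :: "'x \<Rightarrow> int \<Rightarrow> 'x word" where
  "gen_pow x k = replicate (nat \<bar>k\<bar>) (x, k > 0)"

lemma words_append: "u @ v \<in> words S \<longleftrightarrow> u \<in> words S \<and> v \<in> words S"
  by (auto simp: words_def)

lemma word_eq_append_left: "word_eq R u v \<Longrightarrow> word_eq R (w @ u) (w @ v)"
proof (induction rule: word_eq.induct)
  case (cancel u x b v)
  show ?case using word_eq.cancel[of R "w @ u" x b v] by simp
next
  case (relation l r u v)
  then show ?case using word_eq.relation[of l r R "w @ u" v] by simp
next
  case (refl u)
  show ?case by (rule word_eq.refl)
next
  case (sym u v)
  show ?case by (rule word_eq.sym[OF sym.IH])
next
  case (trans u v w')
  show ?case by (rule word_eq.trans[OF trans.IH])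
qed

lemma word_eq_append_right: "word_eq R u v \<Longrightarrow> word_eq R (u @ w) (v @ w)"
proof (induction rule: word_eq.induct)
  case (cancel u x b v)
  show ?case using word_eq.cancel[of R u x b "v @ w"] by simp
next
  case (relation l r u v)
  then show ?case using word_eq.relation[of l r R u "v @ w"] by simp
next
  case (refl u)
  show ?case by (rule word_eq.refl)
next
  case (sym u v)
  show ?case by (rule word_eq.sym[OF sym.IH])
next
  case (trans u v w')
  show ?case by (rule word_eq.trans[OF trans.IH])
qed

lemma equiv_word_rel: "equiv (words S) (word_rel S R)"
proof (rule equivI)
  show "refl_on (words S) (word_rel S R)"
    by (auto simp: refl_on_def word_rel_def intro: word_eq.refl)
  show "sym (word_rel S R)"
    unfolding sym_def word_rel_def by (blast intro: word_eq.sym)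
  show "trans (word_rel S R)"
    unfolding trans_def word_rel_def by (blast intro: word_eq.trans)
  show "word_rel S R \<subseteq> words S \<times> words S"
    by (auto simp: word_rel_def)
qed

lemma presented_group_mult:
  assumes "u \<in> words S" "v \<in> words S"
  shows "word_rel S R `` {u} \<otimes>\<^bsub>presented_group S R\<^esub> word_rel S R `` {v} =
    word_rel S R `` {u @ v}"
proof -
  have "word_rel S R `` {u' @ v'} = word_rel S R `` {u @ v}"
    if "(u, u') \<in> word_rel S R" "(v, v') \<in> word_rel S R" for u' v'
  proof -
    have "word_eq R (u @ v) (u' @ v')"
      using that word_eq_append_right[of R u u' v] word_eq_append_left[of R v v' u']
        word_eq.trans[of R "u @ v" "u' @ v" "u' @ v'"]
      by (simp add: word_rel_def)
    then have "(u @ v, u' @ v') \<in> word_rel S R"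
      using that by (auto simp: word_rel_def words_append)
    then show ?thesis
      using equiv_class_eq[OF equiv_word_rel] by metis
  qed
  moreover have "(u, u) \<in> word_rel S R" "(v, v) \<in> word_rel S R"
    using assms by (auto simp: word_rel_def intro: word_eq.refl)
  ultimately have "(\<Union>u'\<in>word_rel S R `` {u}. \<Union>v'\<in>word_rel S R `` {v}. word_rel S R `` {u' @ v'}) =
      word_rel S R `` {u @ v}"
    by blast
  then show ?thesis
    by (simp add: presented_group_def)
qed

lemma word_eq_inverse: "word_eq R (rev (map (apsnd Not) u) @ u) []"
proof (induction u)
  case Nil
  show ?case by (auto intro: word_eq.refl)
next
  case (Cons a u)
  have "word_eq R (rev (map (apsnd Not) u) @ [(fst a, \<not> snd a), (fst a, \<not> \<not> snd a)] @ u)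
      (rev (map (apsnd Not) u) @ u)"
    by (rule word_eq.cancel)
  then have "word_eq R (rev (map (apsnd Not) u) @ [(fst a, \<not> snd a), (fst a, snd a)] @ u) []"
    using word_eq.trans[OF _ Cons] by simp
  then show ?case by (cases a) simp
qed

lemma group_presented_group: "group (presented_group S R)"
proof (rule groupI)
  let ?P = "presented_group S R"
  let ?c = "\<lambda>u. word_rel S R `` {u}"
  have carr: "carrier ?P = ?c ` words S" and one: "\<one>\<^bsub>?P\<^esub> = ?c []"
    by (auto simp: presented_group_def quotient_def)
  have nil: "[] \<in> words S" by (simp add: words_def)
  show "\<one>\<^bsub>?P\<^esub> \<in> carrier ?P" using carr one nil by auto
  show "A \<otimes>\<^bsub>?P\<^esub> B \<in> carrier ?P" if "A \<in> carrier ?P" "B \<in> carrier ?P" for A B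
    using that by (auto simp: carr presented_group_mult words_append)
  show "A \<otimes>\<^bsub>?P\<^esub> B \<otimes>\<^bsub>?P\<^esub> C = A \<otimes>\<^bsub>?P\<^esub> (B \<otimes>\<^bsub>?P\<^esub> C)"
    if "A \<in> carrier ?P" "B \<in> carrier ?P" "C \<in> carrier ?P" for A B C
    using that by (auto simp: carr presented_group_mult words_append)
  show "\<one>\<^bsub>?P\<^esub> \<otimes>\<^bsub>?P\<^esub> A = A" if "A \<in> carrier ?P" for A
    using that by (auto simp only: carr one presented_group_mult nil append_Nil)
  show "\<exists>B\<in>carrier ?P. B \<otimes>\<^bsub>?P\<^esub> A = \<one>\<^bsub>?P\<^esub>" if A: "A \<in> carrier ?P" for A
  proof -
    obtain u where u: "u \<in> words S" "A = ?c u" using A carr by auto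
    let ?i = "rev (map (apsnd Not) u)"
    have i: "?i \<in> words S" using u(1) by (auto simp: words_def)
    have "(?i @ u, []) \<in> word_rel S R"
      using i u nil word_eq_inverse by (auto simp: word_rel_def words_append)
    then have "?c (?i @ u) = ?c []"
      by (rule equiv_class_eq[OF equiv_word_rel])
    then have "?c ?i \<otimes>\<^bsub>?P\<^esub> A = \<one>\<^bsub>?P\<^esub>"
      using u i by (simp add: presented_group_mult one)
    then show ?thesis using i carr by auto
  qed
qed

section \<open>Baumslag-Solitar groups and elementary groups\<close>

datatype bs_gen = BS_a | BS_t

definition BS :: "int \<Rightarrow> int \<Rightarrow> bs_gen word set monoid" where
  "BS m n = presented_group UNIV
    {([(BS_t, True)] @ gen_pow BS_a m @ [(BS_t, False)], gen_pow BS_a n)}"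

definition elementary_gbs :: "('a, 'b) monoid_scheme \<Rightarrow> bool" where
  "elementary_gbs G \<longleftrightarrow>
    G \<cong> integer_group \<or> G \<cong> integer_group \<times>\<times> integer_group \<or> G \<cong> BS 1 (-1)"

section \<open>Trees and actions on trees\<close>

text \<open>
  Graphs are graphs in the sense of Serre: \<open>bidirected_digraph T s\<close> says that \<open>s\<close> is a
  fixed-point free involution of the set of oriented edges \<open>arcs T\<close>, exchanging origin
  (\<open>tail\<close>) and terminus (\<open>head\<close>). Outside \<open>arcs T\<close> it is the identity, by convention.
  The constant \<open>tree\<close> of the graph library is not the right notion here, since
  it regards a pair of opposite arcs as a cycle.
\<close>

definition serre_tree :: "('v, 'e) pre_digraph \<Rightarrow> ('e \<Rightarrow> 'e) \<Rightarrow> bool" where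
  "serre_tree T s \<longleftrightarrow> bidirected_digraph T s \<and> strongly_connected T \<and>
    (\<forall>u p. pre_digraph.awalk T u p u \<and> p \<noteq> [] \<longrightarrow>
      (\<exists>i. Suc i < length p \<and> p ! Suc i = s (p ! i)))"

text \<open>An action without inversions by graph automorphisms, given on vertices by \<open>\<phi>\<close> and on
  oriented edges by \<open>\<psi>\<close>.\<close>

definition tree_action ::
  "('a, 'b) monoid_scheme \<Rightarrow> ('v, 'e) pre_digraph \<Rightarrow> ('e \<Rightarrow> 'e) \<Rightarrow>
    ('a \<Rightarrow> 'v \<Rightarrow> 'v) \<Rightarrow> ('a \<Rightarrow> 'e \<Rightarrow> 'e) \<Rightarrow> bool" where
  "tree_action G T s \<phi> \<psi> \<longleftrightarrow>
    serre_tree T s \<and> group_action G (verts T) \<phi> \<and> group_action G (arcs T) \<psi> \<and>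
    (\<forall>g\<in>carrier G. \<forall>e\<in>arcs T.
      tail T (\<psi> g e) = \<phi> g (tail T e) \<and> \<psi> g (s e) = s (\<psi> g e) \<and> \<psi> g e \<noteq> s e)"

definition infinite_cyclic :: "('a, 'b) monoid_scheme \<Rightarrow> bool" where
  "infinite_cyclic G \<longleftrightarrow> G \<cong> integer_group"

definition finitely_generated :: "('a, 'b) monoid_scheme \<Rightarrow> bool" where
  "finitely_generated G \<longleftrightarrow> (\<exists>S. finite S \<and> S \<subseteq> carrier G \<and> generate G S = carrier G)"

text \<open>\<open>G\<close> is a GBS group, as witnessed by the given action.\<close>

definition gbs_group ::
  "('a, 'b) monoid_scheme \<Rightarrow> ('v, 'e) pre_digraph \<Rightarrow> ('e \<Rightarrow> 'e) \<Rightarrow>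
    ('a \<Rightarrow> 'v \<Rightarrow> 'v) \<Rightarrow> ('a \<Rightarrow> 'e \<Rightarrow> 'e) \<Rightarrow> bool" where
  "gbs_group G T s \<phi> \<psi> \<longleftrightarrow>
    group G \<and> finitely_generated G \<and> tree_action G T s \<phi> \<psi> \<and>
    (\<forall>v\<in>verts T. infinite_cyclic (G\<lparr>carrier := stabilizer G \<phi> v\<rparr>)) \<and>
    (\<forall>e\<in>arcs T. infinite_cyclic (G\<lparr>carrier := stabilizer G \<psi> e\<rparr>))"

text \<open>For an action without inversions, fixing a point of the tree means fixing a vertex.\<close>

definition elliptic ::
  "('a, 'b) monoid_scheme \<Rightarrow> ('v, 'e) pre_digraph \<Rightarrow> ('a \<Rightarrow> 'v \<Rightarrow> 'v) \<Rightarrow> 'a \<Rightarrow> bool" where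
  "elliptic G T \<phi> g \<longleftrightarrow> g \<in> carrier G \<and> (\<exists>v\<in>verts T. \<phi> g v = v)"

section \<open>Labelled graphs\<close>

definition connected_labelled_graph ::
  "('v, 'e) pre_digraph \<Rightarrow> ('e \<Rightarrow> 'e) \<Rightarrow> ('e \<Rightarrow> int) \<Rightarrow> bool" where
  "connected_labelled_graph \<Gamma> s l \<longleftrightarrow>
    fin_digraph \<Gamma> \<and> bidirected_digraph \<Gamma> s \<and> strongly_connected \<Gamma> \<and> (\<forall>e\<in>arcs \<Gamma>. l e \<noteq> 0)"

text \<open>First Betti number of a connected graph; each geometric edge is a pair of opposite arcs.\<close>

definition betti :: "('v, 'e) pre_digraph \<Rightarrow> int" where
  "betti \<Gamma> = int (card (arcs \<Gamma>) div 2) - int (card (verts \<Gamma>)) + 1"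

definition maximal_subtree :: "('v, 'e) pre_digraph \<Rightarrow> ('e \<Rightarrow> 'e) \<Rightarrow> 'e set \<Rightarrow> bool" where
  "maximal_subtree \<Gamma> s A \<longleftrightarrow>
    A \<subseteq> arcs \<Gamma> \<and> serre_tree (\<Gamma>\<lparr>arcs := A\<rparr>) (\<lambda>e. if e \<in> A then s e else e)"

datatype ('v, 'e) gog_gen = Vert 'v | Edge 'e

text \<open>
  Serre's presentation of the fundamental group of a graph of groups relative to the maximal
  subtree with set of oriented edges \<open>A\<close>, for vertex groups generated by \<open>a\<^sub>v\<close> (written \<open>Vert v\<close>)
  and stable letters \<open>t\<^sub>e\<close> (written \<open>Edge e\<close>). The edge group of \<open>e\<close> is infinite cyclic and is the
  edge group of the opposite edge \<open>s e\<close>; its generator is sent to the power \<open>l e\<close> of the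
  generator at the origin of \<open>e\<close> and to the power \<open>l (s e)\<close> of the one at the terminus of \<open>e\<close>.
\<close>

definition gog_relations ::
  "('v, 'e) pre_digraph \<Rightarrow> ('e \<Rightarrow> 'e) \<Rightarrow> ('e \<Rightarrow> int) \<Rightarrow> 'e set \<Rightarrow>
    (('v, 'e) gog_gen word \<times> ('v, 'e) gog_gen word) set" where
  "gog_relations \<Gamma> s l A =
    {([(Edge e, True), (Edge (s e), True)], []) | e. e \<in> arcs \<Gamma>} \<union>
    {([(Edge e, True)] @ gen_pow (Vert (head \<Gamma> e)) (l (s e)) @ [(Edge e, False)],
      gen_pow (Vert (tail \<Gamma> e)) (l e)) | e. e \<in> arcs \<Gamma>} \<union>
    {([(Edge e, True)], []) | e. e \<in> A}"

definition fundamental_group ::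
  "('v, 'e) pre_digraph \<Rightarrow> ('e \<Rightarrow> 'e) \<Rightarrow> ('e \<Rightarrow> int) \<Rightarrow> 'e set \<Rightarrow>
    ('v, 'e) gog_gen word set monoid" where
  "fundamental_group \<Gamma> s l A =
    presented_group (Vert ` verts \<Gamma> \<union> Edge ` arcs \<Gamma>) (gog_relations \<Gamma> s l A)"

text \<open>The isomorphism type of the fundamental group does not depend on the maximal subtree.\<close>

definition represents ::
  "('v, 'e) pre_digraph \<Rightarrow> ('e \<Rightarrow> 'e) \<Rightarrow> ('e \<Rightarrow> int) \<Rightarrow> ('a, 'b) monoid_scheme \<Rightarrow> bool" where
  "represents \<Gamma> s l G \<longleftrightarrow> connected_labelled_graph \<Gamma> s l \<and>
    (\<exists>A. maximal_subtree \<Gamma> s A \<and> G \<cong> fundamental_group \<Gamma> s l A)"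

section \<open>Elliptic-friendly homomorphisms and the modular homomorphism\<close>

definition torsion_free :: "('a, 'b) monoid_scheme \<Rightarrow> bool" where
  "torsion_free H \<longleftrightarrow>
    (\<forall>h\<in>carrier H. \<forall>k::nat. 0 < k \<and> h [^]\<^bsub>H\<^esub> k = \<one>\<^bsub>H\<^esub> \<longrightarrow> h = \<one>\<^bsub>H\<^esub>)"

definition elliptic_friendly ::
  "('a, 'b) monoid_scheme \<Rightarrow> ('v, 'e) pre_digraph \<Rightarrow> ('a \<Rightarrow> 'v \<Rightarrow> 'v) \<Rightarrow>
    ('c, 'd) monoid_scheme \<Rightarrow> ('a \<Rightarrow> 'c) \<Rightarrow> bool" where
  "elliptic_friendly G T \<phi> H f \<longleftrightarrow> f \<in> hom G H \<and> torsion_free H \<and>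
    (\<forall>g\<in>kernel G H f. elliptic G T \<phi> g \<longrightarrow> g = \<one>\<^bsub>G\<^esub>)"

definition modular ::
  "('a, 'b) monoid_scheme \<Rightarrow> ('v, 'e) pre_digraph \<Rightarrow> ('a \<Rightarrow> 'v \<Rightarrow> 'v) \<Rightarrow> 'a \<Rightarrow> rat" where
  "modular G T \<phi> g = (THE q. \<exists>a (m::int) (n::int).
    elliptic G T \<phi> a \<and> a \<noteq> \<one>\<^bsub>G\<^esub> \<and> m \<noteq> 0 \<and> n \<noteq> 0 \<and>
    g \<otimes>\<^bsub>G\<^esub> (a [^]\<^bsub>G\<^esub> m) \<otimes>\<^bsub>G\<^esub> inv\<^bsub>G\<^esub> g = a [^]\<^bsub>G\<^esub> n \<and>
    q = of_int m / of_int n)"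

definition rat_units :: "rat monoid" where
  "rat_units = \<lparr>carrier = UNIV - {0}, monoid.mult = (*), one = 1\<rparr>"

end

theory Submission
  imports Defs
begin

text \<open>
  Let \<open>a\<^sub>v\<close> and \<open>t\<^sub>e\<close> be the generators given by the labelled graph. The \<open>a\<^sub>v\<close> are pairwise
  commensurable and every element of \<open>G\<close> commensurates them. Following the maximal subtree one
  finds non-zero integers \<open>w\<^sub>v\<close> such that \<open>a\<^sub>u\<^sup>i = a\<^sub>v\<^sup>j\<close> for some non-zero \<open>i, j\<close> with
  \<open>i w\<^sub>u = j w\<^sub>v\<close>. If \<open>a\<^sub>v\<close> had no fixed vertex in the given tree, its axis would be invariant
  under \<open>G\<close>, and \<open>G\<close> would be elementary. Hence \<open>a\<^sub>v\<close> is elliptic, and the modular homomorphism is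
  \<open>t\<^sub>e \<mapsto> w\<^sub>u l(e\<^sup>-) / (w\<^sub>v l(e))\<close> for an edge \<open>e\<close> from \<open>v\<close> to \<open>u\<close>, with \<open>e\<^sup>-\<close> the opposite edge.

  If the graph is a tree, some power of the \<open>a\<^sub>v\<close> is central in \<open>G\<close>, and in a quotient \<open>BS(m,n)\<close> it
  has non-zero exponent sum in \<open>t\<close>; this forces \<open>|m| = |n| = 1\<close>, and \<open>\<int>\<^sup>2\<close> is excluded because \<open>G\<close> has
  virtually cyclic abelianization. If there is a loop and the modular image is generated by \<open>m/n\<close> in
  lowest terms, then sending \<open>a\<^sub>v\<close> to \<open>a^(w\<^sub>v)\<close> and \<open>t\<^sub>e\<close> to \<open>t\<^sup>k\<close>, where \<open>\<Delta>(t\<^sub>e) = (m/n)\<^sup>k\<close>, gives an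
  elliptic-friendly epimorphism onto \<open>BS(m,n)\<close>. With at least two loops \<open>G\<close> also maps onto a free group of rank two.
  Conversely, let \<open>f\<close> be elliptic-friendly. If \<open>f(a\<^sub>v)\<close> is conjugate to a power of \<open>a\<close>, the modular
  image lies in \<open>\<langle>m/n\<rangle>\<close>; otherwise \<open>f(a\<^sub>v)\<close> has positive translation length on the Bass-Serre tree of
  \<open>BS(m,n)\<close>, and the modular image lies in \<open>{1, -1}\<close>.
\<close>

section \<open>Walks in Serre trees\<close>

text \<open>The graph and the tree are linked only through the abstract group \<open>G\<close>, so
  nothing says beforehand that the generators \<open>a_v\<close> fix vertices of the tree.
  Non-elementarity enters here, and this is why the axis of a commensurated element has to be
  analysed. Until then everything is phrased with the relation \<open>conj_ratio b g q\<close>,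
  which makes sense for any \<open>b\<close>; it is identified with the modular homomorphism once
  the \<open>a_v\<close> are known to be elliptic.

  Two details shape the epimorphism. The weights are chosen without common divisor, so that the
  powers \<open>a^(w_v)\<close> generate \<open><a>\<close>. And the modular values determine the
  exponents of the stable letters only when \<open>m/n\<close> is not 1 or -1; otherwise one
  exponent must be chosen to be 1, or \<open>t\<close> could be missed.

  Non-triviality in presented groups is certified by explicit actions: affine maps of the rationals
  for \<open>G\<close>, coded vertices of the Bass-Serre tree for \<open>BS(m,n)\<close>, block
  rotations for a quotient of it. Two loops need their own construction because the modular image
  may then fail to be cyclic; any group with two generators would do as target there.\<close>

lemma (in bidirected_digraph) awalk_rev:
  assumes "awalk u p v"
  shows "awalk v (rev (map arev p)) u"
  using assms
proof (induction p arbitrary: u)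
  case Nil
  then show ?case by (auto simp: awalk_Nil_iff)
next
  case (Cons e p)
  then have e: "e \<in> arcs G" "tail G e = u" "awalk v (rev (map arev p)) (head G e)"
    by (auto simp: awalk_Cons_iff)
  then have "awalk (head G e) [arev e] u"
    by (metis arc_implies_awalk arev_in_arcs head_arev tail_arev)
  with e(3) show ?case by (auto intro: awalk_appendI)
qed

text \<open>Number the arcs injectively and keep, of two opposite arcs, the one with the smaller
  number; the numbers differ because no arc is its own opposite.\<close>

lemma (in bidirected_digraph) ex_orientation:
  assumes "finite (arcs G)"
  obtains O' where "O' \<subseteq> arcs G" "\<And>e. e \<in> arcs G \<Longrightarrow> e \<in> O' \<longleftrightarrow> arev e \<notin> O'"
proof -
  obtain \<iota> :: "'b \<Rightarrow> nat" where inj: "inj_on \<iota> (arcs G)"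
    using finite_imp_inj_to_nat_seg[OF assms] by blast
  define O' where "O' = {e \<in> arcs G. \<iota> e < \<iota> (arev e)}"
  have "e \<in> O' \<longleftrightarrow> arev e \<notin> O'" if "e \<in> arcs G" for e
  proof -
    have "\<iota> e \<noteq> \<iota> (arev e)"
      using inj that arev_neq[OF that] arev_in_arcs[OF that] by (metis inj_on_eq_iff)
    then show ?thesis using that by (auto simp: O'_def)
  qed
  then show thesis using that[of O'] by (auto simp: O'_def)
qed

lemma (in bidirected_digraph) card_orientation:
  assumes "finite (arcs G)" "O' \<subseteq> arcs G" "\<And>e. e \<in> arcs G \<Longrightarrow> e \<in> O' \<longleftrightarrow> arev e \<notin> O'"
  shows "card (arcs G) = 2 * card O'"
proof -
  have "arcs G = O' \<union> arev ` O'"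
  proof
    show "arcs G \<subseteq> O' \<union> arev ` O'"
    proof
      fix e assume e: "e \<in> arcs G"
      show "e \<in> O' \<union> arev ` O'"
        using assms(3)[OF e] arev_arev[of e] by (cases "e \<in> O'") (auto intro: rev_image_eqI)
    qed
  qed (use assms(2) in auto)
  moreover have "O' \<inter> arev ` O' = {}"
    using assms(2,3) by fastforce
  moreover have "card (arev ` O') = card O'"
    by (rule card_image) auto
  ultimately show ?thesis
    using assms(1,2) by (metis card_Un_disjoint finite_Un mult_2)
qed

locale serre_tree_graph = bidirected_digraph +
  assumes conn: "strongly_connected G"
    and backtrack: "\<And>u p. awalk u p u \<Longrightarrow> p \<noteq> [] \<Longrightarrow> \<exists>i. Suc i < length p \<and> p ! Suc i = arev (p ! i)"

lemma serre_tree_iff: "serre_tree T s \<longleftrightarrow> serre_tree_graph T s"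
  by (auto simp: serre_tree_def serre_tree_graph_def serre_tree_graph_axioms_def)

lemma (in wf_digraph) strongly_connected_awalk:
  assumes "strongly_connected G" "u \<in> verts G" "v \<in> verts G"
  obtains p where "awalk u p v"
  using assms by (auto simp: strongly_connected_def reachable_awalk)

lemma (in wf_digraph) strongly_connected_propagate:
  assumes "strongly_connected G" "u \<in> verts G" "v \<in> verts G" "P u"
    and step: "\<And>e. e \<in> arcs G \<Longrightarrow> P (tail G e) \<Longrightarrow> P (head G e)"
  shows "P v"
proof -
  obtain p where "awalk u p v"
    using strongly_connected_awalk assms by metis
  with \<open>P u\<close> show ?thesis
    by (induction p arbitrary: u) (auto simp: awalk_simps dest: step)
qed

context serre_tree_graph
begin

lemma closed_walk_split:
  assumes "awalk u p u" "p \<noteq> []"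
  obtains q e q' where "p = q @ [e, arev e] @ q'" "e \<in> arcs G" "awalk u (q @ q') u"
proof -
  obtain i where i: "Suc i < length p" "p ! Suc i = arev (p ! i)"
    using backtrack[OF assms] by auto
  define q e q' where "q = take i p" and "e = p ! i" and "q' = drop (Suc (Suc i)) p"
  have p: "p = q @ [e, arev e] @ q'"
    using i id_take_nth_drop[of i p] Cons_nth_drop_Suc[of "Suc i" p]
    by (simp add: q_def e_def q'_def)
  then have e: "e \<in> arcs G" using assms by auto
  then have "awalk u (q @ q') u"
    using assms(1) unfolding p by (auto simp: awalk_Cons_iff)
  with p e show thesis by (rule that)
qed

text \<open>Deleting one backtrack at a time shrinks a closed walk in a tree to the empty
  walk.\<close>

lemma closed_walk_invariant:
  assumes "\<And>q e q'. e \<in> arcs G \<Longrightarrow> F (q @ [e, arev e] @ q') = F (q @ q')"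
    and "awalk u p u"
  shows "F p = F []"
  using assms(2)
proof (induction "length p" arbitrary: p rule: less_induct)
  case less
  show ?case
  proof (cases "p = []")
    case False
    with less.prems obtain q e q' where "p = q @ [e, arev e] @ q'" "e \<in> arcs G" "awalk u (q @ q') u"
      by (rule closed_walk_split)
    with less.hyps[of "q @ q'"] assms(1) show ?thesis by simp
  qed simp
qed

text \<open>A multiplicative 1-cocycle on a tree is a coboundary: products along closed walks are 1,
  so the product along a walk from \<open>v0\<close> depends only on its end and may be taken as
  \<open>p\<close>. It serves to count arcs, to separate the two sides of an arc, and to find the
  weights of a labelled graph.\<close>

lemma ex_potential:
  fixes w :: "'b \<Rightarrow> rat"
  assumes w: "\<And>e. e \<in> arcs G \<Longrightarrow> w e \<noteq> 0" "\<And>e. e \<in> arcs G \<Longrightarrow> w (arev e) = inverse (w e)"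
  obtains p where "\<And>v. v \<in> verts G \<Longrightarrow> p v \<noteq> 0"
    "\<And>e. e \<in> arcs G \<Longrightarrow> p (head G e) = p (tail G e) * w e"
proof -
  define F where "F p = prod_list (map w p)" for p
  have closed: "F p = 1" if "awalk u p u" for u p
  proof -
    have "F p = F []"
      using that by (rule closed_walk_invariant[rotated]) (simp add: F_def w)
    then show ?thesis by (simp add: F_def)
  qed
  have nz: "F p \<noteq> 0" if "set p \<subseteq> arcs G" for p
    using that w by (auto simp: F_def prod_list_zero_iff)
  have rev: "F (rev (map arev p)) = inverse (F p)" if "set p \<subseteq> arcs G" for p
    using that by (induction p) (auto simp: F_def w)
  have same: "F p = F q" if "awalk u p v" "awalk u q v" for u v p q
  proof -
    have "F (p @ rev (map arev q)) = 1"
      using that by (intro closed awalk_appendI awalk_rev)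
    moreover have "set q \<subseteq> arcs G" using that by auto
    ultimately show ?thesis
      using rev nz by (auto simp: F_def field_simps)
  qed
  obtain v0 where v0: "v0 \<in> verts G" using conn by (auto simp: strongly_connected_def)
  define W where "W v = (SOME p. awalk v0 p v)" for v
  have W: "awalk v0 (W v) v" if "v \<in> verts G" for v
    unfolding W_def using strongly_connected_awalk[OF conn v0 that] by (metis someI)
  show thesis
  proof
    show "F (W v) \<noteq> 0" if "v \<in> verts G" for v
      using W[OF that] by (intro nz) auto
    show "F (W (head G e)) = F (W (tail G e)) * w e" if e: "e \<in> arcs G" for e
    proof -
      have "awalk v0 (W (tail G e) @ [e]) (head G e)"
        using W[of "tail G e"] e by (auto intro!: awalk_appendI arc_implies_awalk)
      then have "F (W (head G e)) = F (W (tail G e) @ [e])"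
        by (rule same[OF W[OF head_in_verts[OF e]]])
      then show ?thesis by (simp add: F_def)
    qed
  qed
qed

text \<open>Counting \<open>\<int>/2\<close>-valued 1-cochains: on a tree they are exactly the coboundaries of the
  0-cochains vanishing at a base point.\<close>

lemma card_arcs:
  assumes "finite (verts G)" "finite (arcs G)"
  shows "card (arcs G) = 2 * (card (verts G) - 1)"
proof -
  obtain O' where O': "O' \<subseteq> arcs G" "\<And>e. e \<in> arcs G \<Longrightarrow> e \<in> O' \<longleftrightarrow> arev e \<notin> O'"
    using ex_orientation[OF assms(2)] by blast
  obtain v0 where v0: "v0 \<in> verts G" using conn by (auto simp: strongly_connected_def)
  define \<Phi> where "\<Phi> U = {e \<in> O'. (tail G e \<in> U) \<noteq> (head G e \<in> U)}" for U
  have "bij_betw \<Phi> (Pow (verts G - {v0})) (Pow O')"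
    unfolding bij_betw_def
  proof
    show "inj_on \<Phi> (Pow (verts G - {v0}))"
    proof (rule inj_onI)
      fix U V assume UV: "U \<in> Pow (verts G - {v0})" "V \<in> Pow (verts G - {v0})" "\<Phi> U = \<Phi> V"
      have O: "(tail G e \<in> U) \<noteq> (head G e \<in> U) \<longleftrightarrow> (tail G e \<in> V) \<noteq> (head G e \<in> V)" if "e \<in> O'" for e
        using UV(3) that unfolding \<Phi>_def by blast
      have "(tail G e \<in> U) \<noteq> (head G e \<in> U) \<longleftrightarrow> (tail G e \<in> V) \<noteq> (head G e \<in> V)" if "e \<in> arcs G" for e
        using O[of e] O[of "arev e"] O'(2)[OF that] that by (cases "e \<in> O'") auto
      moreover have "v0 \<in> U \<longleftrightarrow> v0 \<in> V" using UV(1,2) by blast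
      ultimately have "v \<in> U \<longleftrightarrow> v \<in> V" if "v \<in> verts G" for v
        by (intro strongly_connected_propagate[OF conn v0 that, of "\<lambda>v. v \<in> U \<longleftrightarrow> v \<in> V"]) blast+
      then show "U = V" using UV by blast
    qed
    show "\<Phi> ` Pow (verts G - {v0}) = Pow O'"
    proof
      show "Pow O' \<subseteq> \<Phi> ` Pow (verts G - {v0})"
      proof
        fix B assume "B \<in> Pow O'"
        then have B: "B \<subseteq> O'" by simp
        \<comment> \<open>Surjectivity: the potential of this sign cocycle changes sign exactly
          across the arcs of \<open>B\<close> and their opposites, and \<open>U\<close> collects the
          vertices whose sign differs from that of \<open>v0\<close>.\<close>
        define w :: "'b \<Rightarrow> rat" where "w e = (if e \<in> B \<or> arev e \<in> B then -1 else 1)" for e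
        obtain p where p: "\<And>v. v \<in> verts G \<Longrightarrow> p v \<noteq> 0"
          "\<And>e. e \<in> arcs G \<Longrightarrow> p (head G e) = p (tail G e) * w e"
          by (rule ex_potential[of w]) (auto simp: w_def)
        define U where "U = {v \<in> verts G. p v * p v0 < 0}"
        have "v0 \<notin> U" using not_square_less_zero[of "p v0"] by (auto simp: U_def)
        moreover have "\<Phi> U = B"
        proof -
          have "(tail G e \<in> U) \<noteq> (head G e \<in> U) \<longleftrightarrow> e \<in> B" if e: "e \<in> O'" for e
          proof -
            have "e \<in> arcs G" "arev e \<notin> B" using e O' B by blast+
            moreover have "p (tail G e) \<noteq> 0" "p (head G e) \<noteq> 0" "p v0 \<noteq> 0"
              using p(1) v0 calculation by auto
            ultimately show ?thesis
              using p(2)[of e] by (auto simp: U_def w_def mult_less_0_iff)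
          qed
          then show ?thesis using B by (auto simp: \<Phi>_def)
        qed
        ultimately show "B \<in> \<Phi> ` Pow (verts G - {v0})" by (auto simp: U_def)
      qed
    qed (auto simp: \<Phi>_def)
  qed
  then have "card (Pow (verts G - {v0})) = card (Pow O')"
    by (rule bij_betw_same_card)
  moreover have "finite O'" using O' assms finite_subset by auto
  ultimately have "2 ^ card (verts G - {v0}) = (2::nat) ^ card O'"
    using assms by (simp add: card_Pow)
  then have "card O' = card (verts G) - 1"
    using v0 assms by simp
  then show ?thesis using card_orientation[OF assms(2) O'] by simp
qed

end

section \<open>Commensurated cyclic subgroups\<close>

context group
begin

definition inf_order :: "'a \<Rightarrow> bool" where
  "inf_order b \<longleftrightarrow> b \<in> carrier G \<and> (\<forall>i::int. b [^] i = \<one> \<longrightarrow> i = 0)"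

definition commensurable :: "'a \<Rightarrow> 'a \<Rightarrow> bool" where
  "commensurable b d \<longleftrightarrow> (\<exists>(i::int) (j::int). i \<noteq> 0 \<and> j \<noteq> 0 \<and> b [^] i = d [^] j)"

text \<open>The modular homomorphism measured on \<open>b\<close>. It is a relation because a value
  need not exist when \<open>g\<close> does not commensurate \<open><b>\<close>. The numerator is
  the exponent being conjugated, as in \<open>modular\<close>.\<close>

definition conj_ratio :: "'a \<Rightarrow> 'a \<Rightarrow> rat \<Rightarrow> bool" where
  "conj_ratio b g q \<longleftrightarrow> (\<exists>(i::int) (j::int). i \<noteq> 0 \<and> j \<noteq> 0 \<and>
    g \<otimes> b [^] i \<otimes> inv g = b [^] j \<and> q = of_int i / of_int j)"

lemma conj_int_pow:
  assumes "g \<in> carrier G" "x \<in> carrier G"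
  shows "g \<otimes> x [^] (k::int) \<otimes> inv g = (g \<otimes> x \<otimes> inv g) [^] k"
proof -
  have "(\<lambda>x. g \<otimes> x \<otimes> inv g) \<in> hom G G"
    using assms(1) by (auto simp: hom_def m_assoc inv_solve_left)
  then interpret c: group_hom G G "\<lambda>x. g \<otimes> x \<otimes> inv g"
    by unfold_locales
  show ?thesis using c.hom_int_pow[OF assms(2)] .
qed

lemma conj_pow_eq:
  assumes "g \<in> carrier G" "b \<in> carrier G" "d \<in> carrier G" "g \<otimes> b [^] (i::int) \<otimes> inv g = d [^] (j::int)"
  shows "g \<otimes> b [^] (i * k) \<otimes> inv g = d [^] (j * k)"
  using conj_int_pow[OF assms(1), of "b [^] i" k] assms by (simp add: int_pow_pow)

lemma int_pow_eq_iff: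
  assumes "inf_order b"
  shows "b [^] (i::int) = b [^] (j::int) \<longleftrightarrow> i = j"
proof
  assume "b [^] i = b [^] j"
  then have "b [^] (i - j) = \<one>"
    using assms by (simp add: inf_order_def int_pow_diff)
  then show "i = j" using assms by (auto simp: inf_order_def)
qed simp

lemma inf_order_commensurable:
  assumes "inf_order b" "commensurable b d" "d \<in> carrier G"
  shows "inf_order d"
proof -
  obtain i j :: int where ij: "i \<noteq> 0" "j \<noteq> 0" "b [^] i = d [^] j"
    using assms(2) by (auto simp: commensurable_def)
  have "k = 0" if "d [^] k = \<one>" for k :: int
  proof -
    have b: "b \<in> carrier G" using assms(1) by (simp add: inf_order_def)
    have "b [^] (i * k) = (b [^] i) [^] k" using b by (simp add: int_pow_pow)
    also have "\<dots> = (d [^] k) [^] j" using ij assms(3) by (simp add: int_pow_pow mult.commute)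
    finally have "b [^] (i * k) = \<one>" using that by simp
    then show ?thesis using assms(1) ij by (auto simp: inf_order_def)
  qed
  then show ?thesis using assms(3) by (auto simp: inf_order_def)
qed

lemma commensurable_trans:
  assumes "commensurable b c" "commensurable c d" "b \<in> carrier G" "c \<in> carrier G" "d \<in> carrier G"
  shows "commensurable b d"
proof -
  obtain i j i' j' :: int where *: "i \<noteq> 0" "j \<noteq> 0" "b [^] i = c [^] j"
    "i' \<noteq> 0" "j' \<noteq> 0" "c [^] i' = d [^] j'"
    using assms by (auto simp: commensurable_def)
  have "b [^] (i * i') = (b [^] i) [^] i'" using assms by (simp add: int_pow_pow)
  also have "\<dots> = (c [^] i') [^] j" using *(3) assms by (simp add: int_pow_pow mult.commute)
  also have "\<dots> = d [^] (j' * j)" unfolding *(6) using assms by (simp add: int_pow_pow)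
  finally show ?thesis using * unfolding commensurable_def
    by (intro exI[of _ "i * i'"] exI[of _ "j' * j"]) simp
qed

text \<open>Raising the two relations to the powers \<open>i'\<close> and \<open>i\<close>
  conjugates the same power of \<open>b\<close> in both, and infinite order lets the resulting
  exponents be compared.\<close>

lemma conj_ratio_unique:
  assumes b: "inf_order b" and g: "g \<in> carrier G" and "conj_ratio b g q" "conj_ratio b g q'"
  shows "q = q'"
proof -
  have bc: "b \<in> carrier G" using b by (simp add: inf_order_def)
  obtain i j :: int where *: "i \<noteq> 0" "j \<noteq> 0" "g \<otimes> b [^] i \<otimes> inv g = b [^] j" "q = of_int i / of_int j"
    using assms by (auto simp: conj_ratio_def)
  obtain i' j' :: int where **: "i' \<noteq> 0" "j' \<noteq> 0" "g \<otimes> b [^] i' \<otimes> inv g = b [^] j'"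
    "q' = of_int i' / of_int j'"
    using assms by (auto simp: conj_ratio_def)
  have "b [^] (j * i') = b [^] (j' * i)"
    using conj_pow_eq[OF g bc bc *(3), of i'] conj_pow_eq[OF g bc bc **(3), of i]
    by (simp add: mult.commute)
  then have "j * i' = j' * i" using int_pow_eq_iff[OF b] by simp
  then have "of_int i / of_int j = (of_int i' / of_int j' :: rat)"
    using * ** by (simp add: frac_eq_eq flip: of_int_mult) (simp add: mult.commute)
  then show ?thesis using * ** by simp
qed

lemma conj_ratio_nonzero: "conj_ratio b g q \<Longrightarrow> q \<noteq> 0"
  by (auto simp: conj_ratio_def)

lemma conj_ratio_commute:
  assumes "g \<in> carrier G" "b \<in> carrier G" "i \<noteq> 0" "g \<otimes> b [^] (i::int) = b [^] i \<otimes> g"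
  shows "conj_ratio b g 1"
  unfolding conj_ratio_def using assms
  by (intro exI[of _ i]) (simp add: m_assoc)

lemma conj_ratio_mult:
  assumes "b \<in> carrier G" "g \<in> carrier G" "h \<in> carrier G" "conj_ratio b g q" "conj_ratio b h q'"
  shows "conj_ratio b (g \<otimes> h) (q * q')"
proof -
  obtain i j :: int where *: "i \<noteq> 0" "j \<noteq> 0" "g \<otimes> b [^] i \<otimes> inv g = b [^] j" "q = of_int i / of_int j"
    using assms by (auto simp: conj_ratio_def)
  obtain i' j' :: int where **: "i' \<noteq> 0" "j' \<noteq> 0" "h \<otimes> b [^] i' \<otimes> inv h = b [^] j'"
    "q' = of_int i' / of_int j'"
    using assms by (auto simp: conj_ratio_def)
  have "(g \<otimes> h) \<otimes> b [^] (i' * i) \<otimes> inv (g \<otimes> h) = g \<otimes> (h \<otimes> b [^] (i' * i) \<otimes> inv h) \<otimes> inv g"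
    using assms by (simp add: m_assoc inv_mult_group)
  also have "\<dots> = g \<otimes> b [^] (i * j') \<otimes> inv g"
    using conj_pow_eq[OF assms(3,1,1) **(3), of i] by (simp add: mult.commute)
  also have "\<dots> = b [^] (j * j')"
    using conj_pow_eq[OF assms(2,1,1) *(3), of j'] .
  finally show ?thesis
    unfolding conj_ratio_def using * **
    by (intro exI[of _ "i' * i"] exI[of _ "j * j'"]) (simp add: mult.commute)
qed

lemma conj_ratio_inv:
  assumes "b \<in> carrier G" "g \<in> carrier G" "conj_ratio b g q"
  shows "conj_ratio b (inv g) (inverse q)"
proof -
  obtain i j :: int where *: "i \<noteq> 0" "j \<noteq> 0" "g \<otimes> b [^] i \<otimes> inv g = b [^] j" "q = of_int i / of_int j"
    using assms by (auto simp: conj_ratio_def)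
  have "inv g \<otimes> b [^] j \<otimes> inv (inv g) = inv g \<otimes> (g \<otimes> b [^] i \<otimes> inv g) \<otimes> g"
    using * assms by simp
  also have "\<dots> = b [^] i" using assms by (simp add: m_assoc) (simp add: m_assoc[symmetric])
  finally show ?thesis unfolding conj_ratio_def using *
    by (intro exI[of _ j] exI[of _ i]) simp
qed

text \<open>Passing to a common power of \<open>b\<close> and \<open>d\<close> scales both exponents
  by the same factor. This makes the modular homomorphism independent of the elliptic element
  used.\<close>

lemma conj_ratio_commensurable:
  assumes "b \<in> carrier G" "d \<in> carrier G" "g \<in> carrier G" "commensurable b d" "conj_ratio b g q"
  shows "conj_ratio d g q"
proof -
  obtain i j :: int where *: "i \<noteq> 0" "j \<noteq> 0" "g \<otimes> b [^] i \<otimes> inv g = b [^] j" "q = of_int i / of_int j"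
    using assms by (auto simp: conj_ratio_def)
  obtain k l :: int where kl: "k \<noteq> 0" "l \<noteq> 0" "b [^] k = d [^] l"
    using assms by (auto simp: commensurable_def)
  have bd: "b [^] (k * x) = d [^] (l * x)" for x
    using kl assms by (metis int_pow_pow)
  have "g \<otimes> b [^] (k * i) \<otimes> inv g = b [^] (k * j)"
    using conj_pow_eq[OF assms(3,1,1) *(3), of k] by (simp add: mult.commute)
  then have "g \<otimes> d [^] (l * i) \<otimes> inv g = d [^] (l * j)"
    by (simp add: bd)
  then show ?thesis unfolding conj_ratio_def using * kl
    by (intro exI[of _ "l * i"] exI[of _ "l * j"]) simp
qed

lemma conj_ratio_generate:
  assumes "b \<in> carrier G" "S \<subseteq> carrier G" "\<And>g. g \<in> S \<Longrightarrow> \<exists>q. conj_ratio b g q"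
    and "g \<in> generate G S"
  shows "\<exists>q. conj_ratio b g q"
  using assms(4)
proof (induction rule: generate.induct)
  case one
  show ?case using conj_ratio_commute[of \<one> b 1] assms by auto
next
  case (incl h)
  then show ?case using assms by auto
next
  case (inv h)
  then show ?case using assms conj_ratio_inv by blast
next
  case (eng h1 h2)
  then show ?case using assms generate_in_carrier[of S] conj_ratio_mult by metis
qed

text \<open>Ratios and \<open>q powi h g\<close> are both multiplicative in \<open>g\<close>, so
  generators suffice. In the applications \<open>h\<close> counts stable letters with sign, possibly
  after a homomorphism.\<close>

lemma conj_ratio_powi:
  assumes "b \<in> carrier G" "S \<subseteq> carrier G" "h \<in> hom G integer_group" "q \<noteq> 0"
    and "\<And>g. g \<in> S \<Longrightarrow> conj_ratio b g (q powi h g)"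
    and "g \<in> generate G S"
  shows "conj_ratio b g (q powi h g)"
proof -
  interpret h: group_hom G integer_group h
    using assms(3) by (simp add: group_hom_def group_hom_axioms_def is_group)
  from assms(6) show ?thesis
  proof (induction rule: generate.induct)
    case one
    show ?case using conj_ratio_commute[of \<one> b 1] assms by auto
  next
    case (incl h)
    then show ?case using assms by auto
  next
    case (inv x)
    then show ?case using assms conj_ratio_inv[of b x "q powi h x"]
      by (auto simp: power_int_minus subset_iff)
  next
    case (eng h1 h2)
    then have c: "h1 \<in> carrier G" "h2 \<in> carrier G" using assms generate_in_carrier[of S] by auto
    with eng.IH conj_ratio_mult[OF assms(1) c] assms(4) show ?case
      by (simp add: power_int_add)
  qed
qed

lemma conj_ratio_hom:
  assumes "group_hom G H f" "b \<in> carrier G" "g \<in> carrier G" "conj_ratio b g q"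
  shows "group.conj_ratio H (f b) (f g) q"
proof -
  interpret f: group_hom G H f by fact
  obtain i j :: int where *: "i \<noteq> 0" "j \<noteq> 0" "g \<otimes> b [^] i \<otimes> inv g = b [^] j" "q = of_int i / of_int j"
    using assms by (auto simp: conj_ratio_def)
  have "f (g \<otimes> b [^] i \<otimes> inv g) = f (b [^] j)" using * by simp
  then have "f g \<otimes>\<^bsub>H\<^esub> f b [^]\<^bsub>H\<^esub> i \<otimes>\<^bsub>H\<^esub> inv\<^bsub>H\<^esub> (f g) = f b [^]\<^bsub>H\<^esub> j"
    using assms by (simp add: f.hom_int_pow)
  then show ?thesis unfolding f.H.conj_ratio_def using * by blast
qed

end

section \<open>Subgroups of the multiplicative group of the rationals\<close>

lemma group_rat_units: "group rat_units"
proof (rule groupI)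
  show "\<exists>y\<in>carrier rat_units. y \<otimes>\<^bsub>rat_units\<^esub> x = \<one>\<^bsub>rat_units\<^esub>" if "x \<in> carrier rat_units" for x
    using that by (intro bexI[of _ "inverse x"]) (auto simp: rat_units_def)
qed (auto simp: rat_units_def)

lemma inv_rat_units: "x \<noteq> 0 \<Longrightarrow> inv\<^bsub>rat_units\<^esub> x = inverse x"
  by (rule group.inv_equality[OF group_rat_units]) (auto simp: rat_units_def)

lemma int_pow_rat_units: "x \<noteq> 0 \<Longrightarrow> x [^]\<^bsub>rat_units\<^esub> (k::int) = x powi k"
proof -
  assume x: "x \<noteq> 0"
  interpret group rat_units by (rule group_rat_units)
  have n: "x [^]\<^bsub>rat_units\<^esub> (n::nat) = x ^ n" for n
    by (induction n) (auto simp: rat_units_def mult.commute)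
  have x': "x \<in> carrier rat_units" using x by (simp add: rat_units_def)
  obtain i where "k = int i \<or> k = - int i" by (metis int_cases2)
  then show ?thesis
    using x x' n[of i] by (auto simp: int_pow_int int_pow_neg_int inv_rat_units power_int_minus)
qed

lemma cyclic_rat_units_iff:
  assumes "subgroup D rat_units"
  shows "cyclic_group (rat_units\<lparr>carrier := D\<rparr>) \<longleftrightarrow> (\<exists>q. q \<noteq> 0 \<and> D = range (\<lambda>k. q powi k))"
proof -
  interpret group rat_units by (rule group_rat_units)
  interpret D: group "rat_units\<lparr>carrier := D\<rparr>"
    using assms subgroup.subgroup_is_group group_rat_units by blast
  have nz: "q \<noteq> 0" if "q \<in> D" for q
    using subgroup.subset[OF assms] that by (auto simp: rat_units_def)
  have "x [^]\<^bsub>rat_units\<lparr>carrier := D\<rparr>\<^esub> k = x powi k" if "x \<in> D" for x and k :: int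
    using int_pow_consistent[OF assms that, of k] int_pow_rat_units[of x k] that nz by simp
  then have "cyclic_group (rat_units\<lparr>carrier := D\<rparr>) \<longleftrightarrow> (\<exists>x\<in>D. D = range (\<lambda>k::int. x powi k))"
    by (auto simp: D.cyclic_group)
  moreover have "q \<in> range (\<lambda>k::int. q powi k)" for q :: rat
    by (rule range_eqI[of _ _ 1]) simp
  ultimately show ?thesis using nz by metis
qed

lemma subgroup_int_multiples:
  fixes D :: "int set"
  assumes "0 \<in> D" "\<And>i j. i \<in> D \<Longrightarrow> j \<in> D \<Longrightarrow> i - j \<in> D"
  obtains d where "D = range (\<lambda>k. d * k)"
proof (cases "D = {0}")
  case True
  then show thesis using that[of 0] by auto
next
  case False
  then obtain x where x: "x \<in> D" "x \<noteq> 0" using assms by auto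
  have neg: "- i \<in> D" if "i \<in> D" for i using assms(2)[OF assms(1) that] by simp
  have add: "i + j \<in> D" if "i \<in> D" "j \<in> D" for i j using assms(2)[OF that(1) neg[OF that(2)]] by simp
  define d where "d = (LEAST n::nat. 0 < n \<and> int n \<in> D)"
  have "0 < nat \<bar>x\<bar> \<and> int (nat \<bar>x\<bar>) \<in> D" using x neg by (auto simp: abs_if)
  then have d: "0 < d" "int d \<in> D" and least: "\<And>n. 0 < n \<Longrightarrow> int n \<in> D \<Longrightarrow> d \<le> n"
    unfolding d_def by (metis (mono_tags, lifting) LeastI, metis (mono_tags, lifting) LeastI)
      (metis (mono_tags, lifting) Least_le)
  have mult: "int d * k \<in> D" for k
  proof (induction k rule: int_induct[of _ 0])
    case base show ?case using assms by simp
  next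
    case (step1 i) then show ?case using add[OF d(2), of "int d * i"] by (simp add: algebra_simps)
  next
    case (step2 i) then show ?case using assms(2)[OF _ d(2)] by (simp add: algebra_simps)
  qed
  have "i \<in> range (\<lambda>k. int d * k)" if "i \<in> D" for i
  proof -
    have "i mod int d = i - int d * (i div int d)" by (simp add: minus_mult_div_eq_mod)
    then have *: "i mod int d \<in> D" using assms(2)[OF that mult] by simp
    have "i mod int d = 0"
    proof (rule ccontr)
      assume "i mod int d \<noteq> 0"
      moreover obtain n where n: "i mod int d = int n"
        using d(1) by (metis nonneg_int_cases of_nat_0_less_iff pos_mod_sign)
      moreover have "i mod int d < int d" using d(1) by simp
      ultimately show False using least[of n] * by simp
    qed
    then have "i = int d * (i div int d)" using mult_div_mod_eq[of "int d" i] by linarith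
    then show ?thesis by (rule range_eqI)
  qed
  then show thesis using that[of "int d"] mult by blast
qed

text \<open>The exponents \<open>k\<close> with \<open>q powi k\<close> in \<open>D\<close> form a
  subgroup of the integers, hence the multiples of some \<open>d\<close>, and
  \<open>q powi d\<close> generates \<open>D\<close>. This also covers 1 and -1 for
  \<open>q\<close>, where different exponents give equal powers.\<close>

lemma cyclic_rat_units_subset:
  assumes "subgroup D rat_units" "q \<noteq> 0" "D \<subseteq> range (\<lambda>k. q powi k)"
  shows "cyclic_group (rat_units\<lparr>carrier := D\<rparr>)"
proof -
  interpret D: subgroup D rat_units by fact
  define E where "E = {k. q powi k \<in> D}"
  have "0 \<in> E" using D.one_closed by (simp add: E_def rat_units_def)
  moreover have "i - j \<in> E" if "i \<in> E" "j \<in> E" for i j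
  proof -
    have "q powi i \<otimes>\<^bsub>rat_units\<^esub> inv\<^bsub>rat_units\<^esub> (q powi j) \<in> D"
      using that by (intro D.m_closed D.m_inv_closed) (simp_all add: E_def)
    then have "q powi i * inverse (q powi j) \<in> D"
      using inv_rat_units[of "q powi j"] assms(2) by (simp add: rat_units_def)
    then show ?thesis using assms(2) by (simp add: E_def power_int_diff divide_inverse)
  qed
  ultimately obtain d where d: "E = range (\<lambda>k. d * k)"
    by (rule subgroup_int_multiples)
  have "D = (\<lambda>k. q powi k) ` E" using assms(3) by (auto simp: E_def)
  also have "\<dots> = range (\<lambda>k. (q powi d) powi k)"
    by (auto simp: d image_image power_int_mult)
  finally have "D = range (\<lambda>k. (q powi d) powi k)" .
  moreover have "q powi d \<noteq> 0" using assms(2) by simp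
  ultimately show ?thesis
    unfolding cyclic_rat_units_iff[OF assms(1)] by blast
qed

section \<open>Homomorphisms out of groups given by presentations\<close>

definition word_val :: "('a, 'b) monoid_scheme \<Rightarrow> ('x \<Rightarrow> 'a) \<Rightarrow> 'x word \<Rightarrow> 'a" where
  "word_val H \<gamma> w = foldr (\<lambda>(x, b) y. (if b then \<gamma> x else inv\<^bsub>H\<^esub> (\<gamma> x)) \<otimes>\<^bsub>H\<^esub> y) w \<one>\<^bsub>H\<^esub>"

lemma word_val_simps [simp]:
  "word_val H \<gamma> [] = \<one>\<^bsub>H\<^esub>"
  "word_val H \<gamma> ((x, b) # w) = (if b then \<gamma> x else inv\<^bsub>H\<^esub> (\<gamma> x)) \<otimes>\<^bsub>H\<^esub> word_val H \<gamma> w"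
  by (simp_all add: word_val_def)

context group
begin

lemma word_val_closed:
  assumes "w \<in> words S" "\<And>x. x \<in> S \<Longrightarrow> \<gamma> x \<in> carrier G"
  shows "word_val G \<gamma> w \<in> carrier G"
  using assms by (induction w) (auto simp: words_def)

lemma word_val_append:
  assumes "u \<in> words S" "v \<in> words S" "\<And>x. x \<in> S \<Longrightarrow> \<gamma> x \<in> carrier G"
  shows "word_val G \<gamma> (u @ v) = word_val G \<gamma> u \<otimes> word_val G \<gamma> v"
  using assms(1)
proof (induction u)
  case Nil
  show ?case using word_val_closed[OF assms(2,3)] by simp
next
  case (Cons l u)
  then have "fst l \<in> S" "u \<in> words S" by (auto simp: words_def)
  then show ?case
    using Cons word_val_closed[OF assms(2,3)] word_val_closed[of u S \<gamma>] assms(3)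
    by (cases l) (auto simp: m_assoc)
qed

lemma word_val_gen_pow:
  assumes "\<gamma> x \<in> carrier G"
  shows "word_val G \<gamma> (gen_pow x k) = \<gamma> x [^] k"
proof -
  have *: "word_val G \<gamma> (replicate n (x, b)) = (if b then \<gamma> x else inv (\<gamma> x)) [^] n" for n b
  proof (induction n)
    case (Suc n)
    have "y \<otimes> y [^] n = y [^] n \<otimes> y" if "y \<in> carrier G" for y
      using that by (metis nat_pow_Suc nat_pow_Suc2)
    then show ?case using Suc assms by auto
  qed simp
  obtain n where "k = int n \<or> k = - int n \<and> 0 < n"
    by (metis int_cases2 add.inverse_neutral gr0I of_nat_0)
  then show ?thesis
  proof (elim disjE conjE)
    assume k: "k = int n"
    have "word_val G \<gamma> (gen_pow x k) = \<gamma> x [^] n"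
      by (cases "n = 0") (simp_all add: gen_pow_def * k)
    then show ?thesis by (simp add: k int_pow_int)
  next
    assume k: "k = - int n" "0 < n"
    then have "word_val G \<gamma> (gen_pow x k) = inv (\<gamma> x) [^] n"
      by (simp add: gen_pow_def *)
    then show ?thesis using assms k by (simp add: nat_pow_inv int_pow_neg_int)
  qed
qed

text \<open>A chain of \<open>word_eq\<close> steps may pass through words with letters outside the
  generating set, which is why \<open>\<gamma>\<close> takes values in the carrier on the whole
  type.\<close>

lemma word_val_word_eq:
  assumes "word_eq R u v" "\<And>x. \<gamma> x \<in> carrier G"
    "\<And>l r. (l, r) \<in> R \<Longrightarrow> word_val G \<gamma> l = word_val G \<gamma> r"
  shows "word_val G \<gamma> u = word_val G \<gamma> v"
proof -
  have cl: "word_val G \<gamma> w \<in> carrier G" for w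
    using assms(2) word_val_closed[of w UNIV] by (auto simp: words_def)
  have app: "word_val G \<gamma> (u @ v) = word_val G \<gamma> u \<otimes> word_val G \<gamma> v" for u v
    using assms(2) word_val_append[of u UNIV] by (auto simp: words_def)
  have canc: "word_val G \<gamma> [(x, b), (x, \<not> b)] = \<one>" for x b
    using assms(2) by (cases b) auto
  show ?thesis
    using assms(1)
  proof (induction rule: word_eq.induct)
    case (cancel u x b v)
    show ?case by (simp only: app canc cl l_one)
  next
    case (relation l r u v)
    then show ?case by (simp only: app assms(3))
  qed simp_all
qed

end

definition pres_gen :: "'x set \<Rightarrow> ('x word \<times> 'x word) set \<Rightarrow> 'x \<Rightarrow> 'x word set" where
  "pres_gen S R x = word_rel S R `` {[(x, True)]}"

lemma carrier_presented_group: "carrier (presented_group S R) = (\<lambda>w. word_rel S R `` {w}) ` words S"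
  by (auto simp: presented_group_def quotient_def)

lemma one_presented_group: "\<one>\<^bsub>presented_group S R\<^esub> = word_rel S R `` {[]}"
  by (simp add: presented_group_def)

lemma pres_gen_closed: "x \<in> S \<Longrightarrow> pres_gen S R x \<in> carrier (presented_group S R)"
  by (auto simp: carrier_presented_group pres_gen_def words_def)

lemma inv_pres_gen:
  assumes "x \<in> S"
  shows "inv\<^bsub>presented_group S R\<^esub> (pres_gen S R x) = word_rel S R `` {[(x, False)]}"
proof -
  interpret group "presented_group S R" by (rule group_presented_group)
  have w: "[(x, False)] \<in> words S" "[(x, True)] \<in> words S" using assms by (auto simp: words_def)
  have "word_rel S R `` {[(x, False)] @ [(x, True)]} = word_rel S R `` {[]}"
    using assms word_eq.cancel[of R "[]" x False "[]"]
    by (intro equiv_class_eq[OF equiv_word_rel]) (auto simp: word_rel_def words_def)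
  then have "word_rel S R `` {[(x, False)]} \<otimes>\<^bsub>presented_group S R\<^esub> pres_gen S R x =
      \<one>\<^bsub>presented_group S R\<^esub>"
    unfolding pres_gen_def using presented_group_mult[OF w] by (simp add: one_presented_group)
  moreover have "word_rel S R `` {[(x, False)]} \<in> carrier (presented_group S R)"
    using w by (auto simp: carrier_presented_group)
  ultimately show ?thesis
    using pres_gen_closed[OF assms] by (intro inv_equality) auto
qed

lemma word_val_pres_gen:
  assumes "w \<in> words S"
  shows "word_val (presented_group S R) (pres_gen S R) w = word_rel S R `` {w}"
  using assms
proof (induction w)
  case Nil
  show ?case by (simp add: one_presented_group)
next
  case (Cons l w)
  obtain x b where l: "l = (x, b)" by (cases l)
  with Cons.prems have x: "x \<in> S" "[(x, b)] \<in> words S" "w \<in> words S" by (auto simp: words_def)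
  have "(if b then pres_gen S R x else inv\<^bsub>presented_group S R\<^esub> (pres_gen S R x)) =
      word_rel S R `` {[(x, b)]}"
    using inv_pres_gen[OF x(1), of R] by (simp add: pres_gen_def)
  then show ?case using Cons.IH[OF x(3)] presented_group_mult[OF x(2,3), of R] by (simp add: l)
qed

lemma presented_group_relation:
  assumes "(l, r) \<in> R" "l \<in> words S" "r \<in> words S"
  shows "word_val (presented_group S R) (pres_gen S R) l =
    word_val (presented_group S R) (pres_gen S R) r"
proof -
  have "(l, r) \<in> word_rel S R"
    using assms word_eq.relation[of l r R "[]" "[]"] by (auto simp: word_rel_def)
  then show ?thesis
    using assms equiv_class_eq[OF equiv_word_rel] by (simp add: word_val_pres_gen)
qed

lemma (in group) word_val_generate:
  assumes "w \<in> words S"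
  shows "word_val G \<gamma> w \<in> generate G (\<gamma> ` S)"
  using assms
proof (induction w)
  case Nil
  show ?case by (simp add: generate.one)
next
  case (Cons l w)
  then have "fst l \<in> S" "w \<in> words S" by (auto simp: words_def)
  then show ?case using Cons.IH
    by (cases l) (auto intro: generate.intros)
qed

lemma generate_presented_group:
  "generate (presented_group S R) (pres_gen S R ` S) = carrier (presented_group S R)"
proof
  interpret group "presented_group S R" by (rule group_presented_group)
  show "generate (presented_group S R) (pres_gen S R ` S) \<subseteq> carrier (presented_group S R)"
    using pres_gen_closed by (intro generate_incl) auto
  show "carrier (presented_group S R) \<subseteq> generate (presented_group S R) (pres_gen S R ` S)"
    using word_val_generate[of _ S "pres_gen S R"] word_val_pres_gen[of _ S R]
    by (auto simp: carrier_presented_group)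
qed

lemma presented_group_hom:
  assumes "group H" "\<And>x. \<gamma> x \<in> carrier H"
    "\<And>l r. (l, r) \<in> R \<Longrightarrow> word_val H \<gamma> l = word_val H \<gamma> r"
  obtains f where "f \<in> hom (presented_group S R) H" "\<And>x. x \<in> S \<Longrightarrow> f (pres_gen S R x) = \<gamma> x"
proof -
  interpret H: group H by fact
  \<comment> \<open>A class is evaluated on a chosen representative; \<open>word_val_word_eq\<close>
    shows that the choice does not matter.\<close>
  define f where "f A = word_val H \<gamma> (SOME w. w \<in> A)" for A
  have f: "f (word_rel S R `` {w}) = word_val H \<gamma> w" if "w \<in> words S" for w
  proof -
    have "w \<in> word_rel S R `` {w}" using that by (auto simp: word_rel_def intro: word_eq.refl)
    then have "(SOME w'. w' \<in> word_rel S R `` {w}) \<in> word_rel S R `` {w}" by (rule someI)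
    then have "(w, SOME w'. w' \<in> word_rel S R `` {w}) \<in> word_rel S R" by blast
    then have "word_eq R w (SOME w'. w' \<in> word_rel S R `` {w})"
      by (auto simp only: word_rel_def mem_Collect_eq prod.case)
    from H.word_val_word_eq[OF this assms(2,3)] show ?thesis by (simp add: f_def)
  qed
  have "f \<in> hom (presented_group S R) H"
  proof (rule homI)
    show "f A \<in> carrier H" if "A \<in> carrier (presented_group S R)" for A
      using that assms(2) H.word_val_closed by (fastforce simp: carrier_presented_group f)
    show "f (A \<otimes>\<^bsub>presented_group S R\<^esub> B) = f A \<otimes>\<^bsub>H\<^esub> f B"
      if AB: "A \<in> carrier (presented_group S R)" "B \<in> carrier (presented_group S R)" for A B
    proof -
      obtain u v where "u \<in> words S" "v \<in> words S" "A = word_rel S R `` {u}" "B = word_rel S R `` {v}"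
        using AB by (auto simp: carrier_presented_group)
      then show ?thesis
        using assms(2) H.word_val_append[of u S v \<gamma>]
        by (simp add: presented_group_mult f words_append)
    qed
  qed
  moreover have "f (pres_gen S R x) = \<gamma> x" if "x \<in> S" for x
    using that f[of "[(x, True)]"] assms(2) by (simp add: pres_gen_def words_def)
  ultimately show thesis by (rule that)
qed

section \<open>The presentation of Baumslag-Solitar groups\<close>

definition bs_gen :: "int \<Rightarrow> int \<Rightarrow> bs_gen \<Rightarrow> bs_gen word set" where
  "bs_gen m n = pres_gen UNIV
    {([(BS_t, True)] @ gen_pow BS_a m @ [(BS_t, False)], gen_pow BS_a n)}"

abbreviation bs_a :: "int \<Rightarrow> int \<Rightarrow> bs_gen word set" where "bs_a m n \<equiv> bs_gen m n BS_a"
abbreviation bs_t :: "int \<Rightarrow> int \<Rightarrow> bs_gen word set" where "bs_t m n \<equiv> bs_gen m n BS_t"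

lemma group_BS [simp]: "group (BS m n)"
  by (simp add: BS_def group_presented_group)

lemma bs_gen_closed [simp]: "bs_gen m n x \<in> carrier (BS m n)"
  by (simp add: BS_def bs_gen_def pres_gen_closed)

lemma UNIV_bs_gen: "(UNIV :: bs_gen set) = {BS_a, BS_t}"
  using bs_gen.exhaust by auto

lemma generate_BS: "generate (BS m n) {bs_a m n, bs_t m n} = carrier (BS m n)"
  using generate_presented_group[of UNIV "{([(BS_t, True)] @ gen_pow BS_a m @ [(BS_t, False)], gen_pow BS_a n)}"]
  by (simp add: BS_def bs_gen_def UNIV_bs_gen)

lemma words_UNIV [simp]: "w \<in> words UNIV"
  by (simp add: words_def)

lemma (in group) word_val_conj_gen_pow:
  assumes "\<And>x. x \<in> {y, z} \<Longrightarrow> \<gamma> x \<in> carrier G"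
  shows "word_val G \<gamma> ([(y, True)] @ gen_pow z k @ [(y, False)]) = \<gamma> y \<otimes> \<gamma> z [^] k \<otimes> inv (\<gamma> y)"
proof -
  have w: "[(y, True)] \<in> words {y, z}" "gen_pow z k \<in> words {y, z}" "[(y, False)] \<in> words {y, z}"
    by (auto simp: words_def gen_pow_def)
  have "word_val G \<gamma> ([(y, True)] @ gen_pow z k @ [(y, False)]) =
      word_val G \<gamma> [(y, True)] \<otimes> (word_val G \<gamma> (gen_pow z k) \<otimes> word_val G \<gamma> [(y, False)])"
    using w assms word_val_append[of _ "{y, z}" _ \<gamma>] by (metis words_append)
  then show ?thesis using assms by (simp add: word_val_gen_pow m_assoc)
qed

lemma BS_relation:
  "bs_t m n \<otimes>\<^bsub>BS m n\<^esub> bs_a m n [^]\<^bsub>BS m n\<^esub> m \<otimes>\<^bsub>BS m n\<^esub> inv\<^bsub>BS m n\<^esub> bs_t m n =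
    bs_a m n [^]\<^bsub>BS m n\<^esub> n"
proof -
  interpret group "BS m n" by simp
  have "word_val (BS m n) (bs_gen m n) ([(BS_t, True)] @ gen_pow BS_a m @ [(BS_t, False)]) =
      word_val (BS m n) (bs_gen m n) (gen_pow BS_a n)"
    unfolding BS_def bs_gen_def by (rule presented_group_relation) auto
  then show ?thesis
    by (simp add: word_val_conj_gen_pow word_val_gen_pow del: append_Cons append_Nil)
qed

lemma BS_hom:
  assumes "group H" "\<alpha> \<in> carrier H" "\<tau> \<in> carrier H"
    "\<tau> \<otimes>\<^bsub>H\<^esub> \<alpha> [^]\<^bsub>H\<^esub> m \<otimes>\<^bsub>H\<^esub> inv\<^bsub>H\<^esub> \<tau> = \<alpha> [^]\<^bsub>H\<^esub> n"
  obtains f where "f \<in> hom (BS m n) H" "f (bs_a m n) = \<alpha>" "f (bs_t m n) = \<tau>"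
proof -
  interpret H: group H by fact
  define \<gamma> where "\<gamma> x = (case x of BS_a \<Rightarrow> \<alpha> | BS_t \<Rightarrow> \<tau>)" for x
  have cl: "\<gamma> x \<in> carrier H" for x using assms by (cases x) (auto simp: \<gamma>_def)
  obtain f where "f \<in> hom (BS m n) H" "\<And>x. f (bs_gen m n x) = \<gamma> x"
  proof (rule presented_group_hom[OF assms(1), of \<gamma>, where S = UNIV and
        R = "{([(BS_t, True)] @ gen_pow BS_a m @ [(BS_t, False)], gen_pow BS_a n)}"])
    show "word_val H \<gamma> u = word_val H \<gamma> v"
      if "(u, v) \<in> {([(BS_t, True)] @ gen_pow BS_a m @ [(BS_t, False)], gen_pow BS_a n)}" for u v
      using that assms cl
      by (auto simp: H.word_val_conj_gen_pow H.word_val_gen_pow \<gamma>_def simp del: append_Cons append_Nil)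
  qed (auto simp: cl BS_def bs_gen_def)
  then show thesis using that by (simp add: \<gamma>_def)
qed

lemma abs_eq_1_of_power_int_eq_1:
  fixes x :: "'a :: linordered_field"
  assumes "x powi k = 1" "k \<noteq> 0"
  shows "\<bar>x\<bar> = 1"
proof -
  obtain n where n: "k = int n \<or> k = - int n" "n > 0" using assms(2) by (metis int_cases2 gr0I of_nat_0 neg_0_equal_iff_equal)
  have "\<bar>x\<bar> powi k = 1" using assms(1) by (metis abs_1 power_int_abs)
  then have "\<bar>x\<bar> ^ n = 1 ^ n"
    using n by (auto simp: power_int_minus)
  then show ?thesis using n(2) by (subst (asm) power_eq_iff_eq_base) auto
qed

section \<open>Permutation groups\<close>

definition perm_group :: "('y \<Rightarrow> 'y) monoid" where
  "perm_group = \<lparr>carrier = {f. bij f}, monoid.mult = (\<circ>), one = id\<rparr>"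

lemma perm_group_simps [simp]:
  "f \<in> carrier perm_group \<longleftrightarrow> bij f"
  "f \<otimes>\<^bsub>perm_group\<^esub> g = f \<circ> g"
  "\<one>\<^bsub>perm_group\<^esub> = id"
  by (simp_all add: perm_group_def)

lemma group_perm_group [simp]: "group perm_group"
proof (rule groupI)
  show "\<exists>y\<in>carrier perm_group. y \<otimes>\<^bsub>perm_group\<^esub> x = \<one>\<^bsub>perm_group\<^esub>" if "x \<in> carrier perm_group" for x :: "'y \<Rightarrow> 'y"
    using that by (intro bexI[of _ "Hilbert_Choice.inv x"]) (auto simp: bij_imp_bij_inv bij_is_inj)
qed (auto simp: bij_comp o_assoc)

lemma inv_perm_group: "f \<circ> g = id \<Longrightarrow> g \<circ> f = id \<Longrightarrow> inv\<^bsub>perm_group\<^esub> f = g"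
  by (rule group.inv_equality) (auto simp: o_bij)

lemma int_pow_perm_group:
  assumes "F 0 = id" "\<And>i j. F i \<circ> F j = F (i + j)"
  shows "F (1::int) [^]\<^bsub>perm_group\<^esub> (k::int) = F k"
proof -
  interpret group "perm_group :: ('a \<Rightarrow> 'a) monoid" by simp
  have bij: "bij (F i)" for i
    using assms(2)[of i "- i"] assms(2)[of "- i" i] assms(1) by (auto intro: o_bij)
  have nat: "F 1 [^]\<^bsub>perm_group\<^esub> (j::nat) = F (int j)" for j
    by (induction j) (auto simp: assms nat_pow_Suc add.commute)
  obtain j where "k = int j \<or> k = - int j" by (metis int_cases2)
  then show ?thesis
  proof
    assume k: "k = - int j"
    have "inv\<^bsub>perm_group\<^esub> (F (int j)) = F (- int j)"
      by (rule inv_perm_group) (simp_all add: assms)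
    then show ?thesis using bij int_pow_neg_int[of "F 1" j] by (simp add: k nat)
  qed (simp add: int_pow_int nat)
qed

section \<open>A permutation representation of Baumslag-Solitar groups\<close>

text \<open>
  Vertices of the Bass-Serre tree are coded by the labels along the path to a base vertex:
  \<open>Out r\<close> and \<open>In r\<close> record that the last edge of the path was traversed by \<open>t\<close>,
  respectively \<open>t\<^sup>-\<^sup>1\<close>, from the residue class of \<open>r\<close>. Each vertex carries a copy of
  \<open>\<int>\<close>, translated by \<open>a\<close>. Residues are those of \<open>mod\<close>, so they have the sign of \<open>m\<close> or \<open>n\<close>.
\<close>

datatype slot = Out int | In int

fun is_Out :: "slot list \<Rightarrow> bool" where
  "is_Out (Out r # w) = True" | "is_Out w = False"

fun is_In :: "slot list \<Rightarrow> bool" where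
  "is_In (In r # w) = True" | "is_In w = False"

text \<open>Paths without backtracking: \<open>Out 0\<close> directly after an \<open>In\<close>, or
  \<open>In 0\<close> directly after an \<open>Out\<close>, would go back along the edge just
  crossed. Together with reduced residues this gives each vertex one code.\<close>

fun nf :: "int \<Rightarrow> int \<Rightarrow> slot list \<Rightarrow> bool" where
  "nf m n [] = True"
| "nf m n (Out r # w) = (r mod m = r \<and> nf m n w \<and> \<not> (r = 0 \<and> is_In w))"
| "nf m n (In r # w) = (r mod n = r \<and> nf m n w \<and> \<not> (r = 0 \<and> is_Out w))"

text \<open>Words violating \<open>nf\<close> are fixed, so that this map and the two below are
  permutations of the whole type, as \<open>perm_group\<close> requires.\<close>

definition shift_act :: "int \<Rightarrow> int \<Rightarrow> int \<Rightarrow> slot list \<times> int \<Rightarrow> slot list \<times> int" where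
  "shift_act m n i = (\<lambda>(w, j). if nf m n w then (w, j + i) else (w, j))"

text \<open>The quotient \<open>j div m\<close> is carried over as a multiple of \<open>n\<close>,
  which forces \<open>t a^m t^-1\<close> to act as \<open>a^n\<close>; the remainder becomes a new
  label. Remainder 0 after \<open>In r\<close> means crossing the last edge back, so the label is
  removed and \<open>r\<close> restored.\<close>

definition up_act :: "int \<Rightarrow> int \<Rightarrow> slot list \<times> int \<Rightarrow> slot list \<times> int" where
  "up_act m n = (\<lambda>(w, j). if nf m n w then
      (case w of In r # w' \<Rightarrow> if j mod m = 0 then (w', n * (j div m) + r)
          else (Out (j mod m) # w, n * (j div m))
        | _ \<Rightarrow> (Out (j mod m) # w, n * (j div m)))
    else (w, j))"

definition down_act :: "int \<Rightarrow> int \<Rightarrow> slot list \<times> int \<Rightarrow> slot list \<times> int" where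
  "down_act m n = (\<lambda>(w, j). if nf m n w then
      (case w of Out r # w' \<Rightarrow> if j mod n = 0 then (w', m * (j div n) + r)
          else (In (j mod n) # w, m * (j div n))
        | _ \<Rightarrow> (In (j mod n) # w, m * (j div n)))
    else (w, j))"

lemma div_of_mod_eq: "(r::int) mod m = r \<Longrightarrow> m \<noteq> 0 \<Longrightarrow> r div m = 0"
  by (metis mod_div_trivial)

lemma up_down:
  assumes "m \<noteq> 0" "n \<noteq> 0"
  shows "up_act m n (down_act m n x) = x"
proof -
  obtain w j where x: "x = (w, j)" by (cases x)
  have j: "n * (j div n) = j" if "j mod n = 0" using that by auto
  have jj: "n * (j div n) + j mod n = j" by simp
  show ?thesis
  proof (cases "nf m n w")
    case True
    show ?thesis
    proof (cases w)
      case (Cons s w')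
      then show ?thesis using True assms j jj
        by (cases s; cases w' rule: is_In.cases)
          (auto simp: x up_act_def down_act_def div_of_mod_eq split: list.splits slot.splits)
    qed (use True assms jj in \<open>auto simp: x up_act_def down_act_def\<close>)
  qed (simp add: x up_act_def down_act_def)
qed

lemma down_up:
  assumes "m \<noteq> 0" "n \<noteq> 0"
  shows "down_act m n (up_act m n x) = x"
proof -
  obtain w j where x: "x = (w, j)" by (cases x)
  have j: "m * (j div m) = j" if "j mod m = 0" using that by auto
  have jj: "m * (j div m) + j mod m = j" by simp
  show ?thesis
  proof (cases "nf m n w")
    case True
    show ?thesis
    proof (cases w)
      case (Cons s w')
      then show ?thesis using True assms j jj
        by (cases s; cases w' rule: is_In.cases)
          (auto simp: x up_act_def down_act_def div_of_mod_eq split: list.splits slot.splits)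
    qed (use True assms jj in \<open>auto simp: x up_act_def down_act_def\<close>)
  qed (simp add: x up_act_def down_act_def)
qed

lemma shift_act_pow: "shift_act m n 1 [^]\<^bsub>perm_group\<^esub> (k::int) = shift_act m n k"
  by (rule int_pow_perm_group) (auto simp: shift_act_def fun_eq_iff add_ac)

lemma bij_shift_act: "bij (shift_act m n i)"
  by (rule o_bij[where g = "shift_act m n (- i)"]) (auto simp: shift_act_def fun_eq_iff)

lemma bij_up_act: "m \<noteq> 0 \<Longrightarrow> n \<noteq> 0 \<Longrightarrow> bij (up_act m n)"
  by (rule o_bij[where g = "down_act m n"]) (auto simp: fun_eq_iff up_down down_up)

lemma inv_up_act: "m \<noteq> 0 \<Longrightarrow> n \<noteq> 0 \<Longrightarrow> inv\<^bsub>perm_group\<^esub> (up_act m n) = down_act m n"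
  by (rule inv_perm_group) (auto simp: fun_eq_iff up_down down_up)

lemma nf_up_act: "nf m n w \<Longrightarrow> nf m n (fst (up_act m n (w, j)))"
  by (auto simp: up_act_def split: list.splits slot.splits)

lemma up_shift:
  assumes "m \<noteq> 0" "n \<noteq> 0"
  shows "up_act m n (shift_act m n m x) = shift_act m n n (up_act m n x)"
proof -
  obtain w j where x: "x = (w, j)" by (cases x)
  show ?thesis
  proof (cases "nf m n w")
    case True
    then have *: "nf m n (fst (up_act m n (w, j)))" by (rule nf_up_act)
    have "shift_act m n n (up_act m n (w, j)) = (fst (up_act m n (w, j)), snd (up_act m n (w, j)) + n)"
      using * by (auto simp: shift_act_def split: prod.split)
    moreover have "up_act m n (w, j + m) = (fst (up_act m n (w, j)), snd (up_act m n (w, j)) + n)"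
      using True assms by (auto simp: up_act_def algebra_simps split: list.splits slot.splits)
    ultimately show ?thesis using True by (simp add: x shift_act_def)
  qed (simp add: x shift_act_def up_act_def)
qed

text \<open>Relation and generation bound the group from above; \<open>act\<close> and the exponent
  sum \<open>ht\<close> in \<open>t\<close> detect non-triviality. Working from these facts keeps
  classes of words out of the arguments.\<close>

locale bs_pair = group +
  fixes a t :: 'a and m n :: int
    and act :: "'a \<Rightarrow> slot list \<times> int \<Rightarrow> slot list \<times> int" and ht :: "'a \<Rightarrow> int"
  assumes a_closed [simp]: "a \<in> carrier G" and t_closed [simp]: "t \<in> carrier G"
    and nonzero: "m \<noteq> 0" "n \<noteq> 0"
    and rel: "t \<otimes> a [^] m \<otimes> inv t = a [^] n"
    and gen: "generate G {a, t} = carrier G"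
    and act_hom: "act \<in> hom G perm_group" and act_a: "act a = shift_act m n 1" and act_t: "act t = up_act m n"
    and ht_hom: "ht \<in> hom G integer_group" and ht_a: "ht a = 0" and ht_t: "ht t = 1"

lemma bs_pair_BS:
  assumes "m \<noteq> 0" "n \<noteq> 0"
  obtains act ht where "bs_pair (BS m n) (bs_a m n) (bs_t m n) m n act ht"
proof -
  let ?P = "perm_group :: (slot list \<times> int \<Rightarrow> slot list \<times> int) monoid"
  have "up_act m n \<otimes>\<^bsub>?P\<^esub> shift_act m n 1 [^]\<^bsub>?P\<^esub> m \<otimes>\<^bsub>?P\<^esub> inv\<^bsub>?P\<^esub> (up_act m n) =
      shift_act m n 1 [^]\<^bsub>?P\<^esub> n"
    using assms by (simp add: inv_up_act shift_act_pow fun_eq_iff up_shift up_down)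
  then obtain act where act: "act \<in> hom (BS m n) ?P" "act (bs_a m n) = shift_act m n 1" "act (bs_t m n) = up_act m n"
    using BS_hom[of ?P "shift_act m n 1" "up_act m n" m n] assms by (auto simp: bij_shift_act bij_up_act)
  obtain ht where ht: "ht \<in> hom (BS m n) integer_group" "ht (bs_a m n) = 0" "ht (bs_t m n) = 1"
    using BS_hom[of integer_group 0 1 m n] by auto
  have "bs_pair (BS m n) (bs_a m n) (bs_t m n) m n act ht"
    unfolding bs_pair_def bs_pair_axioms_def using act ht assms BS_relation generate_BS by auto
  then show thesis by (rule that)
qed

context bs_pair
begin

sublocale act: group_hom G perm_group act
  by (simp add: group_hom_def group_hom_axioms_def act_hom is_group)

sublocale ht: group_hom G integer_group ht
  by (simp add: group_hom_def group_hom_axioms_def ht_hom is_group)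

lemma act_a_pow: "act (a [^] (i::int)) = shift_act m n i"
  by (simp add: act.hom_int_pow act_a shift_act_pow)

lemma act_inv_t: "act (inv t) = down_act m n"
  by (simp add: act_t inv_up_act nonzero)

lemma inf_order_a: "inf_order a"
proof -
  have "i = 0" if "a [^] i = \<one>" for i :: int
  proof -
    have "shift_act m n i ([], 0) = ([], 0)" using act_a_pow[of i] that by simp
    then show ?thesis by (simp add: shift_act_def)
  qed
  then show ?thesis by (simp add: inf_order_def)
qed

lemma conj_ratio_ht:
  assumes "g \<in> carrier G"
  shows "conj_ratio a g ((of_int m / of_int n) powi ht g)"
proof (rule conj_ratio_powi)
  show "g \<in> generate G {a, t}" using assms by (simp add: gen)
  show "conj_ratio a g ((of_int m / of_int n) powi ht g)" if "g \<in> {a, t}" for g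
  proof (cases "g = a")
    case True
    then show ?thesis using conj_ratio_commute[of a a 1] by (simp add: ht_a)
  next
    case False
    with that have "g = t" by simp
    then show ?thesis using rel nonzero by (auto simp: conj_ratio_def ht_t)
  qed
qed (use nonzero ht_hom in auto)


section \<open>Words in \<open>t\<close> and \<open>a\<close>: reduced forms and translation
  lengths\<close>

fun sval :: "(bool \<times> int) list \<Rightarrow> 'a" where
  "sval [] = \<one>"
| "sval ((e, i) # ps) = (if e then t else inv t) \<otimes> a [^] i \<otimes> sval ps"

text \<open>The subwords \<open>t a^i t^-1\<close> and \<open>t^-1 a^i t\<close> that the defining
  relation contracts to a power of \<open>a\<close>.\<close>

fun pinch :: "bool \<times> int \<Rightarrow> bool \<times> int \<Rightarrow> bool" where
  "pinch (e, i) (e', i') \<longleftrightarrow> e \<noteq> e' \<and> (if e then m dvd i else n dvd i)"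

abbreviation reduced :: "(bool \<times> int) list \<Rightarrow> bool" where
  "reduced \<equiv> successively (\<lambda>x y. \<not> pinch x y)"

lemma sval_closed [simp]: "sval ps \<in> carrier G"
  by (induction ps rule: sval.induct) auto

lemma sval_append: "sval (ps @ qs) = sval ps \<otimes> sval qs"
  by (induction ps rule: sval.induct) (auto simp: m_assoc)

lemma pinch_sval:
  assumes "pinch x y"
  obtains k where "sval (x # y # zs) = a [^] (k::int) \<otimes> sval zs"
proof -
  obtain e i e' i' where xy: "x = (e, i)" "y = (e', i')" by (cases x, cases y)
  have rel': "inv t \<otimes> a [^] n \<otimes> t = a [^] m"
    unfolding rel[symmetric] by (simp add: m_assoc inv_solve_left')
  have up: "t \<otimes> a [^] (m * j) \<otimes> inv t = a [^] (n * j)" for j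
    using conj_pow_eq[of t a a m n j] rel by simp
  have down: "inv t \<otimes> a [^] (n * j) \<otimes> t = a [^] (m * j)" for j
    using conj_pow_eq[of "inv t" a a n m j] rel' by simp
  show thesis
  proof (cases e)
    case True
    with assms xy obtain j where j: "i = m * j" "\<not> e'" by auto
    have "sval (x # y # zs) = (t \<otimes> a [^] (m * j) \<otimes> inv t) \<otimes> a [^] i' \<otimes> sval zs"
      using True j by (simp add: xy m_assoc)
    then show thesis using that[of "n * j + i'"] by (simp add: up int_pow_mult)
  next
    case False
    with assms xy obtain j where j: "i = n * j" "e'" by auto
    have "sval (x # y # zs) = (inv t \<otimes> a [^] (n * j) \<otimes> t) \<otimes> a [^] i' \<otimes> sval zs"
      using False j by (simp add: xy m_assoc)
    then show thesis using that[of "m * j + i'"] by (simp add: down int_pow_mult)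
  qed
qed

lemma act_sval_Cons:
  "act (sval ((e, i) # ps)) x = (if e then up_act m n else down_act m n) (shift_act m n i (act (sval ps) x))"
  by (simp add: act_a_pow act_inv_t act_t)

text \<open>This is Britton's lemma.\<close>

lemma act_sval_reduced:
  assumes "reduced ps" "ps \<noteq> []"
  shows "\<exists>w j'. act (sval ps) ([], j) = (w, j') \<and> nf m n w \<and> length w = length ps \<and>
    (if fst (hd ps) then is_Out w \<and> n dvd j' else is_In w \<and> m dvd j')"
  using assms(2,1)
proof (induction ps rule: list_nonempty_induct)
  case (single x)
  obtain e i where "x = (e, i)" by (cases x)
  then show ?case
    by (auto simp: act_sval_Cons up_act_def down_act_def shift_act_def simp del: sval.simps(2))
next
  case (cons x xs)
  obtain e i where x: "x = (e, i)" by (cases x)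
  obtain e' i' ys where xs: "xs = (e', i') # ys" using cons by (cases xs) auto
  have np: "\<not> pinch (e, i) (e', i')" using cons.prems by (simp add: x xs)
  obtain w j' where w: "act (sval xs) ([], j) = (w, j')" "nf m n w" "length w = length xs"
    "if e' then is_Out w \<and> n dvd j' else is_In w \<and> m dvd j'"
    using cons by (auto simp: xs)
  have s: "act (sval (x # xs)) ([], j) = (if e then up_act m n else down_act m n) (w, j' + i)"
    unfolding x act_sval_Cons w(1) using w(2) by (simp add: shift_act_def)
  have not_both: "\<not> (is_In w \<and> is_Out w)" by (cases w rule: is_In.cases) auto
  \<comment> \<open>After \<open>t^-1\<close> the coordinate is a multiple of \<open>m\<close>, so
    removing a label would need \<open>m dvd i\<close>, a pinch. Hence every letter adds a label;
    the divisibility clause of the claim is there for this.\<close>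
  have up: "(j' + i) mod m \<noteq> 0" if "e" "is_In w"
  proof
    assume "(j' + i) mod m = 0"
    moreover have "\<not> e'" "m dvd j'" using w(4) that not_both by (auto split: if_splits)
    ultimately have "m dvd i" by (simp add: dvd_add_right_iff mod_eq_0_iff_dvd)
    then show False using np that \<open>\<not> e'\<close> by simp
  qed
  have down: "(j' + i) mod n \<noteq> 0" if "\<not> e" "is_Out w"
  proof
    assume "(j' + i) mod n = 0"
    moreover have "e'" "n dvd j'" using w(4) that not_both by (auto split: if_splits)
    ultimately have "n dvd i" by (simp add: dvd_add_right_iff mod_eq_0_iff_dvd)
    then show False using np that \<open>e'\<close> by simp
  qed
  show ?case
  proof (cases w)
    case Nil
    with w show ?thesis by (simp add: xs)
  next
    case (Cons sl w')
    then show ?thesis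
      unfolding s using w(2,3) up down
      by (cases sl; cases e) (simp_all add: up_act_def down_act_def x)
  qed
qed

lemma length_act_sval: "length (fst (act (sval ps) (w, j))) \<le> length w + length ps"
proof (induction ps)
  case (Cons x ps)
  obtain e i where x: "x = (e, i)" by (cases x)
  obtain w' j' where w': "act (sval ps) (w, j) = (w', j')" by (cases "act (sval ps) (w, j)")
  have "length (fst ((if e then up_act m n else down_act m n) (shift_act m n i (w', j')))) \<le> Suc (length w')"
    by (auto simp: up_act_def down_act_def shift_act_def split: list.splits slot.splits)
  then show ?case using Cons.IH unfolding x act_sval_Cons w' by simp
qed simp

text \<open>Minimality is not demanded, so \<open>k\<close> only bounds the displacement of the base
  vertex from above. The leading power of \<open>a\<close>, which \<open>sval\<close> cannot
  express, is kept apart.\<close>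

definition t_len :: "nat \<Rightarrow> 'a \<Rightarrow> bool" where
  "t_len k g \<longleftrightarrow> (\<exists>(i::int) ps. length ps = k \<and> g = a [^] i \<otimes> sval ps)"

text \<open>A power of \<open>a\<close> on the right is absorbed by the exponent of the last letter.
  That the leading exponent survives when there is a letter allows it later to be moved to the end
  by conjugation.\<close>

lemma sval_mult_pow:
  "\<exists>(i'::int) ps'. length ps' = length ps \<and> a [^] (i::int) \<otimes> sval ps \<otimes> a [^] (j::int) = a [^] i' \<otimes> sval ps' \<and>
    (ps \<noteq> [] \<longrightarrow> i' = i)"
proof (induction ps arbitrary: i)
  case Nil
  show ?case by (intro exI[of _ "i + j"] exI[of _ "[]"]) (simp add: int_pow_mult)
next
  case (Cons x ps)
  obtain e k where x: "x = (e, k)" by (cases x)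
  from Cons[of k] obtain i' ps' where "length ps' = length ps"
    "a [^] k \<otimes> sval ps \<otimes> a [^] j = a [^] (i'::int) \<otimes> sval ps'" by blast
  then show ?case
    by (intro exI[of _ i] exI[of _ "(e, i') # ps'"]) (simp add: x m_assoc)
qed

lemma t_len_mult:
  assumes "t_len k g" "t_len l h"
  shows "t_len (k + l) (g \<otimes> h)"
proof -
  obtain i j :: int and ps qs where *: "length ps = k" "g = a [^] i \<otimes> sval ps" "length qs = l" "h = a [^] j \<otimes> sval qs"
    using assms by (auto simp: t_len_def)
  obtain i' ps' where **: "length ps' = length ps" "a [^] i \<otimes> sval ps \<otimes> a [^] j = a [^] (i'::int) \<otimes> sval ps'"
    using sval_mult_pow[of ps i j] by blast
  have "g \<otimes> h = (a [^] i \<otimes> sval ps \<otimes> a [^] j) \<otimes> sval qs"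
    by (simp add: * m_assoc)
  also have "\<dots> = a [^] i' \<otimes> sval (ps' @ qs)"
    unfolding ** by (simp add: sval_append m_assoc)
  finally show ?thesis
    unfolding t_len_def using * ** by (intro exI[of _ i'] exI[of _ "ps' @ qs"]) simp
qed

lemma t_len_closed: "t_len k g \<Longrightarrow> g \<in> carrier G"
  by (auto simp: t_len_def)

lemma t_len_pow: "t_len 0 (a [^] (i::int))"
  unfolding t_len_def by (intro exI[of _ i] exI[of _ "[]"]) simp

lemma t_len_letter: "t_len 1 (if e then t else inv t)"
  unfolding t_len_def by (intro exI[of _ 0] exI[of _ "[(e, 0)]"]) simp

lemma t_len_inv:
  assumes "t_len k g"
  shows "t_len k (inv g)"
proof -
  have *: "t_len (length ps) (inv (sval ps))" for ps
  proof (induction ps rule: sval.induct)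
    case 1
    show ?case using t_len_pow[of 0] by simp
  next
    case (2 e i ps)
    have "inv (sval ((e, i) # ps)) = inv (sval ps) \<otimes> (a [^] (- i) \<otimes> (if \<not> e then t else inv t))"
      by (simp add: inv_mult_group int_pow_neg m_assoc)
    moreover have "t_len (length ps + (0 + 1)) (inv (sval ps) \<otimes> (a [^] (- i) \<otimes> (if \<not> e then t else inv t)))"
      by (intro t_len_mult 2 t_len_pow t_len_letter)
    ultimately show ?case by simp
  qed
  obtain i :: int and ps where "length ps = k" "g = a [^] i \<otimes> sval ps"
    using assms by (auto simp: t_len_def)
  then have "inv g = inv (sval ps) \<otimes> a [^] (- i)" "length ps = k"
    by (simp_all add: inv_mult_group int_pow_neg)
  then show ?thesis using t_len_mult[OF *[of ps] t_len_pow[of "- i"]] by simp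
qed

lemma ex_t_len:
  assumes "g \<in> carrier G"
  shows "\<exists>k. t_len k g"
proof -
  have "g \<in> generate G {a, t}" using assms by (simp add: gen)
  then show ?thesis
  proof (induction rule: generate.induct)
    case one
    show ?case using t_len_pow[of 0] by auto
  next
    case (incl h)
    then show ?case using t_len_pow[of 1] t_len_letter[of True] by auto
  next
    case (inv h)
    then show ?case using t_len_inv[OF t_len_pow[of 1]] t_len_letter[of False] by auto
  next
    case (eng h1 h2)
    then show ?case using t_len_mult by blast
  qed
qed

lemma t_len_nat_pow: "t_len k g \<Longrightarrow> t_len (k * N) (g [^] (N::nat))"
proof (induction N)
  case 0
  show ?case using t_len_pow[of 0] by simp
next
  case (Suc N)
  then show ?case using t_len_mult[of "k * N" "g [^] N" k g] by (simp add: add.commute)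
qed

lemma t_len_int_pow:
  assumes "t_len k g"
  shows "t_len (k * nat \<bar>q\<bar>) (g [^] (q::int))"
proof -
  obtain j where "q = int j \<or> q = - int j" by (metis int_cases2)
  then show ?thesis
    using t_len_nat_pow[OF assms, of j] t_len_inv[OF t_len_nat_pow[OF assms, of j]] t_len_closed[OF assms]
    by (auto simp: int_pow_int int_pow_neg_int)
qed

text \<open>No pinch arises where two copies meet, so all positive powers are reduced and displace
  the base vertex by \<open>length ps\<close> per factor: \<open>ps\<close> describes a hyperbolic
  element with that translation length.\<close>

definition cyc_reduced :: "(bool \<times> int) list \<Rightarrow> bool" where
  "cyc_reduced ps \<longleftrightarrow> ps \<noteq> [] \<and> reduced ps \<and> \<not> pinch (last ps) (hd ps)"

lemma sval_pow:
  assumes "cyc_reduced ps" "0 < N"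
  obtains qs where "sval ps [^] (N::nat) = sval qs" "reduced qs" "length qs = length ps * N" "qs \<noteq> []"
proof -
  have "\<exists>qs. sval ps [^] (Suc N) = sval qs \<and> reduced qs \<and> length qs = length ps * Suc N \<and> qs \<noteq> [] \<and>
    last qs = last ps" for N
  proof (induction N)
    case 0
    show ?case using assms by (intro exI[of _ ps]) (auto simp: cyc_reduced_def)
  next
    case (Suc N)
    then obtain qs where "sval ps [^] (Suc N) = sval qs" "reduced qs" "length qs = length ps * Suc N"
      "qs \<noteq> []" "last qs = last ps" by blast
    then show ?case using assms
      by (intro exI[of _ "qs @ ps"]) (auto simp: cyc_reduced_def sval_append successively_append_iff)
  qed
  from this[of "N - 1"] assms that show thesis by auto
qed

lemma act_sval_pow:
  assumes "cyc_reduced ps"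
  shows "length (fst (act (sval ps [^] (N::nat)) ([], 0))) = length ps * N"
proof (cases "N = 0")
  case False
  then obtain qs where "sval ps [^] N = sval qs" "reduced qs" "length qs = length ps * N" "qs \<noteq> []"
    using sval_pow[OF assms] by blast
  then show ?thesis using act_sval_reduced[of qs 0] by auto
qed simp

lemma t_len_bound:
  assumes "t_len k g"
  shows "length (fst (act g ([], 0))) \<le> k"
proof -
  obtain i :: int and ps where *: "length ps = k" "g = a [^] i \<otimes> sval ps"
    using assms by (auto simp: t_len_def)
  have "fst (shift_act m n i x) = fst x" for x
    by (auto simp: shift_act_def split: prod.split)
  then show ?thesis using length_act_sval[of ps "[]" 0] * by (simp add: act_a_pow)
qed

text \<open>Comparing translation lengths: the displacement of \<open>s\<^sup>N\<close> grows like \<open>N\<close> times the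
  cyclically reduced length, up to a bounded error under conjugation.\<close>

lemma cyc_reduced_conj_pow_le:
  assumes "cyc_reduced ps" "g \<in> carrier G" "sval ps [^] (int p) = g \<otimes> sval ps [^] (q::int) \<otimes> inv g"
  shows "int p \<le> \<bar>q\<bar>"
proof (rule ccontr)
  assume "\<not> int p \<le> \<bar>q\<bar>"
  then have pq: "p \<ge> nat \<bar>q\<bar> + 1" by linarith
  let ?k = "length ps"
  have k: "1 \<le> ?k" using assms by (cases ps) (auto simp: cyc_reduced_def)
  obtain l where l: "t_len l g" using ex_t_len assms by blast
  \<comment> \<open>Conjugation costs at most \<open>2 * l\<close> letters, whereas the assumed gap
    between \<open>p\<close> and the absolute value of \<open>q\<close> is worth at least
    \<open>N\<close>; hence one more than \<open>2 * l\<close>.\<close>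
  define N where "N = 2 * l + 1"
  have "t_len ?k (sval ps)" unfolding t_len_def by (intro exI[of _ 0] exI[of _ ps]) simp
  then have "t_len (?k * nat \<bar>q * int N\<bar>) (sval ps [^] (q * int N))" by (rule t_len_int_pow)
  then have T: "t_len (l + ?k * nat \<bar>q * int N\<bar> + l) (g \<otimes> sval ps [^] (q * int N) \<otimes> inv g)"
    by (intro t_len_mult t_len_inv l)
  have "g \<otimes> sval ps [^] (q * int N) \<otimes> inv g = sval ps [^] (int p * int N)"
    using assms by (intro conj_pow_eq) auto
  also have "\<dots> = sval ps [^] (p * N)" by (metis int_pow_int of_nat_mult)
  finally have "?k * (p * N) \<le> l + ?k * nat \<bar>q * int N\<bar> + l"
    using t_len_bound[OF T] act_sval_pow[OF assms(1), of "p * N"] by simp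
  also have "nat \<bar>q * int N\<bar> = nat \<bar>q\<bar> * N" by (simp add: abs_mult nat_mult_distrib)
  finally have "?k * (p * N) \<le> 2 * l + ?k * (nat \<bar>q\<bar> * N)" by simp
  moreover have "?k * ((nat \<bar>q\<bar> + 1) * N) \<le> ?k * (p * N)"
    using pq by (intro mult_le_mono) auto
  moreover have "N \<le> ?k * N" using mult_le_mono1[OF k, of N] by simp
  ultimately show False by (simp add: N_def algebra_simps)
qed

text \<open>Translation length is invariant under conjugation, so conjugate powers have exponents of
  equal absolute value. The available bound is one-sided and is applied to \<open>g\<close> and to
  \<open>inv g\<close>.\<close>

lemma cyc_reduced_conj_ratio:
  assumes "cyc_reduced ps" "g \<in> carrier G" "conj_ratio (sval ps) g q"
  shows "q = 1 \<or> q = -1"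
proof -
  obtain i j :: int where ij: "i \<noteq> 0" "j \<noteq> 0" "g \<otimes> sval ps [^] i \<otimes> inv g = sval ps [^] j"
    "q = of_int i / of_int j"
    using assms(3) by (auto simp: conj_ratio_def)
  have le: "\<bar>j\<bar> \<le> \<bar>i\<bar>" if "g \<in> carrier G" "g \<otimes> sval ps [^] i \<otimes> inv g = sval ps [^] j" for g and i j :: int
  proof -
    have "g \<otimes> sval ps [^] (i * sgn j) \<otimes> inv g = sval ps [^] (j * sgn j)"
      using that by (intro conj_pow_eq) auto
    moreover have "j * sgn j = int (nat \<bar>j\<bar>)" by (auto simp: sgn_if)
    ultimately have "int (nat \<bar>j\<bar>) \<le> \<bar>i * sgn j\<bar>"
      using cyc_reduced_conj_pow_le[OF assms(1) that(1), of "nat \<bar>j\<bar>" "i * sgn j"] by simp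
    also have "\<bar>i * sgn j\<bar> \<le> \<bar>i\<bar>" by (cases "j = 0") (auto simp: abs_mult)
    finally show ?thesis by simp
  qed
  have "inv g \<otimes> sval ps [^] j \<otimes> inv (inv g) = sval ps [^] i"
    unfolding ij(3)[symmetric] using assms(2) by (simp add: m_assoc inv_solve_left')
  then have "\<bar>i\<bar> = \<bar>j\<bar>"
    using le[OF assms(2) ij(3)] le[of "inv g" j i] assms(2) by simp
  then have "i = j \<or> i = - j" by linarith
  then show ?thesis using ij by auto
qed

lemma sval_rotate:
  "\<exists>h \<in> carrier G. sval ps = h \<otimes> sval (rotate k ps) \<otimes> inv h"
proof (induction k)
  case 0
  show ?case by (intro bexI[of _ \<one>]) auto
next
  case (Suc k)
  then obtain h where h: "h \<in> carrier G" "sval ps = h \<otimes> sval (rotate k ps) \<otimes> inv h" by blast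
  show ?case
  proof (cases "rotate k ps")
    case Nil
    then show ?thesis using h by auto
  next
    case (Cons x qs)
    have "sval (x # qs) = sval [x] \<otimes> sval qs" using sval_append[of "[x]" qs] by simp
    also have "\<dots> = sval [x] \<otimes> sval (qs @ [x]) \<otimes> inv (sval [x])"
      by (simp add: sval_append m_assoc del: sval.simps)
    finally have "sval ps = (h \<otimes> sval [x]) \<otimes> sval (rotate (Suc k) ps) \<otimes> inv (h \<otimes> sval [x])"
      using h Cons by (simp add: m_assoc inv_mult_group del: sval.simps)
    then show ?thesis using h(1) by (intro bexI[of _ "h \<otimes> sval [x]"]) auto
  qed
qed

text \<open>A pinch inside the word or across its ends comes to the front by rotation, which is a
  conjugation by \<open>sval_rotate\<close>; there \<open>pinch_sval\<close> removes it.\<close>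

lemma not_cyc_reduced_rotate:
  assumes "ps \<noteq> []" "\<not> cyc_reduced ps"
  obtains k x y zs where "rotate k ps = x # y # zs" "pinch x y"
proof (cases "reduced ps")
  case True
  then have p: "pinch (last ps) (hd ps)" using assms by (auto simp: cyc_reduced_def)
  have np: "\<not> pinch x x" for x by (cases x) auto
  obtain qs x where ps: "ps = qs @ [x]" using assms(1) by (metis append_butlast_last_id)
  with p np obtain y zs where "qs = y # zs" by (cases qs) auto
  then have "rotate (length qs) ps = x # y # zs" using rotate_append[of qs "[x]"] ps by simp
  then show thesis by (rule that) (use p ps \<open>qs = y # zs\<close> in simp)
next
  case False
  then obtain us x y vs where ps: "ps = us @ x # y # vs" "pinch x y"
  proof (induction ps arbitrary: thesis rule: induct_list012)
    case (3 x y zs)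
    show ?case
    proof (cases "pinch x y")
      case True
      then show ?thesis using 3(3)[of "[]" x y zs] by simp
    next
      case False
      with 3(4) have "\<not> reduced (y # zs)" by simp
      with 3(2) obtain us x' y' vs where "y # zs = us @ x' # y' # vs" "pinch x' y'" by metis
      then show ?thesis using 3(3)[of "x # us" x' y' vs] by simp
    qed
  qed auto
  then show thesis using that[of "length us" x y "vs @ us"] by (simp add: rotate_append)
qed

text \<open>This is the division into elliptic and hyperbolic isometries of the Bass-Serre tree.
  Take a conjugate with the fewest letters \<open>t\<close>: if letters remain, a pinch in some
  rotation would remove two of them.\<close>

lemma conj_cyc_reduced_cases:
  assumes "g \<in> carrier G"
  obtains h and i :: int where "h \<in> carrier G" "g = h \<otimes> a [^] i \<otimes> inv h"
  | h ps where "h \<in> carrier G" "cyc_reduced ps" "g = h \<otimes> sval ps \<otimes> inv h"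
proof -
  define P where "P k \<longleftrightarrow> (\<exists>h x. h \<in> carrier G \<and> t_len k x \<and> g = h \<otimes> x \<otimes> inv h)" for k
  define k where "k = (LEAST k. P k)"
  have "\<exists>k. P k"
    using ex_t_len[OF assms] assms unfolding P_def by (metis inv_one l_one one_closed r_one)
  then have "P k" and least: "\<And>l. P l \<Longrightarrow> k \<le> l"
    unfolding k_def by (metis LeastI_ex) (rule Least_le)
  then obtain h and i :: int and ps where h: "h \<in> carrier G" "length ps = k" "g = h \<otimes> (a [^] i \<otimes> sval ps) \<otimes> inv h"
    unfolding P_def t_len_def by blast
  show thesis
  proof (cases "k = 0")
    case True
    then show thesis using that(1)[of h i] h by simp
  next
    case False
    then have ne: "ps \<noteq> []" using h by auto
    \<comment> \<open>Conjugating by the leading power \<open>a^i\<close> moves it to the end, where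
      it is absorbed, so \<open>qs\<close> needs no leading power.\<close>
    obtain i' qs where qs: "length qs = k" "a [^] (0::int) \<otimes> sval ps \<otimes> a [^] i = a [^] (0::int) \<otimes> sval qs"
      using sval_mult_pow[of ps 0 i] h ne by auto
    define h' where "h' = h \<otimes> a [^] i"
    have h': "h' \<in> carrier G" using h by (simp add: h'_def)
    have g: "g = h' \<otimes> sval qs \<otimes> inv h'"
    proof -
      have "h' \<otimes> sval qs \<otimes> inv h' = h \<otimes> (a [^] i \<otimes> (sval ps \<otimes> a [^] i) \<otimes> inv (a [^] i)) \<otimes> inv h"
        using qs h by (simp add: h'_def m_assoc inv_mult_group)
      also have "\<dots> = g" using h by (simp add: m_assoc)
      finally show ?thesis by simp
    qed
    have "cyc_reduced qs"
    proof (rule ccontr)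
      assume "\<not> cyc_reduced qs"
      moreover have "qs \<noteq> []" using qs False by auto
      ultimately obtain l x y zs where rot: "rotate l qs = x # y # zs" "pinch x y"
        by (metis not_cyc_reduced_rotate)
      obtain h'' where h'': "h'' \<in> carrier G" "sval qs = h'' \<otimes> sval (rotate l qs) \<otimes> inv h''"
        using sval_rotate[of qs l] by blast
      obtain j where "sval (rotate l qs) = a [^] (j::int) \<otimes> sval zs"
        using pinch_sval[OF rot(2)] rot(1) by metis
      then have "t_len (length zs) (sval (rotate l qs))"
        by (auto simp: t_len_def)
      moreover have "g = (h' \<otimes> h'') \<otimes> sval (rotate l qs) \<otimes> inv (h' \<otimes> h'')"
        unfolding g h''(2) using h' h''(1) by (simp add: m_assoc inv_mult_group)
      ultimately have "P (length zs)" using h' h''(1) unfolding P_def by blast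
      then have "k \<le> length zs" by (rule least)
      moreover have "length zs + 2 = k" using arg_cong[OF rot(1), of length] qs by simp
      ultimately show False by simp
    qed
    then show thesis using that(2) h' g by blast
  qed
qed

lemma conj_pow_eq_one:
  assumes "h \<in> carrier G" "x \<in> carrier G" "(h \<otimes> x \<otimes> inv h) [^] (k::int) = \<one>"
  shows "x [^] k = \<one>"
proof -
  have "h \<otimes> x [^] k \<otimes> inv h = \<one>" using assms by (simp add: conj_int_pow)
  then have "inv h \<otimes> (h \<otimes> x [^] k \<otimes> inv h) \<otimes> h = \<one>" using assms by simp
  then show ?thesis using assms by (simp add: m_assoc inv_solve_left')
qed

lemma torsion_free: "torsion_free G"
  unfolding torsion_free_def
proof (intro ballI allI impI)
  fix g and k :: nat
  assume g: "g \<in> carrier G" and k: "0 < k \<and> g [^] k = \<one>"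
  then have *: "g [^] int k = \<one>" by (simp add: int_pow_int)
  from g show "g = \<one>"
  proof (rule conj_cyc_reduced_cases)
    fix h and i :: int assume h: "h \<in> carrier G" "g = h \<otimes> a [^] i \<otimes> inv h"
    then have "(a [^] i) [^] int k = \<one>" using * conj_pow_eq_one[of h "a [^] i" "int k"] by simp
    then have "i * int k = 0" using inf_order_a unfolding inf_order_def by (metis a_closed int_pow_pow)
    then have "i = 0" using k by simp
    then show ?thesis using h by simp
  next
    fix h ps assume h: "h \<in> carrier G" "cyc_reduced ps" "g = h \<otimes> sval ps \<otimes> inv h"
    then have "sval ps [^] k = \<one>" using * conj_pow_eq_one[of h "sval ps" "int k"] by (simp add: int_pow_int)
    then have "length ps * k = 0" using act_sval_pow[OF h(2), of k] by simp
    then show ?thesis using h k by (simp add: cyc_reduced_def)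
  qed
qed

lemma conj_ratio_conj:
  assumes "h \<in> carrier G" "x \<in> carrier G" "g \<in> carrier G" "conj_ratio (h \<otimes> x \<otimes> inv h) g q"
  shows "conj_ratio x (inv h \<otimes> g \<otimes> h) q"
proof -
  obtain i j :: int where ij: "i \<noteq> 0" "j \<noteq> 0"
    "g \<otimes> (h \<otimes> x \<otimes> inv h) [^] i \<otimes> inv g = (h \<otimes> x \<otimes> inv h) [^] j" "q = of_int i / of_int j"
    using assms(4) by (auto simp: conj_ratio_def)
  have "(inv h \<otimes> g \<otimes> h) \<otimes> x [^] i \<otimes> inv (inv h \<otimes> g \<otimes> h) =
      inv h \<otimes> (g \<otimes> (h \<otimes> x [^] i \<otimes> inv h) \<otimes> inv g) \<otimes> h"
    using assms by (simp add: m_assoc inv_mult_group)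
  also have "\<dots> = inv h \<otimes> (h \<otimes> x [^] j \<otimes> inv h) \<otimes> h"
    using ij(3) assms by (simp add: conj_int_pow)
  also have "\<dots> = x [^] j" using assms by (simp add: m_assoc inv_solve_left')
  finally show ?thesis unfolding conj_ratio_def using ij by blast
qed

text \<open>For a conjugate of a power of \<open>a\<close> the ratios are those of \<open>a\<close>,
  powers of \<open>m / n\<close>; in the hyperbolic case they are 1 or -1, powers of -1.\<close>

lemma conj_ratio_range:
  assumes "c \<in> carrier G" "c \<noteq> \<one>"
  obtains r where "r \<noteq> 0" "\<And>g q. g \<in> carrier G \<Longrightarrow> conj_ratio c g q \<Longrightarrow> \<exists>k::int. q = r powi k"
  using assms(1)
proof (rule conj_cyc_reduced_cases)
  fix h and i :: int assume h: "h \<in> carrier G" "c = h \<otimes> a [^] i \<otimes> inv h"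
  with assms have "i \<noteq> 0" by auto
  then have comm: "commensurable (a [^] i) a"
    unfolding commensurable_def by (intro exI[of _ 1] exI[of _ i]) simp
  have "\<exists>k::int. q = (of_int m / of_int n) powi k" if "g \<in> carrier G" "conj_ratio c g q" for g q
  proof -
    have g': "inv h \<otimes> g \<otimes> h \<in> carrier G" using h that by simp
    have "conj_ratio (a [^] i) (inv h \<otimes> g \<otimes> h) q"
      using that h by (intro conj_ratio_conj) auto
    then have "conj_ratio a (inv h \<otimes> g \<otimes> h) q"
      by (intro conj_ratio_commensurable[OF _ _ g' comm]) auto
    with conj_ratio_unique[OF inf_order_a g' _ conj_ratio_ht[OF g']] show ?thesis by blast
  qed
  then show thesis using that[of "of_int m / of_int n"] nonzero by simp
next
  fix h ps assume h: "h \<in> carrier G" "cyc_reduced ps" "c = h \<otimes> sval ps \<otimes> inv h"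
  have "\<exists>k::int. q = (-1) powi k" if "g \<in> carrier G" "conj_ratio c g q" for g q
  proof -
    have *: "conj_ratio (sval ps) (inv h \<otimes> g \<otimes> h) q"
      using that h by (intro conj_ratio_conj) auto
    then have "q = 1 \<or> q = -1"
      using cyc_reduced_conj_ratio[OF h(2) _ *] that(1) h(1) by simp
    then show ?thesis
    proof
      assume "q = -1"
      then show ?thesis by (intro exI[of _ 1]) simp
    qed (intro exI[of _ 0], simp)
  qed
  then show thesis using that[of "-1"] by simp
qed

end

text \<open>For \<open>|m| = |n| = N\<close> the group maps onto \<open>\<int>/N * \<int>\<close>. The image is detected by
  permutations of \<open>\<int> \<times> \<int>\<close>: \<open>t\<close> shifts the first coordinate, and \<open>a\<close> rotates blocks of
  length \<open>N\<close> in the row \<open>0\<close>.\<close>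

definition block_rot :: "int \<Rightarrow> int \<Rightarrow> int \<times> int \<Rightarrow> int \<times> int" where
  "block_rot N k = (\<lambda>(i, j). if i = 0 then (0, N * (j div N) + (j + k) mod N) else (i, j))"

text \<open>As \<open>c\<close> commutes with \<open>a\<close>, its ratio is 1, and the non-zero
  exponent sum gives \<open>|m| = |n|\<close>. In the block representation \<open>c\<close> carries
  row 0 to a row where \<open>a\<close> acts trivially; since they commute, \<open>a\<close> fixes
  \<open>(0, 0)\<close>, so the blocks have length 1.\<close>

lemma BS_central_ht:
  assumes "bs_pair (BS m n) (bs_a m n) (bs_t m n) m n act ht"
    and c: "c \<in> carrier (BS m n)" "c \<otimes>\<^bsub>BS m n\<^esub> bs_a m n = bs_a m n \<otimes>\<^bsub>BS m n\<^esub> c" "ht c \<noteq> 0"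
  shows "\<bar>m\<bar> = 1 \<and> \<bar>n\<bar> = 1"
proof -
  interpret bs_pair "BS m n" "bs_a m n" "bs_t m n" m n act ht by fact
  define N where "N = \<bar>n\<bar>"
  have N: "N > 0" using nonzero by (simp add: N_def)
  have "conj_ratio (bs_a m n) c 1"
    using conj_ratio_commute[of c "bs_a m n" 1] c by simp
  then have pow1: "(of_int m / of_int n :: rat) powi ht c = 1"
    using conj_ratio_unique[OF inf_order_a c(1) conj_ratio_ht[OF c(1)]] by simp
  then have "\<bar>of_int m / of_int n :: rat\<bar> = 1"
    using c(3) by (rule abs_eq_1_of_power_int_eq_1)
  then have mn: "\<bar>m\<bar> = N"
    using nonzero by (simp add: N_def abs_divide flip: of_int_abs)
  let ?P = "perm_group :: (int \<times> int \<Rightarrow> int \<times> int) monoid"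
  define \<tau> :: "int \<times> int \<Rightarrow> int \<times> int" where "\<tau> = (\<lambda>(i, j). (i + 1, j))"
  have mod: "(i + (b + j) mod N) mod N = (b + (i + j)) mod N" for b i j
    by (simp add: mod_add_right_eq add_ac)
  have mod': "(N * (b div N) + (b + j) mod N + i) mod N = (b + (i + j)) mod N" for b i j
    using mod_mult_self2[of "i + (b + j) mod N" N "b div N"] mod[of i b j] by (simp only: add_ac)
  have rot_add: "block_rot N i \<circ> block_rot N j = block_rot N (i + j)" for i j
    by (rule ext) (use N mod mod' in \<open>auto simp: block_rot_def\<close>)
  have rot_0: "block_rot N 0 = id"
    by (rule ext) (auto simp: block_rot_def)
  have rot_pow: "block_rot N 1 [^]\<^bsub>?P\<^esub> k = block_rot N k" for k :: int
    by (rule int_pow_perm_group[where F = "block_rot N"]) (simp_all add: rot_add rot_0)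
  have rot_id: "block_rot N k = id" if "\<bar>k\<bar> = N" for k
  proof -
    have "N dvd k" using that by auto
    then have "(j + k) mod N = j mod N" for j by (auto elim!: dvdE)
    then show ?thesis by (intro ext) (auto simp: block_rot_def)
  qed
  have bij: "bij (block_rot N 1)" "bij \<tau>"
    by (rule o_bij[where g = "block_rot N (-1)"]; simp add: rot_add rot_0)
      (rule o_bij[where g = "\<lambda>(i, j). (i - 1, j)"]; auto simp: \<tau>_def fun_eq_iff)
  interpret P: group ?P by simp
  have "\<tau> \<otimes>\<^bsub>?P\<^esub> block_rot N 1 [^]\<^bsub>?P\<^esub> m \<otimes>\<^bsub>?P\<^esub> inv\<^bsub>?P\<^esub> \<tau> = block_rot N 1 [^]\<^bsub>?P\<^esub> n"
    using bij P.r_inv[of \<tau>] rot_id[OF mn] rot_id[OF N_def[symmetric]] by (simp add: rot_pow)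
  then obtain f where f: "f \<in> hom (BS m n) ?P" "f (bs_a m n) = block_rot N 1" "f (bs_t m n) = \<tau>"
    using BS_hom[of ?P "block_rot N 1" \<tau> m n] bij by auto
  interpret f: group_hom "BS m n" ?P f
    using f(1) by (simp add: group_hom_def group_hom_axioms_def)
  have shift: "\<forall>x. fst (f g x) = fst x + ht g" if "g \<in> carrier (BS m n)" for g
  proof -
    have inv_shift: "\<forall>x. fst (f (inv\<^bsub>BS m n\<^esub> g) x) = fst x + ht (inv\<^bsub>BS m n\<^esub> g)"
      if g: "g \<in> carrier (BS m n)" and s: "\<forall>x. fst (f g x) = fst x + ht g" for g
    proof
      fix x
      have "f g \<circ> f (inv\<^bsub>BS m n\<^esub> g) = id"
        using f.hom_mult[OF g inv_closed[OF g]] r_inv[OF g] f.hom_one by simp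
      then have "f g (f (inv\<^bsub>BS m n\<^esub> g) x) = x" by (metis comp_apply id_apply)
      then show "fst (f (inv\<^bsub>BS m n\<^esub> g) x) = fst x + ht (inv\<^bsub>BS m n\<^esub> g)"
        using s[rule_format, of "f (inv\<^bsub>BS m n\<^esub> g) x"] g by simp
    qed
    have gens: "\<forall>x. fst (f g x) = fst x + ht g" if "g \<in> {bs_a m n, bs_t m n}" for g
      using that by (auto simp: f ht_a ht_t block_rot_def \<tau>_def)
    have "g \<in> generate (BS m n) {bs_a m n, bs_t m n}" using that gen by simp
    then show ?thesis
    proof (induction rule: generate.induct)
      case (inv h)
      then show ?case using inv_shift gens by auto
    next
      case (eng h1 h2)
      then have "h1 \<in> carrier (BS m n)" "h2 \<in> carrier (BS m n)" using gen by auto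
      then have "f (h1 \<otimes>\<^bsub>BS m n\<^esub> h2) = f h1 \<circ> f h2" "ht (h1 \<otimes>\<^bsub>BS m n\<^esub> h2) = ht h1 + ht h2"
        by simp_all
      then show ?case using eng.IH(1)[rule_format, of "f h2 _"] eng.IH(2) by (simp only: comp_apply) simp
    qed (use gens in auto)
  qed
  have "f c \<circ> block_rot N 1 = block_rot N 1 \<circ> f c"
    using f.hom_mult[OF c(1), of "bs_a m n"] f.hom_mult[of "bs_a m n" c] c f(2) by simp
  moreover have "block_rot N 1 (f c (0, 0)) = f c (0, 0)"
    using shift[OF c(1)] c(3) by (auto simp: block_rot_def split: prod.split) (metis add_0 fst_conv)
  ultimately have "f c (block_rot N 1 (0, 0)) = f c (0, 0)" by (metis comp_apply)
  moreover have "inj (f c)" using f.hom_closed[OF c(1)] by (simp add: bij_is_inj)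
  ultimately have "block_rot N 1 (0, 0) = (0, 0)" by (simp add: inj_eq)
  then have "N dvd 1" by (simp add: block_rot_def mod_eq_0_iff_dvd)
  then have "N = 1" using N by simp
  then show ?thesis using mn by (simp add: N_def)
qed

section \<open>Bi-infinite lines in trees\<close>

context serre_tree_graph
begin

definition line :: "(int \<Rightarrow> 'b) \<Rightarrow> bool" where
  "line y \<longleftrightarrow> (\<forall>i. y i \<in> arcs G \<and> head G (y i) = tail G (y (i + 1)) \<and> y (i + 1) \<noteq> arev (y i))"

lemma line_walk:
  assumes "line y"
  shows "awalk (tail G (y i)) (map (\<lambda>k. y (i + int k)) [0..<n]) (tail G (y (i + int n)))"
proof (induction n)
  case 0
  show ?case using assms by (auto simp: line_def awalk_Nil_iff)
next
  case (Suc n)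
  have "awalk (tail G (y (i + int n))) [y (i + int n)] (tail G (y (i + int (Suc n))))"
    using assms arc_implies_awalk[of "y (i + int n)"] by (simp add: line_def add.assoc add.commute[of 1])
  with Suc show ?case using awalk_appendI by fastforce
qed

lemma line_tail_neq:
  assumes "line y" "i < j"
  shows "tail G (y i) \<noteq> tail G (y j)"
proof
  assume eq: "tail G (y i) = tail G (y j)"
  define n where "n = nat (j - i)"
  have j: "j = i + int n" "n > 0" using assms by (auto simp: n_def)
  have "\<exists>k. Suc k < length (map (\<lambda>k. y (i + int k)) [0..<n]) \<and>
      map (\<lambda>k. y (i + int k)) [0..<n] ! Suc k = arev (map (\<lambda>k. y (i + int k)) [0..<n] ! k)"
    using line_walk[OF assms(1), of i n] eq j by (intro backtrack) auto
  then obtain k where "Suc k < n" "y (i + int (Suc k)) = arev (y (i + int k))"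
    by (auto simp: nth_map)
  then have "y (i + int k + 1) = arev (y (i + int k))" by (simp add: add_ac)
  then show False using assms(1) by (auto simp: line_def)
qed

lemma line_tail_inj: "line y \<Longrightarrow> tail G (y i) = tail G (y j) \<longleftrightarrow> i = j"
  using line_tail_neq[of y i j] line_tail_neq[of y j i] by (metis linorder_neqE)

lemma line_inj: "line y \<Longrightarrow> y i = y j \<longleftrightarrow> i = j"
  using line_tail_inj by metis

lemma line_neq_arev:
  assumes "line y"
  shows "y i \<noteq> arev (y j)"
proof
  assume eq: "y i = arev (y j)"
  have y: "y k \<in> arcs G" "head G (y k) = tail G (y (k + 1))" "y (k + 1) \<noteq> arev (y k)" for k
    using assms by (auto simp: line_def)
  have "tail G (y i) = tail G (y (j + 1))" using y(2)[of j] y(1)[of j] eq by simp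
  then have "i = j + 1" using line_tail_inj[OF assms] by simp
  then show False using y(3)[of j] eq by simp
qed

lemma line_rev:
  assumes "line y"
  shows "line (\<lambda>i. arev (y (- i)))"
  unfolding line_def
proof (intro allI conjI)
  have y: "y k \<in> arcs G" "head G (y k) = tail G (y (k + 1))" "y (k + 1) \<noteq> arev (y k)" for k
    using assms by (auto simp: line_def)
  fix i
  show "arev (y (- i)) \<in> arcs G" using y by simp
  show "head G (arev (y (- i))) = tail G (arev (y (- (i + 1))))"
    using y(1)[of "- i"] y(1)[of "- (i + 1)"] y(2)[of "- (i + 1)"] by simp
  show "arev (y (- (i + 1))) \<noteq> arev (arev (y (- i)))"
    using y(3)[of "- (i + 1)"] by auto
qed

text \<open>Having followed \<open>y\<close> up to a vertex, \<open>y'\<close> can continue within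
  the line only by the next arc of \<open>y\<close> or by the reverse of the arc just used, and the
  latter is a backtrack. The same holds going backwards.\<close>

lemma line_follows_aux:
  assumes "line y" "line y'" "\<And>i. y' i \<in> range y \<union> arev ` range y" "y' 0 = y j"
  shows "y' i = y (i + j)"
proof -
  have y: "y k \<in> arcs G" "head G (y k) = tail G (y (k + 1))" for k
    using assms(1) by (auto simp: line_def)
  have y': "y' k \<in> arcs G" "head G (y' k) = tail G (y' (k + 1))" "y' (k + 1) \<noteq> arev (y' k)" for k
    using assms(2) by (auto simp: line_def)
  have up: "y' (i + 1) = y (k + 1)" if "y' i = y k" for i k
  proof -
    have t: "tail G (y' (i + 1)) = tail G (y (k + 1))" using y'(2)[of i] y(2)[of k] that by simp
    consider l where "y' (i + 1) = y l" | l where "y' (i + 1) = arev (y l)" using assms(3) by blast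
    then show ?thesis
    proof cases
      case 1
      with t show ?thesis using line_tail_inj[OF assms(1)] by auto
    next
      case 2
      with t y have "tail G (y (l + 1)) = tail G (y (k + 1))" by simp
      then have "l = k" using line_tail_inj[OF assms(1)] by simp
      with 2 that y'(3)[of i] show ?thesis by simp
    qed
  qed
  have down: "y' (i - 1) = y (k - 1)" if "y' i = y k" for i k
  proof -
    have t: "head G (y' (i - 1)) = tail G (y k)" using y'(2)[of "i - 1"] that by simp
    consider l where "y' (i - 1) = y l" | l where "y' (i - 1) = arev (y l)" using assms(3) by blast
    then show ?thesis
    proof cases
      case 1
      with t y have "tail G (y (l + 1)) = tail G (y k)" by simp
      then have "k - 1 = l" using line_tail_inj[OF assms(1)] by auto
      with 1 show ?thesis by simp
    next
      case 2
      with t y have "tail G (y l) = tail G (y k)" by simp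
      then have "l = k" using line_tail_inj[OF assms(1)] by simp
      with 2 that y'(3)[of "i - 1"] show ?thesis by simp
    qed
  qed
  show ?thesis
  proof (induction i rule: int_induct[of _ 0])
    case base
    show ?case using assms(4) by simp
  next
    case (step1 i)
    then show ?case using up[OF step1(2)] by (simp add: algebra_simps)
  next
    case (step2 i)
    then show ?case using down[OF step2(2)] by (simp add: algebra_simps)
  qed
qed

lemma line_follows:
  assumes "line y" "line y'" "\<And>i. y' i \<in> range y \<union> arev ` range y"
  obtains j where "\<And>i. y' i = y (i + j)" | j where "\<And>i. y' i = arev (y (j - i))"
proof -
  consider j where "y' 0 = y j" | j where "y' 0 = arev (y j)" using assms(3) by blast
  then show thesis
  proof cases
    case 1
    then show thesis using line_follows_aux[OF assms] that(1) by blast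
  next
    case 2
    have "range (\<lambda>i. arev (y (- i))) = arev ` range y"
    proof -
      have "arev (y k) = arev (y (- (- k)))" for k by simp
      then show ?thesis by blast
    qed
    moreover have "arev ` range (\<lambda>i. arev (y (- i))) = range y"
    proof -
      have "y k \<in> arev ` range (\<lambda>i. arev (y (- i)))" for k
        by (rule image_eqI[of _ _ "arev (y (- (- k)))"]) (simp, rule range_eqI[of _ _ "- k"], simp)
      then show ?thesis by auto
    qed
    ultimately have "y' i \<in> range (\<lambda>i. arev (y (- i))) \<union> arev ` range (\<lambda>i. arev (y (- i)))" for i
      using assms(3)[of i] by blast
    then have "y' i = arev (y (- (i + (- j))))" for i
      using 2 by (intro line_follows_aux[OF line_rev[OF assms(1)] assms(2)]) auto
    then show thesis using that(2)[of j] by simp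
  qed
qed

text \<open>Two lines translated by the same automorphism coincide: an arc \<open>f\<close> of the second line
  that is missing from the first one would separate the ends of the second line, but far out the
  two lines are joined by translates of a fixed path that avoid \<open>f\<close>. Sides of \<open>f\<close> are told apart
  by a potential that doubles across \<open>f\<close>.\<close>

lemma line_coincide:
  fixes c :: "int \<Rightarrow> 'b \<Rightarrow> 'b"
  assumes y: "line y" and y': "line y'" and nz: "l \<noteq> 0" "l' \<noteq> 0"
    and c_line: "\<And>N i. c N (y i) = y (i + N * l)" "\<And>N i. c N (y' i) = y' (i + N * l')"
    and c_inj: "\<And>N e. e \<in> arcs G \<Longrightarrow> c (- N) (c N e) = e"
    and c_rev: "\<And>N e. e \<in> arcs G \<Longrightarrow> c N (arev e) = arev (c N e)"
    and c_walk: "\<And>N p. awalk (tail G (y 0)) p (tail G (y' 0)) \<Longrightarrow>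
      awalk (tail G (c N (y 0))) (map (c N) p) (tail G (c N (y' 0)))"
  shows "y' i \<in> range y \<union> arev ` range y"
proof (rule ccontr)
  assume f: "y' i \<notin> range y \<union> arev ` range y"
  have yl: "y k \<in> arcs G" "head G (y k) = tail G (y (k + 1))" for k
    using y by (auto simp: line_def)
  have yl': "y' k \<in> arcs G" "head G (y' k) = tail G (y' (k + 1))" for k
    using y' by (auto simp: line_def)
  define w :: "'b \<Rightarrow> rat" where "w e = (if e = y' i then 2 else if e = arev (y' i) then 1 / 2 else 1)" for e
  have "y' i \<noteq> arev (y' i)" using arev_neq[OF yl'(1)[of i]] by simp
  then have "w (arev e) = inverse (w e)" if "e \<in> arcs G" for e
    by (auto simp: w_def) (metis arev_arev)+
  moreover have "w e \<noteq> 0" for e by (simp add: w_def)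
  ultimately obtain p where p: "\<And>v. v \<in> verts G \<Longrightarrow> p v \<noteq> 0"
    "\<And>e. e \<in> arcs G \<Longrightarrow> p (head G e) = p (tail G e) * w e"
    using ex_potential[of w] by blast
  have "w (y k) = 1" for k
  proof -
    have "y k \<noteq> y' i" using f by (metis UnI1 rangeI)
    moreover have "y k \<noteq> arev (y' i)" using f by (metis UnI2 arev_arev image_eqI rangeI)
    ultimately show ?thesis by (simp add: w_def)
  qed
  then have step: "p (tail G (y (k + 1))) = p (tail G (y k))" for k
    using p(2)[OF yl(1)[of k]] yl(2)[of k] by simp
  have const: "p (tail G (y k)) = p (tail G (y 0))" for k
  proof (induction k rule: int_induct[of _ 0])
    case (step2 k)
    then show ?case using step[of "k - 1"] by simp
  qed (use step in simp_all)
  have "w (y' k) = (if k = i then 2 else 1)" for k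
    using line_inj[OF y', of k i] line_neq_arev[OF y', of k i] by (auto simp: w_def)
  then have step': "p (tail G (y' (k + 1))) = p (tail G (y' k)) * (if k = i then 2 else 1)" for k
    using p(2)[OF yl'(1)[of k]] yl'(2)[of k] by simp
  have low: "p (tail G (y' k)) = p (tail G (y' i))" if "k \<le> i" for k
    using that
  proof (induction k rule: int_le_induct)
    case (step k)
    then show ?case using step'[of "k - 1"] by simp
  qed simp
  have high: "p (tail G (y' k)) = p (tail G (y' i)) * 2" if "i + 1 \<le> k" for k
    using that
  proof (induction k rule: int_ge_induct)
    case base
    show ?case using step'[of i] by simp
  next
    case (step k)
    then show ?case using step'[of k] by simp
  qed
  obtain q where q: "awalk (tail G (y 0)) q (tail G (y' 0))"
    using strongly_connected_awalk[OF conn] yl(1) yl'(1) by (metis tail_in_verts)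
  have walk_eq: "p u = p v" if "awalk u q v" "y' i \<notin> set q" "arev (y' i) \<notin> set q" for u v q
    using that
  proof (induction q arbitrary: u)
    case (Cons e q)
    then have "p (head G e) = p v" "p (head G e) = p (tail G e)"
      using p(2)[of e] by (auto simp: awalk_Cons_iff w_def)
    then show ?case using Cons.prems by (auto simp: awalk_Cons_iff)
  qed (auto simp: awalk_Nil_iff)
  \<comment> \<open>The translate of \<open>q\<close> by \<open>c N\<close> meets
    \<open>y' i\<close> or its opposite only for \<open>N\<close> in this set, because
    \<open>c N\<close> carries \<open>y' (i - N * l')\<close> to \<open>y' i\<close>. The set is
    finite, as a line passes each arc at most once.\<close>
  define B where "B = {N. y' (i - N * l') \<in> set q} \<union> {N. arev (y' (i - N * l')) \<in> set q}"
  have "finite {N. y' (i - N * l') \<in> set q}"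
  proof (rule inj_on_finite[of "\<lambda>N. y' (i - N * l')" _ "set q"])
    show "inj_on (\<lambda>N. y' (i - N * l')) {N. y' (i - N * l') \<in> set q}"
      using nz by (auto simp: inj_on_def line_inj[OF y'])
  qed auto
  moreover have "finite {N. arev (y' (i - N * l')) \<in> set q}"
  proof (rule inj_on_finite[of "\<lambda>N. arev (y' (i - N * l'))" _ "set q"])
    show "inj_on (\<lambda>N. arev (y' (i - N * l'))) {N. arev (y' (i - N * l')) \<in> set q}"
      using nz by (auto simp: inj_on_def line_inj[OF y'] arev_eq_iff)
  qed auto
  ultimately have "finite (B \<union> uminus ` B)" by (simp add: B_def)
  moreover have "infinite {\<bar>i\<bar><..}" by (rule infinite_Ioi)
  \<comment> \<open>Both \<open>N\<close> and \<open>- N\<close> avoid \<open>B\<close>, and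
    \<open>N > |i|\<close> puts the vertices at \<open>N * l'\<close> and \<open>- N * l'\<close> on
    different sides of \<open>y' i\<close>.\<close>
  ultimately obtain N where N: "N > \<bar>i\<bar>" "N \<notin> B \<union> uminus ` B"
    using infinite_super[of "{\<bar>i\<bar><..}" "B \<union> uminus ` B"] by blast
  have far: "p (tail G (y' (M * l'))) = p (tail G (y 0))" if "M \<notin> B" for M
  proof -
    have qs: "set q \<subseteq> arcs G" using q by auto
    have not: "y' i \<noteq> c M e" if "e \<in> set q" for e
    proof
      assume "y' i = c M e"
      then have "y' (i - M * l') = e" using c_inj[of e M] c_line(2)[of "- M" i] qs that by auto
      then show False using \<open>M \<notin> B\<close> that by (auto simp: B_def)
    qed
    have not': "arev (y' i) \<noteq> c M e" if "e \<in> set q" for e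
    proof
      assume "arev (y' i) = c M e"
      then have "arev (y' (i - M * l')) = e"
        using c_inj[of e M] c_line(2)[of "- M" i] c_rev[OF yl'(1), of "- M" i] qs that by auto
      then show False using \<open>M \<notin> B\<close> that by (auto simp: B_def)
    qed
    have "p (tail G (c M (y 0))) = p (tail G (c M (y' 0)))"
      using not not' by (intro walk_eq[OF c_walk[OF q]]) auto
    then show ?thesis using const[of "M * l"] by (simp add: c_line)
  qed
  have NB: "N \<notin> B" "- N \<notin> B" using N(2) by (auto simp: image_iff)
  have "N * 1 \<le> N * \<bar>l'\<bar>" using nz N(1) by (intro mult_left_mono) auto
  then have far2: "N \<le> \<bar>N * l'\<bar>" using N(1) by (simp add: abs_mult)
  have "p (tail G (y' (N * l'))) \<noteq> p (tail G (y' (- N * l')))"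
  proof (cases "N * l' > 0")
    case True
    then have "i + 1 \<le> N * l'" "- N * l' \<le> i" using far2 N(1) by auto
    then show ?thesis using low[of "- N * l'"] high[of "N * l'"] p(1)[of "tail G (y' i)"] yl'(1)[of i] by simp
  next
    case False
    then have "i + 1 \<le> - N * l'" "N * l' \<le> i" using far2 N(1) by auto
    then show ?thesis using low[of "N * l'"] high[of "- N * l'"] p(1)[of "tail G (y' i)"] yl'(1)[of i] by simp
  qed
  then show False using far[OF NB(1)] far[OF NB(2)] by simp
qed

end

section \<open>Groups acting on trees with infinite cyclic stabilizers\<close>

lemma infinite_cyclic_generator:
  fixes G (structure)
  assumes "group G" "subgroup H G" "infinite_cyclic (G\<lparr>carrier := H\<rparr>)"
  obtains z where "group.inf_order G z" "H = range (\<lambda>k::int. z [^]\<^bsub>G\<^esub> k)"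
proof -
  interpret group G by fact
  interpret H: group "G\<lparr>carrier := H\<rparr>"
    using assms(2) subgroup.subgroup_is_group[OF _ assms(1)] by blast
  have "integer_group \<cong> G\<lparr>carrier := H\<rparr>"
    using assms(3) H.iso_sym by (simp add: infinite_cyclic_def)
  then obtain f where f: "f \<in> iso integer_group (G\<lparr>carrier := H\<rparr>)" by (auto simp: is_iso_def)
  interpret f: group_hom integer_group "G\<lparr>carrier := H\<rparr>" f
    using f by (simp add: group_hom_def group_hom_axioms_def iso_def)
  have bij: "bij_betw f UNIV H" using f by (simp add: iso_def)
  then have 1: "f 1 \<in> H" by (auto simp: bij_betw_def)
  have pow: "f k = f 1 [^] k" for k
    using f.hom_int_pow[of 1 k] int_pow_consistent[OF assms(2) 1, of k] by simp
  show thesis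
  proof
    have "k = 0" if "f 1 [^] k = \<one>" for k :: int
    proof -
      have "f k = f 0" using that f.hom_one by (simp flip: pow)
      then show ?thesis using bij by (auto simp: bij_betw_def inj_def)
    qed
    then show "inf_order (f 1)"
      using subgroup.subset[OF assms(2)] 1 by (auto simp: inf_order_def)
    show "H = range (\<lambda>k::int. f 1 [^] k)"
      using bij by (simp add: bij_betw_def flip: pow)
  qed
qed

locale gbs_action = group G for G (structure) +
  fixes T :: "('v, 'e) pre_digraph" and r :: "'e \<Rightarrow> 'e"
    and \<phi> :: "'a \<Rightarrow> 'v \<Rightarrow> 'v" and \<psi> :: "'a \<Rightarrow> 'e \<Rightarrow> 'e"
  assumes tree: "serre_tree T r"
    and \<phi>: "group_action G (verts T) \<phi>" and \<psi>: "group_action G (arcs T) \<psi>"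
    and equivariant: "\<And>g e. g \<in> carrier G \<Longrightarrow> e \<in> arcs T \<Longrightarrow>
      tail T (\<psi> g e) = \<phi> g (tail T e) \<and> \<psi> g (r e) = r (\<psi> g e) \<and> \<psi> g e \<noteq> r e"
    and vertex_stab: "\<And>v. v \<in> verts T \<Longrightarrow> infinite_cyclic (G\<lparr>carrier := stabilizer G \<phi> v\<rparr>)"
    and edge_stab: "\<And>e. e \<in> arcs T \<Longrightarrow> infinite_cyclic (G\<lparr>carrier := stabilizer G \<psi> e\<rparr>)"

lemma gbs_group_action: "gbs_group G T r \<phi> \<psi> \<Longrightarrow> gbs_action G T r \<phi> \<psi>"
  unfolding gbs_group_def tree_action_def gbs_action_def gbs_action_axioms_def by blast

context gbs_action
begin

sublocale T: serre_tree_graph T r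
  using tree by (simp add: serre_tree_iff)

sublocale V: group_action G "verts T" \<phi> by (rule \<phi>)
sublocale E: group_action G "arcs T" \<psi> by (rule \<psi>)

lemma arc_action [simp]:
  assumes "g \<in> carrier G" "e \<in> arcs T"
  shows "\<psi> g e \<in> arcs T" "tail T (\<psi> g e) = \<phi> g (tail T e)" "head T (\<psi> g e) = \<phi> g (head T e)"
    "\<psi> g (r e) = r (\<psi> g e)"
proof -
  show *: "\<psi> g e \<in> arcs T" using E.element_image[OF assms] by simp
  show "tail T (\<psi> g e) = \<phi> g (tail T e)" "\<psi> g (r e) = r (\<psi> g e)" using equivariant[OF assms] by auto
  show "head T (\<psi> g e) = \<phi> g (head T e)"
    using equivariant[OF assms(1), of "r e"] equivariant[OF assms] assms(2) *
    by (metis T.arev_in_arcs T.tail_arev)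
qed

lemma vert_action [simp]: "g \<in> carrier G \<Longrightarrow> v \<in> verts T \<Longrightarrow> \<phi> g v \<in> verts T"
  using V.element_image by simp

lemma action_mult:
  assumes "g \<in> carrier G" "h \<in> carrier G"
  shows "v \<in> verts T \<Longrightarrow> \<phi> (g \<otimes> h) v = \<phi> g (\<phi> h v)" "e \<in> arcs T \<Longrightarrow> \<psi> (g \<otimes> h) e = \<psi> g (\<psi> h e)"
  using V.composition_rule[OF _ assms] E.composition_rule[OF _ assms] by auto

lemma action_one: "v \<in> verts T \<Longrightarrow> \<phi> \<one> v = v" "e \<in> arcs T \<Longrightarrow> \<psi> \<one> e = e"
  using V.id_eq_one E.id_eq_one by (metis restrict_apply')+

lemma action_inv:
  assumes "g \<in> carrier G"
  shows "v \<in> verts T \<Longrightarrow> \<phi> (inv g) (\<phi> g v) = v" "e \<in> arcs T \<Longrightarrow> \<psi> (inv g) (\<psi> g e) = e"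
  using assms action_mult[of "inv g" g] action_one by simp_all

lemma action_walk:
  assumes "g \<in> carrier G" "T.awalk u p v"
  shows "T.awalk (\<phi> g u) (map (\<psi> g) p) (\<phi> g v)"
  using assms(2)
  by (induction p arbitrary: u) (auto simp: T.awalk_Nil_iff T.awalk_Cons_iff assms(1))

lemma vertex_generator:
  assumes "v \<in> verts T"
  obtains z where "inf_order z" "stabilizer G \<phi> v = range (\<lambda>k::int. z [^] k)"
  using infinite_cyclic_generator[OF is_group V.stabilizer_subgroup[OF assms] vertex_stab[OF assms]] by blast

lemma edge_generator:
  assumes "e \<in> arcs T"
  obtains z where "inf_order z" "stabilizer G \<psi> e = range (\<lambda>k::int. z [^] k)"
  using infinite_cyclic_generator[OF is_group E.stabilizer_subgroup[OF assms] edge_stab[OF assms]] by blast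

lemma commensurable_cyclic:
  assumes "z \<in> carrier G" "x \<in> range (\<lambda>k::int. z [^] k)" "y \<in> range (\<lambda>k::int. z [^] k)" "x \<noteq> \<one>" "y \<noteq> \<one>"
  shows "commensurable x y"
proof -
  obtain i j :: int where ij: "x = z [^] i" "y = z [^] j" using assms by auto
  then have "i \<noteq> 0" "j \<noteq> 0" using assms by auto
  then show ?thesis using ij assms(1) unfolding commensurable_def
    by (intro exI[of _ j] exI[of _ i]) (simp add: int_pow_pow mult.commute)
qed

lemma elliptic_inf_order:
  assumes "elliptic G T \<phi> x" "x \<noteq> \<one>"
  shows "inf_order x"
proof -
  obtain v where v: "v \<in> verts T" "x \<in> stabilizer G \<phi> v"
    using assms by (auto simp: elliptic_def stabilizer_def)
  obtain z where z: "inf_order z" "stabilizer G \<phi> v = range (\<lambda>k::int. z [^] k)"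
    using vertex_generator[OF v(1)] .
  then have zc: "z \<in> carrier G" by (simp add: inf_order_def)
  have "z \<noteq> \<one>" using z(1) by (auto simp: inf_order_def dest: spec[of _ 1])
  moreover have "z \<in> range (\<lambda>k::int. z [^] k)" by (rule range_eqI[of _ _ 1]) (simp add: zc)
  ultimately have "commensurable z x"
    using commensurable_cyclic[OF zc, of z x] v z(2) assms(2) by simp
  then show ?thesis using inf_order_commensurable[OF z(1)] assms(1) by (simp add: elliptic_def)
qed

text \<open>Non-trivial elements of one infinite cyclic group are commensurable, and neighbouring
  vertex stabilizers share the infinite cyclic stabilizer of the edge; the property spreads along
  the connected tree.\<close>

lemma elliptic_commensurable:
  assumes "elliptic G T \<phi> x" "x \<noteq> \<one>" "elliptic G T \<phi> y" "y \<noteq> \<one>"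
  shows "commensurable x y"
proof -
  obtain u where u: "u \<in> verts T" "x \<in> stabilizer G \<phi> u"
    using assms by (auto simp: elliptic_def stabilizer_def)
  obtain v where v: "v \<in> verts T" "y \<in> stabilizer G \<phi> v"
    using assms by (auto simp: elliptic_def stabilizer_def)
  define P where "P v \<longleftrightarrow> (\<forall>y\<in>stabilizer G \<phi> v. y \<noteq> \<one> \<longrightarrow> commensurable x y)" for v
  have same: "commensurable y z"
    if yz: "w \<in> verts T" "y \<in> stabilizer G \<phi> w" "z \<in> stabilizer G \<phi> w" "y \<noteq> \<one>" "z \<noteq> \<one>" for w y z
  proof -
    obtain c where "inf_order c" "stabilizer G \<phi> w = range (\<lambda>k::int. c [^] k)"
      using vertex_generator[OF yz(1)] .
    then show ?thesis using yz commensurable_cyclic[of c y z] by (simp add: inf_order_def)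
  qed
  have "P v"
  proof (rule T.strongly_connected_propagate[OF T.conn u(1) v(1)])
    show "P u" using same[OF u(1) u(2)] assms(2) by (auto simp: P_def)
    show "P (head T e)" if e: "e \<in> arcs T" "P (tail T e)" for e
    proof -
      obtain c where c: "inf_order c" "stabilizer G \<psi> e = range (\<lambda>k::int. c [^] k)"
        using edge_generator[OF e(1)] .
      then have cc: "c \<in> carrier G" "c \<noteq> \<one>" by (auto simp: inf_order_def dest: spec[of _ 1])
      have "c \<in> range (\<lambda>k::int. c [^] k)" by (rule range_eqI[of _ _ 1]) (simp add: cc)
      then have "\<psi> c e = e" using c by (auto simp: stabilizer_def)
      then have st: "c \<in> stabilizer G \<phi> (tail T e)" "c \<in> stabilizer G \<phi> (head T e)"
        using arc_action(2,3)[OF cc(1) e(1)] cc by (auto simp: stabilizer_def)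
      then have xc: "commensurable x c" using e(2) cc by (auto simp: P_def)
      show ?thesis unfolding P_def
      proof (intro ballI impI)
        fix y assume y: "y \<in> stabilizer G \<phi> (head T e)" "y \<noteq> \<one>"
        have "commensurable c y" using same[OF _ st(2) y(1) cc(2) y(2)] e(1) by simp
        moreover have "x \<in> carrier G" "y \<in> carrier G" using y u by (auto simp: stabilizer_def)
        ultimately show "commensurable x y" using commensurable_trans[OF xc] cc by blast
      qed
    qed
  qed
  then show ?thesis using v assms by (auto simp: P_def)
qed

lemma ex_elliptic: "\<exists>x. elliptic G T \<phi> x \<and> x \<noteq> \<one>"
proof -
  obtain v where v: "v \<in> verts T" using T.conn by (auto simp: strongly_connected_def)
  obtain z where z: "inf_order z" "stabilizer G \<phi> v = range (\<lambda>k::int. z [^] k)"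
    using vertex_generator[OF v] .
  then have zc: "z \<in> carrier G" "z \<noteq> \<one>" by (auto simp: inf_order_def dest: spec[of _ 1])
  have "z \<in> range (\<lambda>k::int. z [^] k)" by (rule range_eqI[of _ _ 1]) (simp add: zc)
  then show ?thesis using v z zc by (auto simp: elliptic_def stabilizer_def)
qed

lemma elliptic_conj_ratio:
  assumes "elliptic G T \<phi> x" "x \<noteq> \<one>" "g \<in> carrier G"
  shows "\<exists>q. conj_ratio x g q"
proof -
  obtain v where v: "v \<in> verts T" "\<phi> x v = v" and x: "x \<in> carrier G"
    using assms(1) by (auto simp: elliptic_def)
  have "\<phi> (g \<otimes> x \<otimes> inv g) (\<phi> g v) = \<phi> g v"
    using assms(3) v x by (simp add: action_mult action_inv)
  then have ell: "elliptic G T \<phi> (g \<otimes> x \<otimes> inv g)"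
    using assms(3) v x by (auto simp: elliptic_def)
  have "x = inv g \<otimes> (g \<otimes> x \<otimes> inv g) \<otimes> g"
    using assms(3) x by (simp add: m_assoc inv_solve_left)
  then have "g \<otimes> x \<otimes> inv g \<noteq> \<one>" using assms(2,3) by auto
  then have "commensurable (g \<otimes> x \<otimes> inv g) x"
    using elliptic_commensurable[OF ell _ assms(1,2)] by simp
  then obtain i j :: int where "i \<noteq> 0" "j \<noteq> 0" "(g \<otimes> x \<otimes> inv g) [^] i = x [^] j"
    by (auto simp: commensurable_def)
  then show ?thesis using assms(3) x by (auto simp: conj_ratio_def conj_int_pow)
qed

text \<open>Non-trivial elliptic elements are commensurable and of infinite order, so the
  description in \<open>modular\<close> has a single solution and may be evaluated on any convenient
  \<open>x\<close>.\<close>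

lemma modular_eq:
  assumes "elliptic G T \<phi> x" "x \<noteq> \<one>" "g \<in> carrier G" "conj_ratio x g q"
  shows "modular G T \<phi> g = q"
  unfolding modular_def
proof (rule the_equality)
  show "\<exists>a (m::int) (n::int). elliptic G T \<phi> a \<and> a \<noteq> \<one> \<and> m \<noteq> 0 \<and> n \<noteq> 0 \<and>
      g \<otimes> a [^] m \<otimes> inv g = a [^] n \<and> q = of_int m / of_int n"
    using assms by (auto simp: conj_ratio_def)
  fix q' :: rat assume "\<exists>a (m::int) (n::int). elliptic G T \<phi> a \<and> a \<noteq> \<one> \<and> m \<noteq> 0 \<and> n \<noteq> 0 \<and>
      g \<otimes> a [^] m \<otimes> inv g = a [^] n \<and> q' = of_int m / of_int n"
  then obtain a where a: "elliptic G T \<phi> a" "a \<noteq> \<one>" "conj_ratio a g q'"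
    by (auto simp: conj_ratio_def)
  then have "conj_ratio x g q'"
    using elliptic_commensurable[OF a(1,2) assms(1,2)] assms(1,3) conj_ratio_commensurable
    by (auto simp: elliptic_def)
  then show "q' = q"
    using conj_ratio_unique[OF elliptic_inf_order[OF assms(1,2)] assms(3) _ assms(4)] by simp
qed

lemma subgroup_modular: "subgroup (modular G T \<phi> ` carrier G) rat_units"
proof -
  obtain x where x: "elliptic G T \<phi> x" "x \<noteq> \<one>" using ex_elliptic by blast
  then have xc: "x \<in> carrier G" by (simp add: elliptic_def)
  have m: "conj_ratio x g (modular G T \<phi> g)" if "g \<in> carrier G" for g
    using elliptic_conj_ratio[OF x that] modular_eq[OF x that] by blast
  have one: "modular G T \<phi> \<one> = 1"
    using modular_eq[OF x one_closed] conj_ratio_commute[of \<one> x 1] xc by simp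
  have mult: "modular G T \<phi> (g \<otimes> h) = modular G T \<phi> g * modular G T \<phi> h"
    if "g \<in> carrier G" "h \<in> carrier G" for g h
    using modular_eq[OF x] conj_ratio_mult[OF xc that m[OF that(1)] m[OF that(2)]] that by simp
  have inv: "modular G T \<phi> (inv g) = inverse (modular G T \<phi> g)" if "g \<in> carrier G" for g
    using modular_eq[OF x] conj_ratio_inv[OF xc that m[OF that]] that by simp
  have nz: "modular G T \<phi> g \<noteq> 0" if "g \<in> carrier G" for g
    using conj_ratio_nonzero[OF m[OF that]] .
  show ?thesis
  proof (rule group.subgroupI[OF group_rat_units])
    show "modular G T \<phi> ` carrier G \<subseteq> carrier rat_units" using nz by (auto simp: rat_units_def)
    show "modular G T \<phi> ` carrier G \<noteq> {}" by auto
    show "inv\<^bsub>rat_units\<^esub> q \<in> modular G T \<phi> ` carrier G" if "q \<in> modular G T \<phi> ` carrier G" for q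
      using that nz inv by (auto simp: inv_rat_units simp flip: inv)
    show "q \<otimes>\<^bsub>rat_units\<^esub> q' \<in> modular G T \<phi> ` carrier G"
      if "q \<in> modular G T \<phi> ` carrier G" "q' \<in> modular G T \<phi> ` carrier G" for q q'
      using that by (auto simp: rat_units_def simp flip: mult)
  qed
qed

end

section \<open>Recognizing elementary groups\<close>

context group
begin

lemma ex_conj_pow:
  assumes "\<alpha> \<in> carrier G" "\<tau> \<in> carrier G" "u = 1 \<or> u = (-1::int)" "\<tau> \<otimes> \<alpha> \<otimes> inv \<tau> = \<alpha> [^] u"
  shows "\<exists>j'::int. \<tau> [^] (k::int) \<otimes> \<alpha> [^] (j::int) \<otimes> inv (\<tau> [^] k) = \<alpha> [^] j'"
proof -
  have up: "\<tau> \<otimes> \<alpha> [^] j \<otimes> inv \<tau> = \<alpha> [^] (u * j)" for j :: int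
    using conj_pow_eq[of \<tau> \<alpha> \<alpha> 1 u j] assms by simp
  have uu: "u * (u * j) = j" for j using assms(3) by auto
  have "\<alpha> [^] j = \<tau> \<otimes> \<alpha> [^] (u * j) \<otimes> inv \<tau>" for j :: int
    using up[of "u * j"] unfolding uu by simp
  then have down: "inv \<tau> \<otimes> \<alpha> [^] j \<otimes> \<tau> = \<alpha> [^] (u * j)" for j :: int
    using assms(1,2) by (metis (no_types) inv_closed inv_solve_right int_pow_closed m_assoc m_closed inv_solve_left)
  show ?thesis
  proof (induction k arbitrary: j rule: int_induct[of _ 0])
    case base
    show ?case using assms by auto
  next
    case (step1 k)
    have "\<tau> [^] (k + 1) = \<tau> [^] k \<otimes> \<tau>" using assms by (simp add: int_pow_mult)
    then have "\<tau> [^] (k + 1) \<otimes> \<alpha> [^] j \<otimes> inv (\<tau> [^] (k + 1)) = \<tau> [^] k \<otimes> (\<tau> \<otimes> \<alpha> [^] j \<otimes> inv \<tau>) \<otimes> inv (\<tau> [^] k)"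
      using assms by (simp add: m_assoc inv_mult_group)
    then show ?case using step1(2)[of "u * j"] by (simp add: up)
  next
    case (step2 k)
    have "\<tau> [^] (k - 1) = \<tau> [^] k \<otimes> inv \<tau>" using assms by (simp add: int_pow_diff)
    then have "\<tau> [^] (k - 1) \<otimes> \<alpha> [^] j \<otimes> inv (\<tau> [^] (k - 1)) = \<tau> [^] k \<otimes> (inv \<tau> \<otimes> \<alpha> [^] j \<otimes> \<tau>) \<otimes> inv (\<tau> [^] k)"
      using assms by (simp add: m_assoc inv_mult_group)
    then show ?case using step2(2)[of "u * j"] by (simp add: down)
  qed
qed

lemma generate_normal_form:
  assumes "\<alpha> \<in> carrier G" "\<tau> \<in> carrier G" "u = 1 \<or> u = (-1::int)" "\<tau> \<otimes> \<alpha> \<otimes> inv \<tau> = \<alpha> [^] u"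
    and "g \<in> generate G {\<alpha>, \<tau>}"
  shows "\<exists>(i::int) (k::int). g = \<alpha> [^] i \<otimes> \<tau> [^] k"
  using assms(5)
proof (induction rule: generate.induct)
  case one
  show ?case by (intro exI[of _ 0]) simp
next
  case (incl h)
  then consider "h = \<alpha>" | "h = \<tau>" by blast
  then show ?case
  proof cases
    case 1
    then show ?thesis using assms by (intro exI[of _ 1] exI[of _ 0]) simp
  next
    case 2
    then show ?thesis using assms by (intro exI[of _ 0] exI[of _ 1]) simp
  qed
next
  case (inv h)
  then consider "h = \<alpha>" | "h = \<tau>" by blast
  then show ?case
  proof cases
    case 1
    then show ?thesis using assms by (intro exI[of _ "-1"] exI[of _ 0]) (simp add: int_pow_neg)
  next
    case 2
    then show ?thesis using assms by (intro exI[of _ 0] exI[of _ "-1"]) (simp add: int_pow_neg)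
  qed
next
  case (eng h1 h2)
  then obtain i k j l :: int where h: "h1 = \<alpha> [^] i \<otimes> \<tau> [^] k" "h2 = \<alpha> [^] j \<otimes> \<tau> [^] l" by blast
  obtain j' :: int where j': "\<tau> [^] k \<otimes> \<alpha> [^] j \<otimes> inv (\<tau> [^] k) = \<alpha> [^] j'"
    using ex_conj_pow[OF assms(1-4)] by blast
  have "h1 \<otimes> h2 = \<alpha> [^] i \<otimes> (\<tau> [^] k \<otimes> \<alpha> [^] j \<otimes> inv (\<tau> [^] k)) \<otimes> (\<tau> [^] k \<otimes> \<tau> [^] l)"
    using assms by (simp add: h m_assoc inv_solve_left)
  also have "\<dots> = \<alpha> [^] (i + j') \<otimes> \<tau> [^] (k + l)"
    using assms by (simp add: j' int_pow_mult)
  finally show ?case by blast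
qed

lemma iso_BS_1:
  assumes "\<alpha> \<in> carrier G" "\<tau> \<in> carrier G" "u = 1 \<or> u = (-1::int)" "\<tau> \<otimes> \<alpha> \<otimes> inv \<tau> = \<alpha> [^] u"
    and form: "\<And>g. g \<in> carrier G \<Longrightarrow> \<exists>(i::int) (k::int). g = \<alpha> [^] i \<otimes> \<tau> [^] k"
    and triv: "\<And>i k. \<alpha> [^] (i::int) \<otimes> \<tau> [^] (k::int) = \<one> \<Longrightarrow> i = 0 \<and> k = 0"
  shows "G \<cong> BS 1 u"
proof -
  obtain F where F: "F \<in> hom (BS 1 u) G" "F (bs_a 1 u) = \<alpha>" "F (bs_t 1 u) = \<tau>"
    using BS_hom[OF is_group assms(1,2), of 1 u] assms by auto
  interpret F: group_hom "BS 1 u" G F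
    using F(1) by (simp add: group_hom_def group_hom_axioms_def is_group)
  have pow: "F (bs_a 1 u [^]\<^bsub>BS 1 u\<^esub> i \<otimes>\<^bsub>BS 1 u\<^esub> bs_t 1 u [^]\<^bsub>BS 1 u\<^esub> k) = \<alpha> [^] i \<otimes> \<tau> [^] k" for i k :: int
    by (simp add: F.hom_int_pow F)
  have rel: "bs_t 1 u \<otimes>\<^bsub>BS 1 u\<^esub> bs_a 1 u \<otimes>\<^bsub>BS 1 u\<^esub> inv\<^bsub>BS 1 u\<^esub> bs_t 1 u = bs_a 1 u [^]\<^bsub>BS 1 u\<^esub> u"
    using BS_relation[of 1 u] by simp
  have form': "\<exists>(i::int) (k::int). x = bs_a 1 u [^]\<^bsub>BS 1 u\<^esub> i \<otimes>\<^bsub>BS 1 u\<^esub> bs_t 1 u [^]\<^bsub>BS 1 u\<^esub> k"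
    if "x \<in> carrier (BS 1 u)" for x
    using F.generate_normal_form[OF _ _ assms(3) rel, of x] that generate_BS[of 1 u] by simp
  have "inj_on F (carrier (BS 1 u))"
  proof (rule F.inj_on_one_iff[THEN iffD2], intro allI impI)
    fix x assume x: "x \<in> carrier (BS 1 u)" "F x = \<one>"
    then obtain i k :: int where ik: "x = bs_a 1 u [^]\<^bsub>BS 1 u\<^esub> i \<otimes>\<^bsub>BS 1 u\<^esub> bs_t 1 u [^]\<^bsub>BS 1 u\<^esub> k"
      using form' by blast
    then have "i = 0 \<and> k = 0" using triv pow x by metis
    then show "x = \<one>\<^bsub>BS 1 u\<^esub>" using ik by simp
  qed
  moreover have "F ` carrier (BS 1 u) = carrier G"
  proof
    show "carrier G \<subseteq> F ` carrier (BS 1 u)"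
    proof
      fix g assume "g \<in> carrier G"
      then obtain i k :: int where "g = \<alpha> [^] i \<otimes> \<tau> [^] k" using form by blast
      then have "g = F (bs_a 1 u [^]\<^bsub>BS 1 u\<^esub> i \<otimes>\<^bsub>BS 1 u\<^esub> bs_t 1 u [^]\<^bsub>BS 1 u\<^esub> k)"
        by (simp only: pow)
      then show "g \<in> F ` carrier (BS 1 u)" by (rule image_eqI) simp
    qed
  qed auto
  ultimately have "F \<in> iso (BS 1 u) G" using F(1) by (simp add: iso_def bij_betw_def)
  then show ?thesis using group.iso_sym[OF group_BS] by (auto simp: is_iso_def)
qed

text \<open>The group is \<open>Z^2\<close> for \<open>u = 1\<close> and the Klein bottle group for
  \<open>u = -1\<close>.\<close>

lemma elementary_gbs_of_normal_form:
  assumes "\<alpha> \<in> carrier G" "\<tau> \<in> carrier G" "u = 1 \<or> u = (-1::int)" "\<tau> \<otimes> \<alpha> \<otimes> inv \<tau> = \<alpha> [^] u"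
    and form: "\<And>g. g \<in> carrier G \<Longrightarrow> \<exists>(i::int) (k::int). g = \<alpha> [^] i \<otimes> \<tau> [^] k"
    and triv: "\<And>i k. \<alpha> [^] (i::int) \<otimes> \<tau> [^] (k::int) = \<one> \<Longrightarrow> i = 0 \<and> k = 0"
  shows "elementary_gbs G"
proof (cases "u = 1")
  case False
  then show ?thesis using iso_BS_1[OF assms] assms(3) by (simp add: elementary_gbs_def)
next
  case True
  interpret Z: group "integer_group \<times>\<times> integer_group"
    by (intro DirProd_group) simp_all
  have comm1: "\<tau> \<otimes> \<alpha> = \<alpha> \<otimes> \<tau>"
    using assms(1,2,4) True by (simp add: inv_solve_right')
  have comm: "\<tau> [^] k \<otimes> \<alpha> [^] j = \<alpha> [^] j \<otimes> \<tau> [^] k" for k j :: int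
  proof -
    have "\<tau> \<otimes> \<alpha> [^] j \<otimes> inv \<tau> = \<alpha> [^] j"
      using conj_pow_eq[of \<tau> \<alpha> \<alpha> 1 1 j] assms True by simp
    then have "\<alpha> [^] j \<otimes> \<tau> = \<tau> \<otimes> \<alpha> [^] j" using assms(1,2) by (simp add: inv_solve_right')
    then have "\<alpha> [^] j \<otimes> \<tau> \<otimes> inv (\<alpha> [^] j) = \<tau>" using assms(1,2) by (simp add: m_assoc)
    then have "\<alpha> [^] j \<otimes> \<tau> [^] k \<otimes> inv (\<alpha> [^] j) = \<tau> [^] k"
      using conj_pow_eq[of "\<alpha> [^] j" \<tau> \<tau> 1 1 k] assms by simp
    then show ?thesis using assms(1,2) by (simp add: inv_solve_right')
  qed
  define f where "f = (\<lambda>(i::int, k::int). \<alpha> [^] i \<otimes> \<tau> [^] k)"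
  have "f \<in> hom (integer_group \<times>\<times> integer_group) G"
  proof (rule homI)
    show "f x \<in> carrier G" if "x \<in> carrier (integer_group \<times>\<times> integer_group)" for x
      using assms(1,2) by (auto simp: f_def split: prod.split)
    show "f (x \<otimes>\<^bsub>integer_group \<times>\<times> integer_group\<^esub> y) = f x \<otimes> f y" for x y
    proof -
      obtain i k j l where xy: "x = (i, k)" "y = (j, l)" by (cases x, cases y)
      have "\<alpha> [^] i \<otimes> \<tau> [^] k \<otimes> (\<alpha> [^] j \<otimes> \<tau> [^] l) = \<alpha> [^] i \<otimes> (\<tau> [^] k \<otimes> \<alpha> [^] j) \<otimes> \<tau> [^] l"
        using assms(1,2) by (simp add: m_assoc)
      also have "\<dots> = \<alpha> [^] (i + j) \<otimes> \<tau> [^] (k + l)"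
        unfolding comm using assms(1,2) by (simp add: int_pow_mult m_assoc)
      finally show ?thesis by (simp add: f_def xy DirProd_def)
    qed
  qed
  then interpret f: group_hom "integer_group \<times>\<times> integer_group" G f
    by (simp add: group_hom_def group_hom_axioms_def is_group Z.is_group)
  have "inj_on f (carrier (integer_group \<times>\<times> integer_group))"
  proof (rule f.inj_on_one_iff[THEN iffD2], intro allI impI)
    fix x assume "f x = \<one>"
    then show "x = \<one>\<^bsub>integer_group \<times>\<times> integer_group\<^esub>"
      using triv by (cases x) (auto simp: f_def)
  qed
  moreover have "carrier G \<subseteq> f ` carrier (integer_group \<times>\<times> integer_group)"
    using form by (fastforce simp: f_def)
  ultimately have "f \<in> iso (integer_group \<times>\<times> integer_group) G"
    using f.homh f.hom_closed by (auto simp: iso_def bij_betw_def)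
  then have "G \<cong> integer_group \<times>\<times> integer_group"
    using Z.iso_sym by (auto simp: is_iso_def)
  then show ?thesis by (simp add: elementary_gbs_def)
qed

end

section \<open>Axes of hyperbolic elements\<close>

lemma (in wf_digraph) awalk_nth_adjacent:
  assumes "awalk u p v" "Suc i < length p"
  shows "head G (p ! i) = tail G (p ! Suc i)"
proof -
  have "p = take i p @ p ! i # p ! Suc i # drop (Suc (Suc i)) p"
    using assms(2) by (simp add: Cons_nth_drop_Suc)
  then have "awalk u (take i p @ p ! i # p ! Suc i # drop (Suc (Suc i)) p) v"
    using assms(1) by simp
  then show ?thesis by (simp add: awalk_Cons_iff)
qed

lemma int_div_mod_Suc:
  assumes "(0::int) < l"
  shows "i mod l + 1 < l \<Longrightarrow> (i + 1) div l = i div l \<and> (i + 1) mod l = i mod l + 1"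
    and "\<not> i mod l + 1 < l \<Longrightarrow> (i + 1) div l = i div l + 1 \<and> (i + 1) mod l = 0 \<and> i mod l = l - 1"
proof -
  have b: "0 \<le> i mod l" "i mod l < l" using assms by simp_all
  have e: "i + 1 = l * (i div l) + (i mod l + 1)" by simp
  show "(i + 1) div l = i div l \<and> (i + 1) mod l = i mod l + 1" if "i mod l + 1 < l"
    using that b unfolding e by (metis add.commute add_0 add_nonneg_nonneg div_mult_self2 div_pos_pos_trivial less_imp_neq mod_mult_self2 mod_pos_pos_trivial zero_le_one assms)
  show "(i + 1) div l = i div l + 1 \<and> (i + 1) mod l = 0 \<and> i mod l = l - 1" if "\<not> i mod l + 1 < l"
  proof -
    have "i mod l = l - 1" using that b by linarith
    then have "i + 1 = l * (i div l + 1)" using e by (simp add: algebra_simps)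
    then show ?thesis using assms \<open>i mod l = l - 1\<close> by simp
  qed
qed

context gbs_action
begin

text \<open>Concatenate the translates of a shortest path from a vertex to its image, shortest over
  all vertices. Minimality excludes backtracks inside the path and where it meets its
  translate.\<close>

lemma ex_axis:
  assumes a: "a \<in> carrier G" and hyp: "\<And>v. v \<in> verts T \<Longrightarrow> \<phi> a v \<noteq> v"
  obtains y l where "T.line y" "l \<noteq> 0" "\<And>i. \<psi> a (y i) = y (i + l)"
proof -
  define P where "P k \<longleftrightarrow> (\<exists>v p. T.awalk v p (\<phi> a v) \<and> length p = k)" for k
  define k where "k = (LEAST k. P k)"
  obtain v0 where v0: "v0 \<in> verts T" using T.conn by (auto simp: strongly_connected_def)
  have "\<exists>k. P k"
    using T.strongly_connected_awalk[OF T.conn v0 vert_action[OF a v0]] unfolding P_def by metis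
  then have "P k" and least: "\<And>j. P j \<Longrightarrow> k \<le> j"
    unfolding k_def by (metis LeastI_ex) (rule Least_le)
  then obtain v p where p: "T.awalk v p (\<phi> a v)" "length p = k" by (auto simp: P_def)
  have v: "v \<in> verts T" using p(1) by auto
  have k: "k > 0" using p hyp[OF v] by (cases p) (auto simp: T.awalk_Nil_iff)
  have arcs: "p ! i \<in> arcs T" if "i < k" for i using p that by (auto dest: nth_mem)
  have hd: "tail T (p ! 0) = v"
    using p k by (cases p) (auto simp: T.awalk_Cons_iff)
  have last: "head T (p ! (k - 1)) = \<phi> a v"
  proof -
    have "p = butlast p @ [p ! (k - 1)]" using p(2) k by (metis append_butlast_last_id last_conv_nth length_greater_0_conv)
    then have "T.awalk v (butlast p @ [p ! (k - 1)]) (\<phi> a v)" using p(1) by simp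
    then show ?thesis by (simp add: T.awalk_Cons_iff T.awalk_Nil_iff)
  qed
  have red: "p ! Suc i \<noteq> r (p ! i)" if i: "Suc i < k" for i
  proof
    assume eq: "p ! Suc i = r (p ! i)"
    have "p = take i p @ p ! i # p ! Suc i # drop (Suc (Suc i)) p"
      using i p(2) by (simp add: Cons_nth_drop_Suc)
    then have "T.awalk v (take i p @ p ! i # r (p ! i) # drop (Suc (Suc i)) p) (\<phi> a v)"
      using p(1) eq by simp
    then have "T.awalk v (take i p @ drop (Suc (Suc i)) p) (\<phi> a v)"
      by (auto simp: T.awalk_Cons_iff)
    then have "P (length (take i p @ drop (Suc (Suc i)) p))" unfolding P_def by blast
    then show False using least i p(2) by fastforce
  qed
  \<comment> \<open>For a path of length 1 this would be an inversion. For a longer one, starting at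
    its second vertex would give a path shorter by two.\<close>
  have cyc: "\<psi> a (p ! 0) \<noteq> r (p ! (k - 1))"
  proof
    assume eq: "\<psi> a (p ! 0) = r (p ! (k - 1))"
    show False
    proof (cases "k = 1")
      case True
      then show False using eq equivariant[OF a arcs[of 0]] by simp
    next
      case False
      then obtain e q f where q: "p = e # q @ [f]"
        using p(2) k by (cases p; cases "tl p" rule: rev_cases) auto
      then have "T.awalk (head T e) (q @ [f]) (\<phi> a v)" "e \<in> arcs T"
        using p(1) by (auto simp: T.awalk_Cons_iff)
      then have w: "T.awalk (head T e) q (tail T f)" "f \<in> arcs T" by (auto simp: T.awalk_Cons_iff)
      have "p ! (k - 1) = f" using q p(2) by (auto simp: nth_append)
      then have "\<psi> a e = r f" using eq q by simp
      then have "\<phi> a (head T e) = tail T f"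
        using arc_action(3)[OF a \<open>e \<in> arcs T\<close>] w(2) by simp
      then have "P (length q)" using w(1) unfolding P_def by metis
      then show False using least[of "length q"] q p(2) by simp
    qed
  qed
  define l where "l = int k"
  have l: "l > 0" using k by (simp add: l_def)
  define y where "y i = \<psi> (a [^] (i div l)) (p ! nat (i mod l))" for i
  have nat: "nat (i mod l) < k" for i using l by (simp add: l_def nat_less_iff)
  have "head T (y i) = tail T (y (i + 1)) \<and> y (i + 1) \<noteq> r (y i)" for i
  proof (cases "i mod l + 1 < l")
    case True
    define n where "n = nat (i mod l)"
    have "int n = i mod l" using l by (simp add: n_def)
    then have n: "Suc n < k" using True by (simp add: l_def)
    have "y i = \<psi> (a [^] (i div l)) (p ! n)" "y (i + 1) = \<psi> (a [^] (i div l)) (p ! Suc n)"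
      using int_div_mod_Suc(1)[OF l True] l by (simp_all add: y_def n_def nat_add_distrib)
    moreover have "\<psi> (inv (a [^] (i div l))) (\<psi> (a [^] (i div l)) (p ! Suc n)) = p ! Suc n"
      "\<psi> (inv (a [^] (i div l))) (\<psi> (a [^] (i div l)) (r (p ! n))) = r (p ! n)"
      using arcs n a by (simp_all add: action_inv del: arc_action(4))
    ultimately show ?thesis
      using red[OF n] arcs[of n] arcs[of "Suc n"] n a T.awalk_nth_adjacent[OF p(1), of n] p(2)
      by (auto simp flip: arc_action(4))
  next
    case False
    have "nat (int k - 1) = k - 1" using k by linarith
    then have "y i = \<psi> (a [^] (i div l)) (p ! (k - 1))"
      using int_div_mod_Suc(2)[OF l False] by (simp add: y_def l_def)
    moreover have "y (i + 1) = \<psi> (a [^] (i div l)) (\<psi> a (p ! 0))"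
      using int_div_mod_Suc(2)[OF l False] a arcs[of 0] k by (simp add: y_def int_pow_mult action_mult)
    moreover have "\<psi> (inv (a [^] (i div l))) (\<psi> (a [^] (i div l)) (\<psi> a (p ! 0))) = \<psi> a (p ! 0)"
      "\<psi> (inv (a [^] (i div l))) (\<psi> (a [^] (i div l)) (r (p ! (k - 1)))) = r (p ! (k - 1))"
      using arcs k a by (simp_all add: action_inv del: arc_action(4))
    ultimately show ?thesis
      using cyc arcs[of 0] arcs[of "k - 1"] k a last hd
      by (auto simp flip: arc_action(4))
  qed
  moreover have "y i \<in> arcs T" for i
    using nat arcs a by (simp add: y_def)
  ultimately have "T.line y" by (simp add: T.line_def)
  moreover have "\<psi> a (y i) = y (i + l)" for i
  proof -
    have "(i + l) div l = 1 + i div l" "(i + l) mod l = i mod l" using l by simp_all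
    then show ?thesis using nat arcs a by (simp add: y_def int_pow_mult action_mult)
  qed
  ultimately show thesis using l by (intro that) auto
qed

section \<open>Translations and reflections of an axis\<close>

definition translates :: "(int \<Rightarrow> 'e) \<Rightarrow> 'a \<Rightarrow> int \<Rightarrow> bool" where
  "translates y h j \<longleftrightarrow> (\<forall>i. \<psi> h (y i) = y (i + j))"

text \<open>For even \<open>j\<close> the arc \<open>y (j div 2)\<close> would be inverted, so in an
  action without inversions \<open>j\<close> is odd and the reflection fixes a vertex of the
  line.\<close>

definition reflects :: "(int \<Rightarrow> 'e) \<Rightarrow> 'a \<Rightarrow> int \<Rightarrow> bool" where
  "reflects y h j \<longleftrightarrow> (\<forall>i. \<psi> h (y i) = r (y (j - i)))"

context
  fixes y :: "int \<Rightarrow> 'e"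
  assumes y: "T.line y"
begin

lemma y_arc: "y i \<in> arcs T" "head T (y i) = tail T (y (i + 1))"
  using y by (auto simp: T.line_def)

lemma translates_mult:
  "g \<in> carrier G \<Longrightarrow> h \<in> carrier G \<Longrightarrow> translates y g i \<Longrightarrow> translates y h j \<Longrightarrow> translates y (g \<otimes> h) (i + j)"
  by (auto simp: translates_def action_mult y_arc add_ac)

lemma translates_inv:
  assumes "g \<in> carrier G" "translates y g i"
  shows "translates y (inv g) (- i)"
  unfolding translates_def
proof
  fix k
  have "y k = \<psi> g (y (k + - i))" using assms(2) by (simp add: translates_def)
  then show "\<psi> (inv g) (y k) = y (k + - i)" using action_inv(2)[OF assms(1) y_arc(1)] by simp
qed

lemma translates_int_pow:
  assumes "g \<in> carrier G" "translates y g i"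
  shows "translates y (g [^] (k::int)) (k * i)"
proof (induction k rule: int_induct[of _ 0])
  case base
  show ?case by (simp add: translates_def action_one y_arc)
next
  case (step1 k)
  have "g [^] (k + 1) = g [^] k \<otimes> g" "(k + 1) * i = k * i + i"
    using assms(1) int_pow_mult[of g k 1] by (simp_all add: algebra_simps)
  then show ?case
    using translates_mult[OF _ assms(1) step1(2) assms(2)] assms(1) by simp
next
  case (step2 k)
  then show ?case
    using translates_mult[OF _ _ _ translates_inv[OF assms], of "g [^] k" "k * i"] assms(1)
    by (simp add: int_pow_diff algebra_simps)
qed

lemma reflects_mult:
  assumes "g \<in> carrier G" "h \<in> carrier G"
  shows "reflects y g i \<Longrightarrow> translates y h j \<Longrightarrow> reflects y (g \<otimes> h) (i - j)"
    and "translates y g i \<Longrightarrow> reflects y h j \<Longrightarrow> reflects y (g \<otimes> h) (i + j)"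
    and "reflects y g i \<Longrightarrow> reflects y h j \<Longrightarrow> translates y (g \<otimes> h) (i - j)"
  using assms by (auto simp: translates_def reflects_def action_mult y_arc algebra_simps)

lemma not_translates_reflects: "translates y g i \<Longrightarrow> reflects y g j \<Longrightarrow> False"
  using T.line_neq_arev[OF y] by (auto simp: translates_def reflects_def)

lemma translates_unique: "translates y g i \<Longrightarrow> translates y g j \<Longrightarrow> i = j"
  using T.line_inj[OF y] by (auto simp: translates_def)

text \<open>The image of \<open>y\<close> under \<open>h\<close> is an axis of the conjugate of
  \<open>a\<close>, and some power of this conjugate is a power of \<open>a\<close>. So the powers
  of \<open>a^n\<close> translate both lines, by multiples of \<open>n * l\<close> and of
  \<open>m * l\<close>, and \<open>line_coincide\<close> applies.\<close>

lemma line_preserved: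
  assumes a: "a \<in> carrier G" "translates y a l" "l \<noteq> 0" and h: "h \<in> carrier G" "conj_ratio a h q"
  shows "(\<exists>j. translates y h j) \<or> (\<exists>j. reflects y h j)"
proof -
  obtain m n :: int where mn: "m \<noteq> 0" "n \<noteq> 0" "h \<otimes> a [^] m \<otimes> inv h = a [^] n"
    using h(2) by (auto simp: conj_ratio_def)
  define y' where "y' i = \<psi> h (y i)" for i
  have y': "T.line y'"
    unfolding T.line_def
  proof (intro allI conjI)
    fix i
    show "y' i \<in> arcs T" "head T (y' i) = tail T (y' (i + 1))"
      using h(1) y_arc by (simp_all add: y'_def)
    have "y (i + 1) \<noteq> r (y i)" using y by (simp add: T.line_def)
    then show "y' (i + 1) \<noteq> r (y' i)"
      using action_inv(2)[OF h(1) y_arc(1)[of "i + 1"]] action_inv(2)[OF h(1), of "r (y i)"] h(1) y_arc(1)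
      by (metis T.arev_in_arcs arc_action(4) y'_def)
  qed
  have pow: "\<psi> (a [^] k) (y i) = y (i + k * l)" for k i :: int
    using translates_int_pow[OF a(1,2), of k] by (simp add: translates_def)
  have "y' i \<in> range y \<union> r ` range y" for i
  proof (rule T.line_coincide[OF y y', of "n * l" "m * l" "\<lambda>N. \<psi> (a [^] (n * N))"])
    show "n * l \<noteq> 0" "m * l \<noteq> 0" using mn a(3) by auto
    show "\<psi> (a [^] (n * N)) (y i) = y (i + N * (n * l))" for N i
      by (simp add: pow mult_ac)
    show "\<psi> (a [^] (n * N)) (y' i) = y' (i + N * (m * l))" for N i
    proof -
      have "a [^] (n * N) \<otimes> h = h \<otimes> a [^] (m * N)"
        using conj_pow_eq[OF h(1) a(1) a(1) mn(3), of N] h(1) a(1) by (metis inv_solve_right' int_pow_closed m_closed)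
      then have "\<psi> (a [^] (n * N)) (\<psi> h (y i)) = \<psi> h (\<psi> (a [^] (m * N)) (y i))"
        using h(1) a(1) y_arc(1) by (metis action_mult(2) int_pow_closed)
      then show ?thesis by (simp add: y'_def pow mult_ac)
    qed
    show "\<psi> (a [^] (n * - N)) (\<psi> (a [^] (n * N)) e) = e" if "e \<in> arcs T" for N e
      using action_inv(2)[of "a [^] (n * N)" e] a(1) that by (simp add: int_pow_neg)
    show "\<psi> (a [^] (n * N)) (r e) = r (\<psi> (a [^] (n * N)) e)" if "e \<in> arcs T" for N e
      using that a(1) by simp
    show "T.awalk (tail T (\<psi> (a [^] (n * N)) (y 0))) (map (\<psi> (a [^] (n * N))) p) (tail T (\<psi> (a [^] (n * N)) (y' 0)))"
      if "T.awalk (tail T (y 0)) p (tail T (y' 0))" for N p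
      using action_walk[OF _ that, of "a [^] (n * N)"] a(1) h(1) y_arc by (simp add: y'_def)
  qed
  then show ?thesis
    using T.line_follows[OF y y'] unfolding translates_def reflects_def y'_def by metis
qed

end

text \<open>The axis of \<open>a\<close> is invariant under the whole group. The stabilizer \<open>\<langle>z\<rangle>\<close> of an
  arc of the axis is the kernel of the action on the axis, and the quotient is infinite cyclic or
  infinite dihedral.\<close>

theorem elementary_if_commensurated_hyperbolic:
  assumes a: "a \<in> carrier G" and hyp: "\<And>v. v \<in> verts T \<Longrightarrow> \<phi> a v \<noteq> v"
    and comm: "\<And>g. g \<in> carrier G \<Longrightarrow> \<exists>q. conj_ratio a g q"
  shows "elementary_gbs G"
proof -
  obtain y l where y: "T.line y" and l: "l \<noteq> 0" "\<And>i. \<psi> a (y i) = y (i + l)"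
    using ex_axis[OF a hyp] by blast
  then have al: "translates y a l" by (simp add: translates_def)
  note arc = y_arc[OF y] and mult = translates_mult[OF y] and inv = translates_inv[OF y]
    and pow = translates_int_pow[OF y] and rmult = reflects_mult[OF y]
  have cases: "(\<exists>j. translates y h j) \<or> (\<exists>j. reflects y h j)" if "h \<in> carrier G" for h
    using line_preserved[OF y a al l(1) that] comm[OF that] by blast
  obtain z where z: "inf_order z" "stabilizer G \<psi> (y 0) = range (\<lambda>k::int. z [^] k)"
    using edge_generator[OF arc(1)] .
  have zc: "z \<in> carrier G" using z(1) by (simp add: inf_order_def)
  have stab: "(\<exists>k::int. h = z [^] k) \<longleftrightarrow> translates y h 0" if h: "h \<in> carrier G" for h
  proof
    assume "\<exists>k::int. h = z [^] k"
    then have fix0: "\<psi> h (y 0) = y 0" using z(2) h by (auto simp: stabilizer_def)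
    from cases[OF h] show "translates y h 0"
    proof
      assume "\<exists>j. translates y h j"
      then obtain j where j: "translates y h j" ..
      then have "y (0 + j) = y 0" using fix0 by (simp add: translates_def)
      then have "j = 0" using T.line_inj[OF y] by simp
      with j show ?thesis by simp
    next
      assume "\<exists>j. reflects y h j"
      then obtain j where "reflects y h j" ..
      then have "r (y (j - 0)) = y 0" using fix0 by (simp add: reflects_def)
      then show ?thesis using T.line_neq_arev[OF y] by metis
    qed
  next
    assume "translates y h 0"
    then have "h \<in> stabilizer G \<psi> (y 0)" using h by (simp add: stabilizer_def translates_def)
    then show "\<exists>k::int. h = z [^] k" using z(2) by auto
  qed
  have zt: "translates y (z [^] (k::int)) 0" for k
    using stab[of "z [^] k"] zc by blast
  have z0: "translates y z 0" using zt[of 1] zc by simp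
  \<comment> \<open>Translation amounts form a subgroup of the integers; an element \<open>t\<close>
    realising its generator produces, together with \<open>z\<close>, everything that translates the
    axis.\<close>
  define J where "J = {j. \<exists>h\<in>carrier G. translates y h j}"
  have "0 \<in> J" unfolding J_def using zt[of 0] by auto
  moreover have "i - j \<in> J" if "i \<in> J" "j \<in> J" for i j
    using that mult[OF _ inv_closed _ inv] unfolding J_def by fastforce
  ultimately obtain d where d: "J = range (\<lambda>k. d * k)" by (rule subgroup_int_multiples)
  have "d \<noteq> 0" using d al a l(1) by (auto simp: J_def)
  have "d \<in> J" unfolding d by (rule range_eqI[of _ _ 1]) simp
  then obtain t where t: "t \<in> carrier G" "translates y t d" by (auto simp: J_def)
  have form: "\<exists>(i::int) (k::int). h = t [^] k \<otimes> z [^] i"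
    if th: "t \<in> carrier G" "translates y t d" and h: "h \<in> carrier G" "translates y h j" for t h j
  proof -
    have "j \<in> J" using h by (auto simp: J_def)
    then obtain k where k: "j = d * k" using d by blast
    have "translates y (inv (t [^] k) \<otimes> h) (- (k * d) + j)"
      using th h by (intro mult inv pow) auto
    then have "translates y (inv (t [^] k) \<otimes> h) 0" by (simp add: k mult.commute)
    then obtain i :: int where "inv (t [^] k) \<otimes> h = z [^] i"
      using stab[of "inv (t [^] k) \<otimes> h"] th h by auto
    then have "h = t [^] k \<otimes> z [^] i" using th h zc by (metis inv_solve_left' int_pow_closed m_closed)
    then show ?thesis by blast
  qed
  show ?thesis
  proof (cases "\<exists>b\<in>carrier G. \<exists>j. reflects y b j")
    case False
    then have tr: "\<exists>j. translates y h j" if "h \<in> carrier G" for h using cases that by blast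
    have conj: "\<exists>u::int. g \<otimes> z \<otimes> inv g = z [^] u" if g: "g \<in> carrier G" for g
    proof -
      obtain i where i: "translates y g i" using tr g by blast
      have "translates y (g \<otimes> z \<otimes> inv g) (i + 0 + - i)"
        using g zc i z0 by (intro mult inv) auto
      then show ?thesis using stab[of "g \<otimes> z \<otimes> inv g"] g zc by auto
    qed
    \<comment> \<open>Conjugation by \<open>t\<close> and by its inverse both preserve
      \<open><z>\<close>, so \<open>u\<close> and \<open>v\<close> are inverse integers.\<close>
    obtain u v :: int where u: "t \<otimes> z \<otimes> inv t = z [^] u" and v: "inv t \<otimes> z \<otimes> inv (inv t) = z [^] v"
      using conj t(1) by (metis inv_closed)
    have "inv t \<otimes> z [^] u \<otimes> inv (inv t) = z [^] (v * u)"
      using conj_pow_eq[of "inv t" z z 1 v u] v t(1) zc by simp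
    moreover have "inv t \<otimes> z [^] u \<otimes> inv (inv t) = z [^] (1::int)"
      unfolding u[symmetric] using t(1) zc by (simp add: m_assoc inv_solve_left')
    ultimately have "v * u = 1" using int_pow_eq_iff[OF z(1)] by metis
    then have u1: "u = 1 \<or> u = -1" by (metis zmult_eq_1_iff)
    show ?thesis
    proof (rule elementary_gbs_of_normal_form[OF zc t(1) u1 u])
      fix g assume g: "g \<in> carrier G"
      then obtain j where "translates y (inv g) j" using tr by blast
      then obtain i k :: int where "inv g = t [^] k \<otimes> z [^] i" using form[OF t] g by blast
      then have "g = z [^] (- i) \<otimes> t [^] (- k)"
        using g t(1) zc by (metis inv_inv inv_mult_group int_pow_closed int_pow_neg)
      then show "\<exists>(i::int) (k::int). g = z [^] i \<otimes> t [^] k" by blast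
    next
      fix i k :: int assume eq: "z [^] i \<otimes> t [^] k = \<one>"
      have "translates y (z [^] i \<otimes> t [^] k) (0 + k * d)"
        using zc t by (intro mult pow zt) auto
      then have "0 + k * d = 0" using translates_unique[OF y] zt[of 0] eq by (metis int_pow_0)
      then have "k = 0" using \<open>d \<noteq> 0\<close> by simp
      then show "i = 0 \<and> k = 0" using eq z(1) zc by (auto simp: inf_order_def)
    qed
  next
    case True
    \<comment> \<open>A reflection \<open>h\<close> fixes a vertex of the axis. The generator
      \<open>\<beta>\<close> of the stabilizer of that vertex reflects as well, and \<open>z\<close>
      is \<open>\<beta>^2\<close> or \<open>\<beta>^-2\<close>; so \<open>h\<close> is an odd power
      of \<open>\<beta>\<close>, which commutes with \<open>z\<close> and has an odd power of
      \<open>z\<close> as its square.\<close>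
    have refl: "h \<otimes> z = z \<otimes> h \<and> (\<exists>x::int. h \<otimes> h = z [^] (2 * x + 1))"
      if h: "h \<in> carrier G" "reflects y h j" for h j
    proof -
      have "odd j"
      proof
        assume "even j"
        then obtain i where "j = 2 * i" by blast
        then have "\<psi> h (y i) = r (y i)" using h(2) by (simp add: reflects_def)
        then show False using equivariant[OF h(1) arc(1)] by blast
      qed
      then obtain i where i: "j = 2 * i - 1" by (metis odd_two_times_div_two_succ add_diff_cancel_right' distrib_left mult_2 one_add_one add.assoc diff_add_eq)
      define v where "v = tail T (y i)"
      have v: "v \<in> verts T" using arc(1) by (simp add: v_def)
      have "\<phi> h v = tail T (r (y (i - 1)))"
        using arc_action(2)[OF h(1) arc(1), of i] h(2) by (simp add: v_def reflects_def i algebra_simps)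
      then have hv: "\<phi> h v = v" using arc(1)[of "i - 1"] arc(2)[of "i - 1"] by (simp add: v_def)
      obtain \<beta> where \<beta>: "inf_order \<beta>" "stabilizer G \<phi> v = range (\<lambda>k::int. \<beta> [^] k)"
        using vertex_generator[OF v] .
      have \<beta>c: "\<beta> \<in> carrier G" using \<beta>(1) by (simp add: inf_order_def)
      have "\<beta> \<in> range (\<lambda>k::int. \<beta> [^] k)" by (rule range_eqI[of _ _ 1]) (simp add: \<beta>c)
      then have \<beta>v: "\<phi> \<beta> v = v" using \<beta>(2) by (auto simp: stabilizer_def)
      obtain w :: int where w: "h = \<beta> [^] w" using hv h(1) \<beta>(2) by (auto simp: stabilizer_def)
      have "\<phi> z v = v" using arc_action(2)[OF zc arc(1)[of i]] z0 by (simp add: v_def translates_def)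
      then obtain x :: int where x: "z = \<beta> [^] x" using zc \<beta>(2) by (auto simp: stabilizer_def)
      have nt: "\<not> (\<exists>k. translates y \<beta> k)"
      proof
        assume "\<exists>k. translates y \<beta> k"
        then obtain k where "translates y \<beta> k" ..
        then have "translates y h (w * k)" unfolding w by (intro pow \<beta>c)
        then show False using not_translates_reflects[OF y _ h(2)] by blast
      qed
      then obtain k where k: "reflects y \<beta> k" using cases[OF \<beta>c] by blast
      have "translates y (\<beta> \<otimes> \<beta>) (k - k)" using k \<beta>c by (intro rmult(3)) auto
      then obtain p :: int where p: "\<beta> \<otimes> \<beta> = z [^] p" using stab[of "\<beta> \<otimes> \<beta>"] \<beta>c by auto
      have sq: "\<beta> \<otimes> \<beta> = \<beta> [^] (2::int)" using \<beta>c int_pow_mult[of \<beta> 1 1] by simp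
      have tr2: "translates y (\<beta> [^] (2 * i)) 0" for i :: int
      proof -
        have "\<beta> [^] (2 * i) = z [^] (p * i)" using p sq \<beta>c zc by (metis int_pow_pow)
        then show ?thesis using zt by simp
      qed
      have odd_refl: "reflects y (\<beta> [^] (2 * i + 1)) (0 + k)" for i :: int
        using rmult(2)[OF _ \<beta>c tr2[of i] k] \<beta>c by (simp add: int_pow_mult)
      have "odd w"
      proof
        assume "even w"
        then obtain w' where "w = 2 * w'" by blast
        then show False using not_translates_reflects[OF y tr2[of w'] ] h(2) w by blast
      qed
      then obtain w' where w': "w = 2 * w' + 1" by (elim oddE)
      have "even x"
      proof (rule ccontr)
        assume "odd x"
        then obtain x' where "x = 2 * x' + 1" by (elim oddE)
        then show False using not_translates_reflects[OF y z0] odd_refl[of x'] x by blast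
      qed
      then obtain x' where x': "x = 2 * x'" by blast
      have "\<beta> [^] (2::int) = \<beta> [^] (x * p)"
        using p sq x \<beta>c by (simp add: int_pow_pow)
      then have "2 = x * p" using int_pow_eq_iff[OF \<beta>(1)] by blast
      then have xp: "x' * p = 1" using x' by simp
      then have x'1: "x' = 1 \<or> x' = -1" by (metis zmult_eq_1_iff)
      have "h \<otimes> h = \<beta> [^] (w + w)" using w \<beta>c int_pow_mult by metis
      also have "w + w = x * (x' * (2 * w' + 1))" using x'1 by (auto simp: x' w')
      also have "\<beta> [^] \<dots> = z [^] (x' * (2 * w' + 1))" using x \<beta>c by (simp add: int_pow_pow)
      finally have hh: "h \<otimes> h = z [^] (x' * (2 * w' + 1))" .
      have "odd (x' * (2 * w' + 1))" using x'1 by auto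
      then obtain x'' where "x' * (2 * w' + 1) = 2 * x'' + 1" by (elim oddE)
      then have "h \<otimes> h = z [^] (2 * x'' + 1)" using hh by simp
      moreover have "h \<otimes> z = z \<otimes> h"
        using w x \<beta>c by (simp add: add.commute flip: int_pow_mult)
      ultimately show ?thesis by blast
    qed
    \<comment> \<open>Since \<open>h\<close> commutes with \<open>z\<close>, multiplying it by
      \<open>z^(-x)\<close> corrects its square to \<open>z\<close> exactly.\<close>
    have adjust: "(h \<otimes> z [^] (- x)) \<otimes> (h \<otimes> z [^] (- x)) = z"
      if h: "h \<in> carrier G" "h \<otimes> z = z \<otimes> h" "h \<otimes> h = z [^] (2 * x + 1)" for h and x :: int
    proof -
      have "h \<otimes> z \<otimes> inv h = z" using h(1,2) zc by (simp add: m_assoc)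
      then have "h \<otimes> z [^] (- x) \<otimes> inv h = z [^] (- x)"
        using conj_pow_eq[of h z z 1 1 "- x"] h(1) zc by simp
      then have c: "h \<otimes> z [^] (- x) = z [^] (- x) \<otimes> h" using h(1) zc by (metis inv_solve_right' int_pow_closed m_closed)
      have "(h \<otimes> z [^] (- x)) \<otimes> (h \<otimes> z [^] (- x)) = (h \<otimes> z [^] (- x)) \<otimes> (z [^] (- x) \<otimes> h)"
        by (simp only: c)
      also have "\<dots> = h \<otimes> (z [^] (- x) \<otimes> z [^] (- x)) \<otimes> h" using h(1) zc by (simp add: m_assoc)
      also have "\<dots> = h \<otimes> z [^] (- x) \<otimes> (z [^] (- x) \<otimes> h)" using h(1) zc by (simp add: m_assoc)
      also have "\<dots> = (z [^] (- x) \<otimes> h) \<otimes> (h \<otimes> z [^] (- x))" by (simp only: c)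
      also have "\<dots> = z [^] (- x) \<otimes> (h \<otimes> h) \<otimes> z [^] (- x)" using h(1) zc by (simp add: m_assoc)
      also have "\<dots> = z [^] (- x + (2 * x + 1) + - x)" unfolding h(3) using zc by (simp only: int_pow_mult int_pow_closed)
      finally show ?thesis using zc by simp
    qed
    obtain b0 j0 where b0: "b0 \<in> carrier G" "reflects y b0 j0" using True by blast
    obtain x0 :: int where x0: "b0 \<otimes> z = z \<otimes> b0" "b0 \<otimes> b0 = z [^] (2 * x0 + 1)" using refl[OF b0] by blast
    define b where "b = b0 \<otimes> z [^] (- x0)"
    have b: "b \<in> carrier G" "b \<otimes> b = z" using b0 zc adjust[OF b0(1) x0] by (auto simp: b_def)
    have br: "reflects y b (j0 - 0)" unfolding b_def using b0 zc zt by (intro rmult(1)) auto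
    have btr: "reflects y (b \<otimes> t) (j0 - 0 - d)" using b br t by (intro rmult(1)) auto
    then obtain x1 :: int where x1: "b \<otimes> t \<otimes> z = z \<otimes> (b \<otimes> t)" "(b \<otimes> t) \<otimes> (b \<otimes> t) = z [^] (2 * x1 + 1)"
      using refl[OF _ btr] b(1) t(1) by auto
    \<comment> \<open>The correction makes \<open>b\<close> and \<open>b s\<close> both have square
      \<open>z\<close>; then \<open>(b s)^2 = b^2\<close> yields \<open>b s b^-1 = s^-1\<close>, the
      relation of the Klein bottle group.\<close>
    define s where "s = t \<otimes> z [^] (- x1)"
    have s: "s \<in> carrier G" "translates y s d"
      using t zc mult[OF _ _ t(2) zt[of "- x1"]] by (auto simp: s_def)
    have bs: "(b \<otimes> s) \<otimes> (b \<otimes> s) = z"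
      using adjust[OF _ x1] b(1) t(1) zc by (simp add: s_def m_assoc)
    have sbs: "s \<otimes> (b \<otimes> s) = b"
    proof -
      have "b \<otimes> (s \<otimes> (b \<otimes> s)) = b \<otimes> b" using bs b s(1) by (simp add: m_assoc)
      then show ?thesis using b(1) s(1) by (metis l_cancel m_closed)
    qed
    have conj: "b \<otimes> s \<otimes> inv b = s [^] (-1::int)"
    proof -
      have "b \<otimes> s = inv s \<otimes> b" using sbs b(1) s(1) by (metis inv_solve_left m_closed)
      then have "b \<otimes> s \<otimes> inv b = inv s" using b(1) s(1) by (simp add: m_assoc)
      then show ?thesis using s(1) by (simp add: int_pow_neg)
    qed
    have zb: "z [^] (i::int) = b [^] (2 * i)" for i
    proof -
      have "z = b [^] (2::int)" using b int_pow_mult[of b 1 1] by simp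
      then show ?thesis using b(1) by (simp add: int_pow_pow)
    qed
    show ?thesis
    proof (rule elementary_gbs_of_normal_form[OF s(1) b(1) _ conj])
      fix g assume g: "g \<in> carrier G"
      from cases[OF g] show "\<exists>(i::int) (k::int). g = s [^] i \<otimes> b [^] k"
      proof
        assume "\<exists>j. translates y g j"
        then obtain i k :: int where "g = s [^] k \<otimes> z [^] i" using form[OF s g] by blast
        then show ?thesis unfolding zb by blast
      next
        assume "\<exists>j. reflects y g j"
        then obtain j where "reflects y g j" ..
        then have "translates y (g \<otimes> b) (j - (j0 - 0))" using g b br by (intro rmult(3)) auto
        then obtain i k :: int where "g \<otimes> b = s [^] k \<otimes> z [^] i" using form[OF s] g b(1) by blast
        then have "g = s [^] k \<otimes> z [^] i \<otimes> inv b" using g b(1) s(1) zc by (metis inv_solve_right int_pow_closed m_closed)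
        then have "g = s [^] k \<otimes> b [^] (2 * i - 1)"
          using b(1) s(1) by (simp add: zb m_assoc int_pow_diff)
        then show ?thesis by blast
      qed
    next
      fix i k :: int assume eq: "s [^] i \<otimes> b [^] k = \<one>"
      have si: "translates y (s [^] i) (i * d)" using s by (intro pow)
      have one: "translates y \<one> 0" using zt[of 0] by simp
      \<comment> \<open>Odd powers of \<open>b\<close> reflect the axis, which neither powers of
        \<open>s\<close> nor the identity do.\<close>
      have "even k"
      proof (rule ccontr)
        assume "odd k"
        then obtain k' where k': "k = 2 * k' + 1" by (elim oddE)
        have "b [^] k = z [^] k' \<otimes> b" unfolding k' zb using b(1) by (simp add: int_pow_mult)
        moreover have "reflects y (z [^] k' \<otimes> b) (0 + (j0 - 0))" using zc b br zt by (intro rmult(2)) auto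
        ultimately have "reflects y (s [^] i \<otimes> b [^] k) (i * d + (0 + (j0 - 0)))"
          using s b si by (intro rmult(2)) auto
        then show False using eq not_translates_reflects[OF y one] by simp
      qed
      then obtain k' where k': "k = 2 * k'" by blast
      have "translates y (s [^] i \<otimes> z [^] k') (i * d + 0)" using s zc si zt by (intro mult) auto
      then have "i * d + 0 = 0" using translates_unique[OF y _ one] eq k' zb by metis
      then have "i = 0" using \<open>d \<noteq> 0\<close> by simp
      then have "z [^] k' = \<one>" using eq b(1) by (simp add: k' zb)
      then show "i = 0 \<and> k = 0" using z(1) \<open>i = 0\<close> k' by (auto simp: inf_order_def)
    qed simp
  qed
qed

end

section \<open>The group of a labelled graph\<close>

lemma ex_common_denominator:
  assumes "finite V"
  shows "\<exists>D::int. D \<noteq> 0 \<and> (\<forall>v\<in>V. \<exists>k::int. of_int D * (p v :: rat) = of_int k)"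
  using assms
proof (induction V)
  case empty
  show ?case by (intro exI[of _ 1]) simp
next
  case (insert x V)
  then obtain D :: int where D: "D \<noteq> 0" "\<forall>v\<in>V. \<exists>k::int. of_int D * p v = of_int k" by blast
  obtain m n where q: "quotient_of (p x) = (m, n)" by (cases "quotient_of (p x)")
  have mn: "p x = of_int m / of_int n" "n \<noteq> 0"
    using quotient_of_div[OF q] quotient_of_denom_pos[OF q] by auto
  have "\<exists>k::int. of_int (D * n) * p v = of_int k" if v: "v \<in> insert x V" for v
  proof (cases "v = x")
    case True
    then show ?thesis using mn by (intro exI[of _ "D * m"]) simp
  next
    case False
    then obtain k :: int where "of_int D * p v = of_int k" using D v by blast
    then have "of_int n * (of_int D * p v) = of_int (n * k)" by simp
    then have "of_int (D * n) * p v = of_int (n * k)" by (simp only: of_int_mult mult.assoc mult.left_commute)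
    then show ?thesis by blast
  qed
  then show ?case using D(1) mn(2) by (intro exI[of _ "D * n"]) simp
qed

lemma ex_primitive_integer_multiple:
  fixes p :: "'v \<Rightarrow> rat"
  assumes "finite V" "V \<noteq> {}" "\<And>v. v \<in> V \<Longrightarrow> p v \<noteq> 0"
  obtains w :: "'v \<Rightarrow> int" and c where "c \<noteq> 0" "\<And>v. v \<in> V \<Longrightarrow> of_int (w v) = c * p v"
    "\<forall>d. (\<forall>v\<in>V. d dvd w v) \<longrightarrow> is_unit d"
proof -
  obtain D :: int where D: "D \<noteq> 0" "\<forall>v\<in>V. \<exists>k::int. of_int D * p v = of_int k"
    using ex_common_denominator[OF assms(1)] by blast
  then obtain k :: "'v \<Rightarrow> int" where k: "\<And>v. v \<in> V \<Longrightarrow> of_int D * p v = of_int (k v)" by metis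
  have nz: "k v \<noteq> 0" if "v \<in> V" for v
    using k[OF that] D(1) assms(3)[OF that] by auto
  define g where "g = Gcd (k ` V)"
  have g0: "g \<noteq> 0" using nz assms(2) by (auto simp: g_def)
  have gk: "g * (k v div g) = k v" if "v \<in> V" for v
    using that by (simp add: g_def)
  show thesis
  proof (rule that[of "of_int D / of_int g" "\<lambda>v. k v div g"])
    show "(of_int D / of_int g :: rat) \<noteq> 0" using D(1) g0 by simp
    show "of_int (k v div g) = of_int D / of_int g * p v" if "v \<in> V" for v
    proof -
      have "(of_int g :: rat) * of_int (k v div g) = of_int D * p v"
        using gk[OF that] k[OF that] by (metis of_int_mult)
      then show ?thesis using g0 by (simp add: field_simps)
    qed
    show "\<forall>d. (\<forall>v\<in>V. d dvd k v div g) \<longrightarrow> is_unit d"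
    proof (intro allI impI)
      fix d assume d: "\<forall>v\<in>V. d dvd k v div g"
      have "g * d dvd k v" if "v \<in> V" for v
        using mult_dvd_mono[OF dvd_refl d[rule_format, OF that], of g] gk[OF that] by simp
      then have "g * d dvd Gcd (k ` V)" by (auto intro!: Gcd_greatest)
      then have "g * d dvd g * 1" by (simp only: g_def[symmetric] mult_1_right)
      then show "is_unit d" using g0 unfolding dvd_mult_cancel_left by simp
    qed
  qed
qed

locale labelled_presentation = group G for G (structure) +
  fixes \<Gamma> :: "('w, 'f) pre_digraph" and s :: "'f \<Rightarrow> 'f" and l :: "'f \<Rightarrow> int" and A :: "'f set"
    and \<theta> :: "('w, 'f) gog_gen word set \<Rightarrow> 'a"
  assumes graph: "connected_labelled_graph \<Gamma> s l"
    and subtree: "maximal_subtree \<Gamma> s A"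
    and \<theta>: "\<theta> \<in> iso (fundamental_group \<Gamma> s l A) G"

lemma represents_presentation:
  assumes "group G" "represents \<Gamma> s l G"
  obtains A \<theta> where "labelled_presentation G \<Gamma> s l A \<theta>"
proof -
  obtain A where A: "connected_labelled_graph \<Gamma> s l" "maximal_subtree \<Gamma> s A" "G \<cong> fundamental_group \<Gamma> s l A"
    using assms(2) by (auto simp: represents_def)
  then have "fundamental_group \<Gamma> s l A \<cong> G"
    using group.iso_sym[OF assms(1)] by blast
  then obtain \<theta> where "\<theta> \<in> iso (fundamental_group \<Gamma> s l A) G" by (auto simp: is_iso_def)
  then have "labelled_presentation G \<Gamma> s l A \<theta>"
    using A assms(1) by (simp add: labelled_presentation_def labelled_presentation_axioms_def)
  then show thesis by (rule that)
qed

context labelled_presentation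
begin

sublocale \<Gamma>: bidirected_digraph \<Gamma> s
  using graph by (simp add: connected_labelled_graph_def)

sublocale A: serre_tree_graph "\<Gamma>\<lparr>arcs := A\<rparr>" "\<lambda>e. if e \<in> A then s e else e"
  using subtree by (simp add: maximal_subtree_def serre_tree_iff)

lemma finite_graph: "finite (verts \<Gamma>)" "finite (arcs \<Gamma>)"
  using graph by (auto simp: connected_labelled_graph_def fin_digraph_def fin_digraph_axioms_def)

lemma l_nonzero: "e \<in> arcs \<Gamma> \<Longrightarrow> l e \<noteq> 0"
  using graph by (simp add: connected_labelled_graph_def)

lemma A_arcs: "A \<subseteq> arcs \<Gamma>"
  using subtree by (simp add: maximal_subtree_def)

lemma A_s: "e \<in> A \<Longrightarrow> s e \<in> A"
  using A.arev_in_arcs[of e] by (simp split: if_splits)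

lemma A_s_iff: "e \<in> arcs \<Gamma> \<Longrightarrow> s e \<in> A \<longleftrightarrow> e \<in> A"
  using A_s[of e] A_s[of "s e"] by auto

lemma verts_nonempty: "verts \<Gamma> \<noteq> {}"
  using graph by (auto simp: connected_labelled_graph_def strongly_connected_def)

text \<open>By \<open>card_arcs\<close> the maximal subtree accounts for
  \<open>2 * (card (verts \<Gamma>) - 1)\<close> arcs, so the Betti number counts the pairs of
  opposite arcs whose stable letter is not killed by a relation.\<close>

lemma betti_eq: "int (card (arcs \<Gamma> - A)) = 2 * betti \<Gamma>"
proof -
  obtain O' where O': "O' \<subseteq> arcs \<Gamma>" "\<And>e. e \<in> arcs \<Gamma> \<Longrightarrow> e \<in> O' \<longleftrightarrow> s e \<notin> O'"
    using \<Gamma>.ex_orientation[OF finite_graph(2)] by blast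
  have "card (arcs \<Gamma>) = 2 * card O'" using \<Gamma>.card_orientation[OF finite_graph(2) O'] .
  moreover have "card A = 2 * (card (verts \<Gamma>) - 1)"
    using A.card_arcs finite_graph A_arcs finite_subset by fastforce
  moreover have "card (verts \<Gamma>) \<ge> 1"
    using verts_nonempty finite_graph(1) by (simp add: Suc_le_eq card_gt_0_iff)
  moreover have "card (arcs \<Gamma> - A) = card (arcs \<Gamma>) - card A"
    using A_arcs finite_graph(2) by (metis card_Diff_subset finite_subset)
  moreover have "card A \<le> card (arcs \<Gamma>)" using A_arcs finite_graph(2) by (rule card_mono[rotated])
  ultimately show ?thesis by (simp add: betti_def)
qed

definition gens :: "('w, 'f) gog_gen set" where "gens = Vert ` verts \<Gamma> \<union> Edge ` arcs \<Gamma>"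

definition pgen :: "('w, 'f) gog_gen \<Rightarrow> ('w, 'f) gog_gen word set" where
  "pgen = pres_gen gens (gog_relations \<Gamma> s l A)"

definition av :: "'w \<Rightarrow> 'a" where "av v = \<theta> (pgen (Vert v))"
definition te :: "'f \<Rightarrow> 'a" where "te e = \<theta> (pgen (Edge e))"

abbreviation P where "P \<equiv> fundamental_group \<Gamma> s l A"

lemma P_eq: "P = presented_group gens (gog_relations \<Gamma> s l A)"
  by (simp add: fundamental_group_def gens_def)

sublocale P: group P
  by (simp add: P_eq group_presented_group)

sublocale \<theta>: group_hom P G \<theta>
  using \<theta> by (simp add: group_hom_def group_hom_axioms_def iso_def P.is_group is_group)

lemma pgen_closed: "x \<in> gens \<Longrightarrow> pgen x \<in> carrier P"
  by (simp add: P_eq pgen_def pres_gen_closed)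

lemma pgen_vert [simp]: "v \<in> verts \<Gamma> \<Longrightarrow> pgen (Vert v) \<in> carrier P"
  and pgen_edge [simp]: "e \<in> arcs \<Gamma> \<Longrightarrow> pgen (Edge e) \<in> carrier P"
  by (auto intro: pgen_closed simp: gens_def)

lemma av_closed [simp]: "v \<in> verts \<Gamma> \<Longrightarrow> av v \<in> carrier G"
  and te_closed [simp]: "e \<in> arcs \<Gamma> \<Longrightarrow> te e \<in> carrier G"
  by (auto simp: av_def te_def)

lemma generate_av_te: "generate G (av ` verts \<Gamma> \<union> te ` arcs \<Gamma>) = carrier G"
proof -
  have "generate P (pgen ` gens) = carrier P"
    by (simp add: P_eq pgen_def generate_presented_group)
  moreover have "\<theta> ` generate P (pgen ` gens) = generate G (\<theta> ` pgen ` gens)"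
    using pgen_closed by (intro \<theta>.generate_img[symmetric]) auto
  moreover have "\<theta> ` carrier P = carrier G" using \<theta> by (auto simp: iso_def bij_betw_def)
  moreover have "\<theta> ` pgen ` gens = av ` verts \<Gamma> \<union> te ` arcs \<Gamma>"
    by (simp add: gens_def image_Un image_image av_def te_def)
  ultimately show ?thesis by simp
qed

lemma P_relation:
  assumes "(u, v) \<in> gog_relations \<Gamma> s l A"
  shows "word_val P pgen u = word_val P pgen v"
  unfolding P_eq pgen_def
proof (rule presented_group_relation[OF assms])
  show "u \<in> words gens" "v \<in> words gens"
    using assms A_arcs by (auto simp: gog_relations_def words_def gens_def gen_pow_def)
qed

lemma te_A: "e \<in> A \<Longrightarrow> te e = \<one>"
proof -
  assume e: "e \<in> A"
  have "word_val P pgen [(Edge e, True)] = word_val P pgen []"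
    using e by (intro P_relation) (auto simp: gog_relations_def)
  then have "\<theta> (pgen (Edge e)) = \<theta> \<one>\<^bsub>P\<^esub>"
    using e A_arcs by auto
  then show ?thesis by (simp add: te_def)
qed

lemma te_conj:
  assumes e: "e \<in> arcs \<Gamma>"
  shows "te e \<otimes> av (head \<Gamma> e) [^] l (s e) \<otimes> inv te e = av (tail \<Gamma> e) [^] l e"
proof -
  have "word_val P pgen ([(Edge e, True)] @ gen_pow (Vert (head \<Gamma> e)) (l (s e)) @ [(Edge e, False)]) =
      word_val P pgen (gen_pow (Vert (tail \<Gamma> e)) (l e))"
    using e by (intro P_relation) (auto simp: gog_relations_def)
  then have "pgen (Edge e) \<otimes>\<^bsub>P\<^esub> pgen (Vert (head \<Gamma> e)) [^]\<^bsub>P\<^esub> l (s e) \<otimes>\<^bsub>P\<^esub> inv\<^bsub>P\<^esub> pgen (Edge e) =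
      pgen (Vert (tail \<Gamma> e)) [^]\<^bsub>P\<^esub> l e"
    using e by (subst (asm) P.word_val_conj_gen_pow) (auto simp: P.word_val_gen_pow)
  then have "\<theta> (pgen (Edge e) \<otimes>\<^bsub>P\<^esub> pgen (Vert (head \<Gamma> e)) [^]\<^bsub>P\<^esub> l (s e) \<otimes>\<^bsub>P\<^esub> inv\<^bsub>P\<^esub> pgen (Edge e)) =
      \<theta> (pgen (Vert (tail \<Gamma> e)) [^]\<^bsub>P\<^esub> l e)"
    by simp
  then show ?thesis using e by (simp add: av_def te_def \<theta>.hom_int_pow)
qed

lemma ex_hom:
  assumes H: "group H" and cl: "\<And>v. v \<in> verts \<Gamma> \<Longrightarrow> \<alpha> v \<in> carrier H" "\<And>e. e \<in> arcs \<Gamma> \<Longrightarrow> \<tau> e \<in> carrier H"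
    and inv: "\<And>e. e \<in> arcs \<Gamma> \<Longrightarrow> \<tau> e \<otimes>\<^bsub>H\<^esub> \<tau> (s e) = \<one>\<^bsub>H\<^esub>"
    and conj: "\<And>e. e \<in> arcs \<Gamma> \<Longrightarrow> \<tau> e \<otimes>\<^bsub>H\<^esub> \<alpha> (head \<Gamma> e) [^]\<^bsub>H\<^esub> l (s e) \<otimes>\<^bsub>H\<^esub> inv\<^bsub>H\<^esub> \<tau> e =
      \<alpha> (tail \<Gamma> e) [^]\<^bsub>H\<^esub> l e"
    and one: "\<And>e. e \<in> A \<Longrightarrow> \<tau> e = \<one>\<^bsub>H\<^esub>"
  obtains f where "f \<in> hom G H" "\<And>v. v \<in> verts \<Gamma> \<Longrightarrow> f (av v) = \<alpha> v" "\<And>e. e \<in> arcs \<Gamma> \<Longrightarrow> f (te e) = \<tau> e"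
proof -
  interpret H: group H by fact
  \<comment> \<open>The value 1 outside the graph is a default: \<open>presented_group_hom\<close>
    wants \<open>\<gamma>\<close> on the whole type.\<close>
  define \<gamma> where "\<gamma> x = (case x of Vert v \<Rightarrow> if v \<in> verts \<Gamma> then \<alpha> v else \<one>\<^bsub>H\<^esub>
    | Edge e \<Rightarrow> if e \<in> arcs \<Gamma> then \<tau> e else \<one>\<^bsub>H\<^esub>)" for x
  have \<gamma>: "\<gamma> (Vert v) = \<alpha> v" if "v \<in> verts \<Gamma>" for v using that by (simp add: \<gamma>_def)
  have \<gamma>': "\<gamma> (Edge e) = \<tau> e" if "e \<in> arcs \<Gamma>" for e using that by (simp add: \<gamma>_def)
  have cl': "\<gamma> x \<in> carrier H" for x using cl by (cases x) (auto simp: \<gamma>_def)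
  have rels: "word_val H \<gamma> u = word_val H \<gamma> v" if uv: "(u, v) \<in> gog_relations \<Gamma> s l A" for u v
  proof -
    consider e where "e \<in> arcs \<Gamma>" "u = [(Edge e, True), (Edge (s e), True)]" "v = []"
      | e where "e \<in> arcs \<Gamma>" "u = [(Edge e, True)] @ gen_pow (Vert (head \<Gamma> e)) (l (s e)) @ [(Edge e, False)]"
        "v = gen_pow (Vert (tail \<Gamma> e)) (l e)"
      | e where "e \<in> A" "u = [(Edge e, True)]" "v = []"
      using uv unfolding gog_relations_def by blast
    then show ?thesis
    proof cases
      case 1
      then show ?thesis using inv cl(2) by (simp add: \<gamma>')
    next
      case 2
      then show ?thesis
        unfolding 2(2,3) H.word_val_gen_pow[where \<gamma> = \<gamma>, OF cl'] H.word_val_conj_gen_pow[where \<gamma> = \<gamma>, OF cl']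
        using conj by (simp add: \<gamma> \<gamma>')
    next
      case 3
      then have "e \<in> arcs \<Gamma>" using A_arcs by blast
      then show ?thesis using 3 one by (simp add: \<gamma>')
    qed
  qed
  obtain F where F: "F \<in> hom (presented_group gens (gog_relations \<Gamma> s l A)) H"
    "\<And>x. x \<in> gens \<Longrightarrow> F (pres_gen gens (gog_relations \<Gamma> s l A) x) = \<gamma> x"
    using presented_group_hom[OF H cl' rels] by blast
  define f where "f = F \<circ> inv_into (carrier P) \<theta>"
  have "inv_into (carrier P) \<theta> \<in> hom G P"
    using P.iso_set_sym[OF \<theta>] by (simp add: iso_def)
  then have "f \<in> hom G H"
    unfolding f_def using F(1) unfolding P_eq[symmetric] by (rule Group.hom_compose)
  moreover have inj: "inv_into (carrier P) \<theta> (\<theta> x) = x" if "x \<in> carrier P" for x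
    using \<theta> that by (intro inv_into_f_f) (auto simp: iso_def bij_betw_def)
  moreover have "f (av v) = \<alpha> v" if "v \<in> verts \<Gamma>" for v
  proof -
    have "Vert v \<in> gens" using that by (simp add: gens_def)
    then show ?thesis using F(2)[of "Vert v"] that inj by (simp add: f_def av_def pgen_def[symmetric] \<gamma>)
  qed
  moreover have "f (te e) = \<tau> e" if "e \<in> arcs \<Gamma>" for e
  proof -
    have "Edge e \<in> gens" using that by (simp add: gens_def)
    then show ?thesis using F(2)[of "Edge e"] that inj by (simp add: f_def te_def pgen_def[symmetric] \<gamma>')
  qed
  ultimately show thesis using that by blast
qed

text \<open>Stable letters of the subtree are trivial, so \<open>a_v\<close> can go to
  \<open>a^(w_v)\<close> with \<open>a\<close> of infinite order only under these equations; a
  potential on the subtree solves them. They are homogeneous, so the solution can be scaled to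
  coprime integers, which later puts \<open>a\<close> into the image.\<close>

lemma ex_weights:
  obtains w :: "'w \<Rightarrow> int" where "\<And>v. v \<in> verts \<Gamma> \<Longrightarrow> w v \<noteq> 0"
    "\<And>e. e \<in> A \<Longrightarrow> w (head \<Gamma> e) * l (s e) = w (tail \<Gamma> e) * l e"
    "\<forall>d. (\<forall>v\<in>verts \<Gamma>. d dvd w v) \<longrightarrow> is_unit d"
proof -
  have A: "e \<in> arcs \<Gamma>" if "e \<in> A" for e using A_arcs that by blast
  define c :: "'f \<Rightarrow> rat" where "c e = of_int (l e) / of_int (l (s e))" for e
  obtain p where p: "\<And>v. v \<in> verts \<Gamma> \<Longrightarrow> p v \<noteq> 0" "\<And>e. e \<in> A \<Longrightarrow> p (head \<Gamma> e) = p (tail \<Gamma> e) * c e"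
  proof (rule A.ex_potential[of c])
    show "c e \<noteq> 0" if "e \<in> arcs (\<Gamma>\<lparr>arcs := A\<rparr>)" for e
      using that A l_nonzero by (simp add: c_def)
    show "c (if e \<in> A then s e else e) = inverse (c e)" if "e \<in> arcs (\<Gamma>\<lparr>arcs := A\<rparr>)" for e
      using that A by (simp add: c_def)
  qed auto
  show thesis
  proof (rule ex_primitive_integer_multiple[OF finite_graph(1) verts_nonempty, of p])
    show "p v \<noteq> 0" if "v \<in> verts \<Gamma>" for v using p(1)[OF that] .
    fix w :: "'w \<Rightarrow> int" and k
    assume w: "k \<noteq> 0" "\<And>v. v \<in> verts \<Gamma> \<Longrightarrow> of_int (w v) = k * p v"
      "\<forall>d. (\<forall>v\<in>verts \<Gamma>. d dvd w v) \<longrightarrow> is_unit d"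
    show thesis
  proof (rule that[OF _ _ w(3)])
    show "w v \<noteq> 0" if "v \<in> verts \<Gamma>" for v
      using w(2)[OF that] w(1) p(1)[OF that] by auto
    show "w (head \<Gamma> e) * l (s e) = w (tail \<Gamma> e) * l e" if "e \<in> A" for e
    proof -
      have "of_int (w (head \<Gamma> e) * l (s e)) = (of_int (w (tail \<Gamma> e) * l e) :: rat)"
        using w(2) p(2)[OF that] A[OF that] l_nonzero[of "s e"] by (simp add: c_def)
      then show ?thesis by (simp only: of_int_eq_iff)
    qed
  qed
  qed
qed

end

text \<open>The labels determine the vertex generators up to commensurability: \<open>av v\<close> behaves like
  translation by \<open>w v\<close>, and \<open>te e\<close> scales by \<open>1 / ratio e\<close>.\<close>

locale weighted_presentation = labelled_presentation G \<Gamma> s l A \<theta>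
  for G (structure) and \<Gamma> :: "('w, 'f) pre_digraph" and s l A \<theta> +
  fixes w :: "'w \<Rightarrow> int"
  assumes w_nonzero: "\<And>v. v \<in> verts \<Gamma> \<Longrightarrow> w v \<noteq> 0"
    and w_A: "\<And>e. e \<in> A \<Longrightarrow> w (head \<Gamma> e) * l (s e) = w (tail \<Gamma> e) * l e"
    and w_primitive: "\<forall>d. (\<forall>v\<in>verts \<Gamma>. d dvd w v) \<longrightarrow> is_unit d"
begin

definition ratio :: "'f \<Rightarrow> rat" where
  "ratio e = of_int (w (head \<Gamma> e) * l (s e)) / of_int (w (tail \<Gamma> e) * l e)"

lemma ratio_nonzero: "e \<in> arcs \<Gamma> \<Longrightarrow> ratio e \<noteq> 0"
  using w_nonzero l_nonzero by (simp add: ratio_def)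

lemma ratio_s: "e \<in> arcs \<Gamma> \<Longrightarrow> ratio (s e) = inverse (ratio e)"
  by (simp add: ratio_def)

lemma ratio_A: "e \<in> A \<Longrightarrow> ratio e = 1"
  using w_A[of e] ratio_nonzero[of e] A_arcs by (auto simp: ratio_def)

text \<open>The affine maps \<open>x \<mapsto> x + w v\<close> and
  \<open>x \<mapsto> x / ratio e\<close> of the rationals satisfy the defining relations, and
  translation by a non-zero number has infinite order.\<close>

lemma inf_order_av:
  assumes "v \<in> verts \<Gamma>"
  shows "inf_order (av v)"
proof -
  let ?H = "perm_group :: (rat \<Rightarrow> rat) monoid"
  define \<alpha> :: "'w \<Rightarrow> rat \<Rightarrow> rat" where "\<alpha> v = (\<lambda>x. x + of_int (w v))" for v
  define \<tau> :: "'f \<Rightarrow> rat \<Rightarrow> rat" where "\<tau> e = (\<lambda>x. x / ratio e)" for e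
  have pow: "\<alpha> v [^]\<^bsub>?H\<^esub> k = (\<lambda>x. x + of_int k * of_int (w v))" for v and k :: int
    using int_pow_perm_group[of "\<lambda>k x. x + of_int k * of_int (w v)" k]
    by (simp add: \<alpha>_def fun_eq_iff algebra_simps)
  have \<tau>_inv: "\<tau> e \<circ> \<tau> (s e) = id" "\<tau> (s e) \<circ> \<tau> e = id" if "e \<in> arcs \<Gamma>" for e
    using that ratio_nonzero[OF that] by (auto simp: \<tau>_def ratio_s fun_eq_iff field_simps)
  have bij: "bij (\<tau> e)" if "e \<in> arcs \<Gamma>" for e
    using \<tau>_inv[OF that] by (metis o_bij)
  have inv: "inv\<^bsub>?H\<^esub> (\<tau> e) = \<tau> (s e)" if "e \<in> arcs \<Gamma>" for e
    using \<tau>_inv[OF that] by (rule inv_perm_group)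
  obtain f where f: "f \<in> hom G ?H" "\<And>v. v \<in> verts \<Gamma> \<Longrightarrow> f (av v) = \<alpha> v"
  proof (rule ex_hom[of ?H \<alpha> \<tau>])
    show "\<alpha> v \<in> carrier ?H" for v
      by (auto simp: \<alpha>_def intro!: o_bij[of "\<lambda>x. x - of_int (w v)"])
    show "\<tau> e \<otimes>\<^bsub>?H\<^esub> \<alpha> (head \<Gamma> e) [^]\<^bsub>?H\<^esub> l (s e) \<otimes>\<^bsub>?H\<^esub> inv\<^bsub>?H\<^esub> \<tau> e = \<alpha> (tail \<Gamma> e) [^]\<^bsub>?H\<^esub> l e"
      if e: "e \<in> arcs \<Gamma>" for e
    proof
      fix x
      have "of_int (l (s e)) * of_int (w (head \<Gamma> e)) / ratio e = of_int (l e) * of_int (w (tail \<Gamma> e))"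
        using ratio_nonzero[OF e] by (simp add: ratio_def field_simps)
      then show "(\<tau> e \<otimes>\<^bsub>?H\<^esub> \<alpha> (head \<Gamma> e) [^]\<^bsub>?H\<^esub> l (s e) \<otimes>\<^bsub>?H\<^esub> inv\<^bsub>?H\<^esub> \<tau> e) x = (\<alpha> (tail \<Gamma> e) [^]\<^bsub>?H\<^esub> l e) x"
        unfolding inv[OF e] pow using e ratio_nonzero[OF e]
        by (simp add: \<tau>_def ratio_s add_divide_distrib)
    qed
    show "\<tau> e = \<one>\<^bsub>?H\<^esub>" if "e \<in> A" for e using that by (simp add: \<tau>_def ratio_A fun_eq_iff)
  qed (auto simp: bij \<tau>_inv)
  interpret f: group_hom G ?H f
    using f(1) by (simp add: group_hom_def group_hom_axioms_def is_group)
  have "k = 0" if "av v [^] k = \<one>" for k :: int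
  proof -
    have "f (av v [^] k) = id" using that f.hom_one by simp
    then have "(\<lambda>x. x + of_int k * of_int (w v)) = (id :: rat \<Rightarrow> rat)"
      using assms f.hom_int_pow[of "av v" k] by (simp add: f(2) pow)
    then have "0 + of_int k * of_int (w v) = (0 :: rat)" by (metis id_apply)
    then show ?thesis using w_nonzero[OF assms] by simp
  qed
  then show ?thesis using assms by (simp add: inf_order_def)
qed

lemma av_commensurable:
  assumes u: "u \<in> verts \<Gamma>" and v: "v \<in> verts \<Gamma>"
  obtains i j :: int where "i \<noteq> 0" "j \<noteq> 0" "av u [^] i = av v [^] j" "i * w u = j * w v"
proof -
  define Q where "Q v \<longleftrightarrow> (v \<in> verts \<Gamma> \<longrightarrow> (\<exists>i j :: int. i \<noteq> 0 \<and> j \<noteq> 0 \<and> av u [^] i = av v [^] j \<and> i * w u = j * w v))" for v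
  have "Q v"
  proof (rule A.strongly_connected_propagate[OF A.conn])
    show "u \<in> verts (\<Gamma>\<lparr>arcs := A\<rparr>)" "v \<in> verts (\<Gamma>\<lparr>arcs := A\<rparr>)" using u v by simp_all
    show "Q u" unfolding Q_def by (intro impI exI[of _ 1]) simp
    show "Q (head (\<Gamma>\<lparr>arcs := A\<rparr>) e)" if eA: "e \<in> arcs (\<Gamma>\<lparr>arcs := A\<rparr>)" and Q: "Q (tail (\<Gamma>\<lparr>arcs := A\<rparr>) e)" for e
    proof -
      have e: "e \<in> A" "e \<in> arcs \<Gamma>" using eA A_arcs by auto
      then obtain i j :: int where ij: "i \<noteq> 0" "j \<noteq> 0" "av u [^] i = av (tail \<Gamma> e) [^] j" "i * w u = j * w (tail \<Gamma> e)"
        using Q by (auto simp: Q_def)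
      have rel: "av (head \<Gamma> e) [^] l (s e) = av (tail \<Gamma> e) [^] l e"
        using te_conj[OF e(2)] te_A[OF e(1)] e(2) by simp
      have "av u [^] (i * l e) = (av u [^] i) [^] l e" using u by (simp add: int_pow_pow)
      also have "\<dots> = (av (tail \<Gamma> e) [^] l e) [^] j" using ij e(2) by (simp add: int_pow_pow mult.commute)
      also have "\<dots> = av (head \<Gamma> e) [^] (l (s e) * j)" using e(2) by (simp add: int_pow_pow flip: rel)
      finally have "av u [^] (i * l e) = av (head \<Gamma> e) [^] (l (s e) * j)" .
      moreover have "i * l e * w u = l (s e) * j * w (head \<Gamma> e)"
      proof -
        have "i * l e * w u = l e * (i * w u)" by (simp add: mult_ac)
        also have "\<dots> = j * (w (tail \<Gamma> e) * l e)" by (simp add: ij(4) mult_ac)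
        also have "\<dots> = j * (w (head \<Gamma> e) * l (s e))" by (simp only: w_A[OF e(1)])
        finally show ?thesis by (simp add: mult_ac)
      qed
      ultimately show ?thesis using ij(1,2) l_nonzero e(2) unfolding Q_def
        by (intro impI exI[of _ "i * l e"] exI[of _ "l (s e) * j"]) simp
    qed
  qed
  then show thesis using v that by (auto simp: Q_def)
qed

lemma conj_ratio_av:
  assumes u: "u \<in> verts \<Gamma>" and v: "v \<in> verts \<Gamma>"
  shows "conj_ratio (av u) (av v) 1"
proof -
  obtain i j :: int where ij: "i \<noteq> 0" "av u [^] i = av v [^] j" using av_commensurable[OF u v] .
  have "av v \<otimes> av v [^] j = av v [^] j \<otimes> av v"
    using v int_pow_mult[of "av v" 1 j] int_pow_mult[of "av v" j 1] by (simp add: add.commute)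
  then show ?thesis using conj_ratio_commute[of "av v" "av u" i] u v ij by simp
qed

text \<open>The relation of \<open>e\<close> conjugates a power of the generator at the head to one
  at the tail. Both are rewritten as powers of \<open>av u\<close>, and the weights turn the
  quotient of exponents into \<open>ratio e\<close>.\<close>

lemma conj_ratio_te:
  assumes u: "u \<in> verts \<Gamma>" and e: "e \<in> arcs \<Gamma>"
  shows "conj_ratio (av u) (te e) (ratio e)"
proof -
  have h: "head \<Gamma> e \<in> verts \<Gamma>" "tail \<Gamma> e \<in> verts \<Gamma>" using e by simp_all
  obtain i j :: int where ij: "i \<noteq> 0" "j \<noteq> 0" "av u [^] i = av (head \<Gamma> e) [^] j" "i * w u = j * w (head \<Gamma> e)"
    using av_commensurable[OF u h(1)] .
  obtain i' j' :: int where ij': "i' \<noteq> 0" "j' \<noteq> 0" "av u [^] i' = av (tail \<Gamma> e) [^] j'" "i' * w u = j' * w (tail \<Gamma> e)"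
    using av_commensurable[OF u h(2)] .
  have pow: "av u [^] (i * k) = av (head \<Gamma> e) [^] (j * k)" "av u [^] (i' * k) = av (tail \<Gamma> e) [^] (j' * k)" for k
    using ij(3) ij'(3) u h by (metis int_pow_pow av_closed)+
  have "te e \<otimes> av (head \<Gamma> e) [^] (l (s e) * (j * j')) \<otimes> inv te e = av (tail \<Gamma> e) [^] (l e * (j * j'))"
    using e by (intro conj_pow_eq te_conj) auto
  moreover have "l (s e) * (j * j') = j * (l (s e) * j')" "l e * (j * j') = j' * (l e * j)" by (simp_all add: mult_ac)
  ultimately have "te e \<otimes> av u [^] (i * (l (s e) * j')) \<otimes> inv te e = av u [^] (i' * (l e * j))"
    unfolding pow by simp
  moreover have "ratio e = of_int (i * (l (s e) * j')) / of_int (i' * (l e * j))"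
  proof -
    have nz: "w (tail \<Gamma> e) \<noteq> 0" "w u \<noteq> 0" "l e \<noteq> 0" using w_nonzero u h l_nonzero[OF e] by auto
    have "w u * (w (head \<Gamma> e) * l (s e) * (i' * (l e * j))) = (j * w (head \<Gamma> e)) * (i' * w u) * l (s e) * l e"
      by (simp add: mult_ac)
    also have "\<dots> = w u * (i * (l (s e) * j') * (w (tail \<Gamma> e) * l e))"
      unfolding ij(4)[symmetric] ij'(4) by (simp add: mult_ac)
    finally have "w (head \<Gamma> e) * l (s e) * (i' * (l e * j)) = i * (l (s e) * j') * (w (tail \<Gamma> e) * l e)"
      using nz by simp
    then have "(of_int (w (head \<Gamma> e) * l (s e)) * of_int (i' * (l e * j)) :: rat) =
        of_int (i * (l (s e) * j')) * of_int (w (tail \<Gamma> e) * l e)"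
      by (metis of_int_mult)
    then show ?thesis unfolding ratio_def using nz ij' ij by (subst frac_eq_eq) auto
  qed
  ultimately show ?thesis unfolding conj_ratio_def using ij ij' l_nonzero[OF e] l_nonzero[of "s e"] e
    by (intro exI[of _ "i * (l (s e) * j')"] exI[of _ "i' * (l e * j)"]) simp
qed

lemma ex_conj_ratio_av:
  assumes "u \<in> verts \<Gamma>" "g \<in> carrier G"
  shows "\<exists>q. conj_ratio (av u) g q"
proof (rule conj_ratio_generate)
  show "g \<in> generate G (av ` verts \<Gamma> \<union> te ` arcs \<Gamma>)" using assms(2) by (simp add: generate_av_te)
  show "\<exists>q. conj_ratio (av u) x q" if "x \<in> av ` verts \<Gamma> \<union> te ` arcs \<Gamma>" for x
    using that conj_ratio_av[OF assms(1)] conj_ratio_te[OF assms(1)] by blast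
qed (use assms in auto)

end

section \<open>Epimorphisms onto Baumslag-Solitar groups\<close>

context group
begin

lemma conj_nat_pow_pow:
  assumes "a \<in> carrier G" "t \<in> carrier G" "t \<otimes> a [^] (m::int) \<otimes> inv t = a [^] (n::int)"
  shows "t [^] (k::nat) \<otimes> a [^] (m ^ k * c) \<otimes> inv (t [^] k) = a [^] (n ^ k * c)"
proof (induction k arbitrary: c)
  case (Suc k)
  have "t [^] Suc k \<otimes> a [^] (m ^ Suc k * c) \<otimes> inv (t [^] Suc k) =
      t [^] k \<otimes> (t \<otimes> a [^] (m * (m ^ k * c)) \<otimes> inv t) \<otimes> inv (t [^] k)"
    using assms(1,2) by (simp add: m_assoc inv_mult_group mult.assoc)
  also have "t \<otimes> a [^] (m * (m ^ k * c)) \<otimes> inv t = a [^] (m ^ k * (n * c))"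
    using conj_pow_eq[OF assms(2,1,1,3), of "m ^ k * c"] by (simp add: mult_ac)
  also have "t [^] k \<otimes> \<dots> \<otimes> inv (t [^] k) = a [^] (n ^ k * (n * c))" by (rule Suc)
  finally show ?case by (simp add: mult_ac)
qed (use assms in simp)

text \<open>For \<open>k = j \<ge> 0\<close> the hypothesis reads
  \<open>M * n ^ j = N * m ^ j\<close>. As \<open>m\<close> and \<open>n\<close> are coprime,
  \<open>m ^ j\<close> divides \<open>M\<close>, so each of the \<open>j\<close> conjugations by
  \<open>t\<close> meets an exponent divisible by \<open>m\<close>. Negative \<open>k\<close>
  exchanges \<open>M\<close> and \<open>N\<close>.\<close>

lemma conj_powi_pow:
  assumes a: "a \<in> carrier G" and t: "t \<in> carrier G" and rel: "t \<otimes> a [^] (m::int) \<otimes> inv t = a [^] (n::int)"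
    and mn: "coprime m n" "m \<noteq> 0" "n \<noteq> 0" and MN: "M \<noteq> 0" "N \<noteq> 0"
    and eq: "of_int M / of_int N = (of_int m / of_int n :: rat) powi k"
  shows "t [^] k \<otimes> a [^] M \<otimes> inv (t [^] k) = a [^] N"
proof -
  have nat: "t [^] j \<otimes> a [^] M \<otimes> inv (t [^] j) = a [^] N"
    if MN: "M \<noteq> 0" "N \<noteq> 0" and eq: "of_int M / of_int N = (of_int m / of_int n :: rat) ^ j" for M N and j :: nat
  proof -
    have "of_int M * of_int (n ^ j) = (of_int N * of_int (m ^ j) :: rat)"
      using eq MN mn by (simp add: power_divide field_simps)
    then have int: "M * n ^ j = N * m ^ j" by (metis of_int_eq_iff of_int_mult)
    then have "m ^ j dvd M * n ^ j" by simp
    then have "m ^ j dvd M" using mn(1) by (simp add: coprime_dvd_mult_left_iff)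
    then obtain c where c: "M = m ^ j * c" by (elim dvdE)
    have "m ^ j * (n ^ j * c) = m ^ j * N" using int unfolding c by (simp only: mult_ac)
    then have "N = n ^ j * c" using mn(2) by simp
    then show ?thesis using conj_nat_pow_pow[OF a t rel, of j c] c by simp
  qed
  obtain j where "k = int j \<or> k = - int j" by (metis int_cases2)
  then show ?thesis
  proof
    assume "k = int j"
    then show ?thesis using nat[OF MN, of j] eq by (simp add: int_pow_int)
  next
    assume k: "k = - int j"
    then have "inverse (of_int M / of_int N) = (of_int m / of_int n :: rat) ^ j"
      using eq by (simp add: power_int_minus)
    then have "t [^] j \<otimes> a [^] N \<otimes> inv (t [^] j) = a [^] M"
      using nat[OF MN(2,1), of j] by simp
    then have "inv (t [^] j) \<otimes> a [^] M \<otimes> t [^] j = inv (t [^] j) \<otimes> (t [^] j \<otimes> a [^] N \<otimes> inv (t [^] j)) \<otimes> t [^] j"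
      by simp
    also have "\<dots> = a [^] N" using a t by (simp add: m_assoc inv_solve_left')
    finally show ?thesis using t by (simp add: k int_pow_neg_int)
  qed
qed

end

context weighted_presentation
begin

lemma carrier_induct:
  assumes "g \<in> carrier G"
    and "\<And>v. v \<in> verts \<Gamma> \<Longrightarrow> Q (av v)" "\<And>e. e \<in> arcs \<Gamma> \<Longrightarrow> Q (te e)" "Q \<one>"
    and mult: "\<And>g h. g \<in> carrier G \<Longrightarrow> h \<in> carrier G \<Longrightarrow> Q g \<Longrightarrow> Q h \<Longrightarrow> Q (g \<otimes> h)"
    and inv: "\<And>g. g \<in> carrier G \<Longrightarrow> Q g \<Longrightarrow> Q (inv g)"
  shows "Q g"
proof -
  have "g \<in> generate G (av ` verts \<Gamma> \<union> te ` arcs \<Gamma>)" using assms(1) generate_av_te by simp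
  then show ?thesis
  proof (induction rule: generate.induct)
    case (inv h)
    then show ?case using assms(2,3) assms(6) by auto
  next
    case (eng h1 h2)
    then show ?case using mult generate_av_te by simp
  qed (use assms(2-4) in auto)
qed

lemma quotient_of_tree:
  assumes "betti \<Gamma> = 0" "m \<noteq> 0" "n \<noteq> 0" and f: "f \<in> epi G (BS m n)"
  shows "BS m n \<cong> BS 1 (-1)"
proof -
  let ?B = "BS m n"
  obtain act ht where bs: "bs_pair ?B (bs_a m n) (bs_t m n) m n act ht"
    using bs_pair_BS[OF assms(2,3)] .
  interpret B: bs_pair ?B "bs_a m n" "bs_t m n" m n act ht by (rule bs)
  interpret f: group_hom G ?B f
    using f by (simp add: group_hom_def group_hom_axioms_def epi_def is_group)
  have surj: "\<exists>g\<in>carrier G. f g = x" if "x \<in> carrier ?B" for x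
  proof -
    have "x \<in> f ` carrier G" using f that by (simp add: epi_def)
    then show ?thesis by blast
  qed
  have "arcs \<Gamma> - A = {}" using betti_eq assms(1) finite_graph by auto
  then have te1: "te e = \<one>" if "e \<in> arcs \<Gamma>" for e using te_A that by blast
  obtain u where u: "u \<in> verts \<Gamma>" using verts_nonempty by blast
  have "\<forall>v\<in>verts \<Gamma>. \<exists>(i::int) (j::int). i \<noteq> 0 \<and> j \<noteq> 0 \<and> av u [^] i = av v [^] j"
  proof
    fix v assume v: "v \<in> verts \<Gamma>"
    obtain i j :: int where "i \<noteq> 0" "j \<noteq> 0" "av u [^] i = av v [^] j"
      using av_commensurable[OF u v] .
    then show "\<exists>(i::int) (j::int). i \<noteq> 0 \<and> j \<noteq> 0 \<and> av u [^] i = av v [^] j"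
      by (intro exI[of _ i] exI[of _ j] conjI)
  qed
  then obtain i j :: "'w \<Rightarrow> int" where ij: "\<And>v. v \<in> verts \<Gamma> \<Longrightarrow> i v \<noteq> 0 \<and> j v \<noteq> 0 \<and> av u [^] i v = av v [^] j v"
    by metis
  \<comment> \<open>A common multiple of the exponents, so that the \<open>J\<close>-th power of
    \<open>av u\<close> is a power of every \<open>av v\<close>. As all stable letters are trivial,
    it is central.\<close>
  define J where "J = (\<Prod>v\<in>verts \<Gamma>. i v)"
  have J: "J \<noteq> 0" using ij finite_graph by (simp add: J_def)
  define c where "c = av u [^] J"
  have cc: "c \<in> carrier G" using u by (simp add: c_def)
  have comm: "g \<otimes> c = c \<otimes> g" if "g \<in> carrier G" for g
    using that
  proof (rule carrier_induct)
    fix v assume v: "v \<in> verts \<Gamma>"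
    have "i v dvd J" unfolding J_def using v finite_graph by (intro dvd_prodI)
    then obtain k where k: "J = i v * k" by (elim dvdE)
    have "c = (av u [^] i v) [^] k" using u by (simp add: c_def k int_pow_pow)
    also have "\<dots> = av v [^] (j v * k)" using ij[OF v] v by (simp add: int_pow_pow)
    finally show "av v \<otimes> c = c \<otimes> av v"
      using v int_pow_mult[of "av v" 1 "j v * k"] int_pow_mult[of "av v" "j v * k" 1] by (simp add: add.commute)
  next
    fix g h assume gh: "g \<in> carrier G" "h \<in> carrier G" "g \<otimes> c = c \<otimes> g" "h \<otimes> c = c \<otimes> h"
    then show "g \<otimes> h \<otimes> c = c \<otimes> (g \<otimes> h)" using cc by (metis m_assoc)
  next
    fix g assume g: "g \<in> carrier G" "g \<otimes> c = c \<otimes> g"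
    then show "inv g \<otimes> c = c \<otimes> inv g" using cc by (metis inv_closed inv_solve_left inv_solve_right m_assoc m_closed)
  qed (use te1 cc in auto)
  \<comment> \<open>A homomorphism to the integers is thus determined by its value at
    \<open>av u\<close>: the abelianization of \<open>G\<close> has rank at most 1.\<close>
  have scale: "i v * h (av u) = j v * h (av v)" if h: "h \<in> hom G integer_group" and v: "v \<in> verts \<Gamma>" for h v
  proof -
    interpret h: group_hom G integer_group h
      using h by (simp add: group_hom_def group_hom_axioms_def is_group)
    have "h (av u [^] i v) = h (av v [^] j v)" using ij[OF v] by simp
    then show ?thesis using u v by (simp add: h.hom_int_pow)
  qed
  define h1 where "h1 = ht \<circ> f"
  have h1: "h1 \<in> hom G integer_group"
    unfolding h1_def by (rule Group.hom_compose[OF f.homh B.ht_hom])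
  interpret h1: group_hom G integer_group h1
    using h1 by (simp add: group_hom_def group_hom_axioms_def is_group)
  have h1u: "h1 (av u) \<noteq> 0"
  proof
    assume z: "h1 (av u) = 0"
    have "h1 g = 0" if "g \<in> carrier G" for g
      using that
    proof (rule carrier_induct)
      show "h1 (av v) = 0" if "v \<in> verts \<Gamma>" for v
        using scale[OF h1 that] z ij[OF that] by simp
    qed (auto simp: te1)
    moreover obtain g where "g \<in> carrier G" "f g = bs_t m n" using surj[of "bs_t m n"] by auto
    ultimately show False using B.ht_t by (force simp: h1_def)
  qed
  have "h1 c = J * h1 (av u)" using u by (simp add: c_def h1.hom_int_pow)
  then have "ht (f c) \<noteq> 0" using J h1u by (simp add: h1_def)
  moreover have "f c \<otimes>\<^bsub>?B\<^esub> bs_a m n = bs_a m n \<otimes>\<^bsub>?B\<^esub> f c"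
  proof -
    obtain g where g: "g \<in> carrier G" "f g = bs_a m n" using surj[of "bs_a m n"] by auto
    then show ?thesis using comm[OF g(1)] cc by (metis f.hom_mult)
  qed
  ultimately have one: "\<bar>m\<bar> = 1" "\<bar>n\<bar> = 1" using BS_central_ht[OF bs, of "f c"] cc by auto
  \<comment> \<open>For \<open>m = n\<close> the group \<open>BS m n\<close> has independent
    homomorphisms to the integers, counting \<open>a\<close> and counting \<open>t\<close>, whereas
    those of \<open>G\<close> are proportional.\<close>
  have "m \<noteq> n"
  proof
    assume "m = n"
    then obtain ht' where ht': "ht' \<in> hom ?B integer_group" "ht' (bs_a m n) = 1" "ht' (bs_t m n) = 0"
      using BS_hom[of integer_group 1 0 m n] by auto
    define h2 where "h2 = ht' \<circ> f"
    have h2: "h2 \<in> hom G integer_group"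
      unfolding h2_def by (rule Group.hom_compose[OF f.homh ht'(1)])
    interpret h2: group_hom G integer_group h2
      using h2 by (simp add: group_hom_def group_hom_axioms_def is_group)
    have proportional: "h1 (av u) * h2 g = h2 (av u) * h1 g" if "g \<in> carrier G" for g
      using that
    proof (rule carrier_induct)
      fix v assume v: "v \<in> verts \<Gamma>"
      have "j v * (h1 (av u) * h2 (av v)) = h1 (av u) * (i v * h2 (av u))"
        using scale[OF h2 v] by (simp add: mult_ac)
      also have "\<dots> = j v * (h2 (av u) * h1 (av v))" using scale[OF h1 v] by (simp add: mult_ac)
      finally show "h1 (av u) * h2 (av v) = h2 (av u) * h1 (av v)" using ij[OF v] by simp
    qed (auto simp: te1 algebra_simps)
    obtain g where g: "g \<in> carrier G" "f g = bs_a m n" using surj[of "bs_a m n"] by auto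
    then have "h1 g = 0" "h2 g = 1" using B.ht_a ht' by (auto simp: h1_def h2_def)
    then show False using proportional[OF g(1)] h1u by simp
  qed
  then consider "m = 1" "n = -1" | "m = -1" "n = 1" using one by (auto simp: abs_if split: if_splits)
  then show ?thesis
  proof cases
    case 1
    then show ?thesis by (simp add: iso_refl)
  next
    case 2
    have "bs_a m n [^]\<^bsub>?B\<^esub> (1::int) = bs_a m n" by simp
    then have rel: "bs_t m n \<otimes>\<^bsub>?B\<^esub> bs_a m n \<otimes>\<^bsub>?B\<^esub> inv\<^bsub>?B\<^esub> bs_t m n = bs_a m n [^]\<^bsub>?B\<^esub> (-1::int)"
      using B.conj_pow_eq[OF B.t_closed B.a_closed B.a_closed B.rel, of "-1"] 2 by simp
    show ?thesis
    proof (rule B.iso_BS_1[OF B.a_closed B.t_closed _ rel])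
      show "\<exists>(i::int) (k::int). g = bs_a m n [^]\<^bsub>?B\<^esub> i \<otimes>\<^bsub>?B\<^esub> bs_t m n [^]\<^bsub>?B\<^esub> k" if "g \<in> carrier ?B" for g
        using B.generate_normal_form[OF B.a_closed B.t_closed _ rel, of g] that B.gen by simp
      fix i k :: int assume eq: "bs_a m n [^]\<^bsub>?B\<^esub> i \<otimes>\<^bsub>?B\<^esub> bs_t m n [^]\<^bsub>?B\<^esub> k = \<one>\<^bsub>?B\<^esub>"
      have "ht (bs_a m n [^]\<^bsub>?B\<^esub> i \<otimes>\<^bsub>?B\<^esub> bs_t m n [^]\<^bsub>?B\<^esub> k) = k"
        by (simp add: B.ht.hom_int_pow B.ht_a B.ht_t)
      then have "k = 0" using eq B.ht.hom_one by simp
      then show "i = 0 \<and> k = 0" using eq B.inf_order_a by (simp add: B.inf_order_def)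
    qed simp
  qed
qed

text \<open>The exponents are forced unless \<open>q\<close> is 1 or -1. In those cases there is
  freedom, and taking all exponents even, say, would keep \<open>t\<close> out of the image; so one
  of them is made equal to 1.\<close>

lemma ex_exponents:
  assumes u: "u \<in> verts \<Gamma>" and e0: "arcs \<Gamma> - A \<noteq> {}"
    and cyc: "{q'. \<exists>g\<in>carrier G. conj_ratio (av u) g q'} = range (\<lambda>k. q powi k)"
  obtains k :: "'f \<Rightarrow> int" where "\<And>e. e \<in> arcs \<Gamma> \<Longrightarrow> ratio e = q powi k e" "\<And>e. e \<in> arcs \<Gamma> \<Longrightarrow> k (s e) = - k e"
    "\<And>e. e \<in> A \<Longrightarrow> k e = 0" "\<bar>q\<bar> \<noteq> 1 \<or> (\<exists>e\<in>arcs \<Gamma>. k e = 1)"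
proof -
  have "\<exists>k. ratio e = q powi k" if e: "e \<in> arcs \<Gamma>" for e
  proof -
    have "ratio e \<in> {q'. \<exists>g\<in>carrier G. conj_ratio (av u) g q'}"
      using conj_ratio_te[OF u e] te_closed[OF e] by blast
    then show ?thesis unfolding cyc by blast
  qed
  then have "\<forall>e\<in>arcs \<Gamma>. \<exists>k. ratio e = q powi k" by blast
  then have "\<exists>k1. \<forall>e\<in>arcs \<Gamma>. ratio e = q powi k1 e" by (rule bchoice)
  then obtain k1 where k1: "\<And>e. e \<in> arcs \<Gamma> \<Longrightarrow> ratio e = q powi k1 e" by blast
  \<comment> \<open>Only one arc of each opposite pair will keep its value, so the exponent 1 is
    arranged on both.\<close>
  have "\<exists>k0. (\<forall>e\<in>arcs \<Gamma>. ratio e = q powi k0 e) \<and> (\<forall>e\<in>A. k0 e = (0::int)) \<and>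
      (\<bar>q\<bar> \<noteq> 1 \<or> (\<exists>e\<in>arcs \<Gamma>. k0 e = 1 \<and> k0 (s e) = 1))"
  proof -
    have "\<bar>q\<bar> \<noteq> 1 \<or> q = 1 \<or> q = -1" by arith
    then consider "\<bar>q\<bar> \<noteq> 1" | "q = 1" | "q = -1" by blast
    then show ?thesis
    proof cases
      case 1
      have "ratio e = q powi (if e \<in> A then 0 else k1 e)" if "e \<in> arcs \<Gamma>" for e
        using ratio_A[of e] k1[OF that] by (cases "e \<in> A") simp_all
      then show ?thesis using 1 by (intro exI[of _ "\<lambda>e. if e \<in> A then 0 else k1 e"]) simp
    next
      case 2
      then show ?thesis using k1 e0 A_s_iff by (intro exI[of _ "\<lambda>e. if e \<in> A then 0 else 1"]) auto
    next
      case 3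
      have pm: "ratio e = 1 \<or> ratio e = -1" if "e \<in> arcs \<Gamma>" for e
        using k1[OF that] 3 by (cases "even (k1 e)") (auto simp: power_int_minus_left)
      \<comment> \<open>Otherwise every element of \<open>G\<close> would have ratio 1, while
        \<open>cyc\<close> makes -1 a ratio.\<close>
      have "\<exists>e\<in>arcs \<Gamma>. ratio e = -1"
      proof (rule ccontr)
        assume "\<not> (\<exists>e\<in>arcs \<Gamma>. ratio e = -1)"
        then have r1: "ratio e = 1" if "e \<in> arcs \<Gamma>" for e using pm that by blast
        have uc: "av u \<in> carrier G" using u by simp
        have "conj_ratio (av u) g 1" if "g \<in> carrier G" for g
          using that
        proof (rule carrier_induct)
          show "conj_ratio (av u) (te e) 1" if "e \<in> arcs \<Gamma>" for e
            using conj_ratio_te[OF u that] r1[OF that] by simp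
          show "conj_ratio (av u) \<one> 1" using conj_ratio_commute[of \<one> "av u" 1] uc by simp
          show "conj_ratio (av u) (g \<otimes> h) 1"
            if "g \<in> carrier G" "h \<in> carrier G" "conj_ratio (av u) g 1" "conj_ratio (av u) h 1" for g h
            using conj_ratio_mult[OF uc that] by simp
          show "conj_ratio (av u) (inv g) 1" if "g \<in> carrier G" "conj_ratio (av u) g 1" for g
            using conj_ratio_inv[OF uc that] by simp
        qed (rule conj_ratio_av[OF u])
        moreover have "q \<in> range (\<lambda>k. q powi k)" by (rule range_eqI[of _ _ 1]) simp
        then obtain g where "g \<in> carrier G" "conj_ratio (av u) g q" unfolding cyc[symmetric] by auto
        ultimately have "q = 1" using conj_ratio_unique[OF inf_order_av[OF u]] by blast
        then show False using 3 by simp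
      qed
      then obtain e where e: "e \<in> arcs \<Gamma>" "ratio e = -1" ..
      then have "ratio (s e) = -1" by (simp add: ratio_s)
      moreover have "(if ratio e = -1 then 1 else 0) = (0::int)" if "e \<in> A" for e using ratio_A[OF that] by simp
      ultimately show ?thesis using e 3 pm
        by (intro exI[of _ "\<lambda>e. if ratio e = -1 then 1 else 0"]) auto
    qed
  qed
  then obtain k0 :: "'f \<Rightarrow> int" where k0: "\<And>e. e \<in> arcs \<Gamma> \<Longrightarrow> ratio e = q powi k0 e" "\<And>e. e \<in> A \<Longrightarrow> k0 e = 0"
    "\<bar>q\<bar> \<noteq> 1 \<or> (\<exists>e\<in>arcs \<Gamma>. k0 e = 1 \<and> k0 (s e) = 1)" by blast
  obtain O' where O': "O' \<subseteq> arcs \<Gamma>" "\<And>e. e \<in> arcs \<Gamma> \<Longrightarrow> e \<in> O' \<longleftrightarrow> s e \<notin> O'"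
    using \<Gamma>.ex_orientation[OF finite_graph(2)] by blast
  define k where "k e = (if e \<in> O' then k0 e else - k0 (s e))" for e
  show thesis
  proof (rule that[of k])
    show "ratio e = q powi k e" if "e \<in> arcs \<Gamma>" for e
      using k0(1)[OF that] k0(1)[of "s e"] that ratio_s[OF that]
      by (simp add: k_def power_int_minus) (metis inverse_inverse_eq)
    show "k (s e) = - k e" if "e \<in> arcs \<Gamma>" for e
      using O'(2)[OF that] by (simp add: k_def)
    show "k e = 0" if "e \<in> A" for e
      using k0(2) that A_s by (simp add: k_def)
    show "\<bar>q\<bar> \<noteq> 1 \<or> (\<exists>e\<in>arcs \<Gamma>. k e = 1)"
    proof (cases "\<bar>q\<bar> = 1")
      case True
      then obtain e where e: "e \<in> arcs \<Gamma>" "k0 e = 1" "k0 (s e) = 1" using k0(3) by blast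
      have "k e = 1 \<or> k (s e) = 1" using O'(2)[OF e(1)] e(2,3) by (simp add: k_def)
      then show ?thesis using e(1) \<Gamma>.arev_in_arcs[OF e(1)] by blast
    qed simp
  qed
qed

lemma ex_epi_if_cyclic:
  assumes u: "u \<in> verts \<Gamma>" and e0: "arcs \<Gamma> - A \<noteq> {}" and q: "q \<noteq> 0"
    and cyc: "{q'. \<exists>g\<in>carrier G. conj_ratio (av u) g q'} = range (\<lambda>k. q powi k)"
  obtains m n f where "m \<noteq> 0" "n \<noteq> 0" "f \<in> epi G (BS m n)"
    "\<And>v. v \<in> verts \<Gamma> \<Longrightarrow> f (av v) = bs_a m n [^]\<^bsub>BS m n\<^esub> w v"
proof -
  obtain m n where mn: "quotient_of q = (m, n)" by (cases "quotient_of q")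
  have q_eq: "q = of_int m / of_int n" and n: "n \<noteq> 0" and cop: "coprime m n"
    using quotient_of_div[OF mn] quotient_of_denom_pos[OF mn] quotient_of_coprime[OF mn] by auto
  then have m: "m \<noteq> 0" using q by auto
  let ?B = "BS m n" and ?a = "bs_a m n" and ?t = "bs_t m n"
  obtain act ht where "bs_pair ?B ?a ?t m n act ht" using bs_pair_BS[OF m n] .
  then interpret B: bs_pair ?B ?a ?t m n act ht .
  obtain k where k: "\<And>e. e \<in> arcs \<Gamma> \<Longrightarrow> ratio e = q powi k e" "\<And>e. e \<in> arcs \<Gamma> \<Longrightarrow> k (s e) = - k e"
    "\<And>e. e \<in> A \<Longrightarrow> k e = 0" "\<bar>q\<bar> \<noteq> 1 \<or> (\<exists>e\<in>arcs \<Gamma>. k e = 1)"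
    using ex_exponents[OF u e0 cyc] by blast
  obtain f where f: "f \<in> hom G ?B" "\<And>v. v \<in> verts \<Gamma> \<Longrightarrow> f (av v) = ?a [^]\<^bsub>?B\<^esub> w v"
    "\<And>e. e \<in> arcs \<Gamma> \<Longrightarrow> f (te e) = ?t [^]\<^bsub>?B\<^esub> k e"
  proof (rule ex_hom[of ?B "\<lambda>v. ?a [^]\<^bsub>?B\<^esub> w v" "\<lambda>e. ?t [^]\<^bsub>?B\<^esub> k e"])
    show "?t [^]\<^bsub>?B\<^esub> k e \<otimes>\<^bsub>?B\<^esub> ?t [^]\<^bsub>?B\<^esub> k (s e) = \<one>\<^bsub>?B\<^esub>" if "e \<in> arcs \<Gamma>" for e
      using k(2)[OF that] by (simp add: B.int_pow_neg)
    show "?t [^]\<^bsub>?B\<^esub> k e \<otimes>\<^bsub>?B\<^esub> (?a [^]\<^bsub>?B\<^esub> w (head \<Gamma> e)) [^]\<^bsub>?B\<^esub> l (s e) \<otimes>\<^bsub>?B\<^esub> inv\<^bsub>?B\<^esub> (?t [^]\<^bsub>?B\<^esub> k e) =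
        (?a [^]\<^bsub>?B\<^esub> w (tail \<Gamma> e)) [^]\<^bsub>?B\<^esub> l e" if e: "e \<in> arcs \<Gamma>" for e
    proof -
      have "?t [^]\<^bsub>?B\<^esub> k e \<otimes>\<^bsub>?B\<^esub> ?a [^]\<^bsub>?B\<^esub> (w (head \<Gamma> e) * l (s e)) \<otimes>\<^bsub>?B\<^esub> inv\<^bsub>?B\<^esub> (?t [^]\<^bsub>?B\<^esub> k e) =
          ?a [^]\<^bsub>?B\<^esub> (w (tail \<Gamma> e) * l e)"
      proof (rule B.conj_powi_pow[OF B.a_closed B.t_closed B.rel cop m n])
        show "w (head \<Gamma> e) * l (s e) \<noteq> 0" "w (tail \<Gamma> e) * l e \<noteq> 0"
          using e w_nonzero l_nonzero by simp_all
        show "of_int (w (head \<Gamma> e) * l (s e)) / of_int (w (tail \<Gamma> e) * l e) = (of_int m / of_int n :: rat) powi k e"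
          using k(1)[OF e] by (simp only: ratio_def q_eq)
      qed
      then show ?thesis by (simp add: B.int_pow_pow)
    qed
  qed (use k(3) in auto)
  interpret f: group_hom G ?B f
    using f(1) by (simp add: group_hom_def group_hom_axioms_def is_group)
  let ?I = "f ` carrier G"
  interpret I: subgroup ?I ?B by (rule f.img_is_subgroup)
  have diff: "x [^]\<^bsub>?B\<^esub> (i - j) \<in> ?I"
    if "x \<in> carrier ?B" "x [^]\<^bsub>?B\<^esub> i \<in> ?I" "x [^]\<^bsub>?B\<^esub> j \<in> ?I" for x and i j :: int
    using I.m_closed[OF that(2) I.m_inv_closed[OF that(3)]] that(1) by (simp add: B.int_pow_diff)
  \<comment> \<open>The exponents \<open>i\<close> with \<open>a^i\<close> in the image are the
    multiples of some \<open>d\<close>, which divides every weight and is therefore a unit.\<close>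
  have "?a \<in> ?I"
  proof -
    obtain d where d: "{i::int. ?a [^]\<^bsub>?B\<^esub> i \<in> ?I} = range (\<lambda>k. d * k)"
      by (rule subgroup_int_multiples[of "{i. ?a [^]\<^bsub>?B\<^esub> i \<in> ?I}"]) (use diff I.one_closed in auto)
    have "d dvd w v" if "v \<in> verts \<Gamma>" for v
    proof -
      have "?a [^]\<^bsub>?B\<^esub> w v \<in> ?I" using f(2)[OF that] that by (metis av_closed imageI)
      then have "w v \<in> range (\<lambda>k. d * k)" unfolding d[symmetric] by simp
      then show ?thesis by auto
    qed
    then have "is_unit d" using w_primitive by blast
    then obtain c where "1 = d * c" by (elim dvdE)
    then have "1 \<in> range (\<lambda>k. d * k)" by (rule range_eqI)
    then show ?thesis unfolding d[symmetric] by simp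
  qed
  \<comment> \<open>Each generator goes to a power of \<open>a\<close> or of \<open>t\<close>, so
    \<open>t\<close> raised to the exponent sum of an image lies in the image too. It remains to
    find exponent sum 1.\<close>
  have tI: "?t [^]\<^bsub>?B\<^esub> ht (f g) \<in> ?I" if "g \<in> carrier G" for g
    using that
  proof (rule carrier_induct)
    show "?t [^]\<^bsub>?B\<^esub> ht (f (av v)) \<in> ?I" if "v \<in> verts \<Gamma>" for v
      using f(2)[OF that] I.one_closed by (simp add: B.ht.hom_int_pow B.ht_a)
    show "?t [^]\<^bsub>?B\<^esub> ht (f (te e)) \<in> ?I" if "e \<in> arcs \<Gamma>" for e
      using f(3)[OF that] that by (simp add: B.ht.hom_int_pow B.ht_t) (metis imageI te_closed)
    show "?t [^]\<^bsub>?B\<^esub> ht (f \<one>) \<in> ?I" using I.one_closed by simp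
    show "?t [^]\<^bsub>?B\<^esub> ht (f (g \<otimes> h)) \<in> ?I"
      if "g \<in> carrier G" "h \<in> carrier G" "?t [^]\<^bsub>?B\<^esub> ht (f g) \<in> ?I" "?t [^]\<^bsub>?B\<^esub> ht (f h) \<in> ?I" for g h
      using I.m_closed[OF that(3,4)] that(1,2) by (simp add: B.int_pow_mult)
    show "?t [^]\<^bsub>?B\<^esub> ht (f (inv g)) \<in> ?I" if "g \<in> carrier G" "?t [^]\<^bsub>?B\<^esub> ht (f g) \<in> ?I" for g
      using I.m_inv_closed[OF that(2)] that(1) by (simp add: B.int_pow_neg)
  qed
  have "\<exists>g\<in>carrier G. ht (f g) = 1"
  proof (cases "\<bar>q\<bar> = 1")
    case True
    then obtain e where "e \<in> arcs \<Gamma>" "k e = 1" using k(4) by blast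
    then show ?thesis using f(3) by (intro bexI[of _ "te e"]) (auto simp: B.ht_t)
  next
    case False
    \<comment> \<open>An element with ratio \<open>q\<close> has an exponent sum \<open>h\<close>
      with \<open>q powi h = q\<close>, and \<open>h = 1\<close> because \<open>q\<close> is neither
      1 nor -1.\<close>
    have hom: "ht \<circ> f \<in> hom G integer_group" by (rule Group.hom_compose[OF f(1) B.ht_hom])
    have "q \<in> range (\<lambda>k. q powi k)" by (rule range_eqI[of _ _ 1]) simp
    then obtain g where g: "g \<in> carrier G" "conj_ratio (av u) g q" unfolding cyc[symmetric] by auto
    have *: "conj_ratio (av u) g (q powi (ht \<circ> f) g)"
    proof (rule conj_ratio_powi[OF _ _ hom q])
      show "g \<in> generate G (av ` verts \<Gamma> \<union> te ` arcs \<Gamma>)" using g(1) generate_av_te by simp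
      show "conj_ratio (av u) x (q powi (ht \<circ> f) x)" if "x \<in> av ` verts \<Gamma> \<union> te ` arcs \<Gamma>" for x
        using that conj_ratio_av[OF u] conj_ratio_te[OF u] k(1)
        by (auto simp: f B.ht.hom_int_pow B.ht_a B.ht_t)
    qed (use u in auto)
    have "q powi (ht (f g) - 1) = q powi (ht \<circ> f) g / q" using q by (simp add: power_int_diff)
    also have "q powi (ht \<circ> f) g = q"
      by (rule conj_ratio_unique[OF inf_order_av[OF u] g(1) * g(2)])
    finally have "q powi (ht (f g) - 1) = 1" using q by simp
    then have "ht (f g) - 1 = 0" using abs_eq_1_of_power_int_eq_1 False by blast
    then show ?thesis using g(1) by auto
  qed
  then have "?t \<in> ?I" using tI by force
  then have "generate ?B {?a, ?t} \<subseteq> ?I"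
    using \<open>?a \<in> ?I\<close> B.generate_subgroup_incl[OF _ I.subgroup_axioms] by simp
  then have "f \<in> epi G ?B" using f(1) f.hom_closed by (auto simp: epi_def B.gen)
  then show thesis using that[OF m n _ f(2)] by blast
qed

text \<open>Killing the vertex groups leaves a free group; with two independent loops it maps onto
  any Baumslag-Solitar group.\<close>

lemma ex_epi_two_loops:
  assumes e1: "e1 \<in> arcs \<Gamma> - A" and e2: "e2 \<in> arcs \<Gamma> - A" "e2 \<noteq> e1" "e2 \<noteq> s e1"
  shows "\<exists>f. f \<in> epi G (BS 1 1)"
proof -
  let ?B = "BS 1 1" and ?a = "bs_a 1 1" and ?t = "bs_t 1 1"
  interpret B: group ?B by simp
  define \<tau> where "\<tau> e = (if e = e1 then ?a else if e = s e1 then inv\<^bsub>?B\<^esub> ?a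
    else if e = e2 then ?t else if e = s e2 then inv\<^bsub>?B\<^esub> ?t else \<one>\<^bsub>?B\<^esub>)" for e
  have ne: "s e1 \<noteq> e1" "s e2 \<noteq> e2" "s e2 \<noteq> e1" "s e2 \<noteq> s e1"
    using e1 e2 \<Gamma>.arev_neq \<Gamma>.arev_arev by (auto simp: \<Gamma>.arev_eq_iff)
  have \<tau>c: "\<tau> e \<in> carrier ?B" for e by (simp add: \<tau>_def)
  obtain f where f: "f \<in> hom G ?B" "\<And>e. e \<in> arcs \<Gamma> \<Longrightarrow> f (te e) = \<tau> e"
  proof (rule ex_hom[of ?B "\<lambda>v. \<one>\<^bsub>?B\<^esub>" \<tau>])
    show "\<tau> e \<otimes>\<^bsub>?B\<^esub> \<tau> (s e) = \<one>\<^bsub>?B\<^esub>" if "e \<in> arcs \<Gamma>" for e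
      using ne e2(2,3) \<Gamma>.arev_arev[of e] by (auto simp: \<tau>_def \<Gamma>.arev_eq_iff)
    show "\<tau> e = \<one>\<^bsub>?B\<^esub>" if "e \<in> A" for e
      using that e1 e2 A_s_iff[of e1] A_s_iff[of e2] by (auto simp: \<tau>_def)
  qed (use \<tau>c in auto)
  interpret f: group_hom G ?B f
    using f(1) by (simp add: group_hom_def group_hom_axioms_def is_group)
  have "?a \<in> f ` carrier G" using f(2)[of e1] e1 by (intro image_eqI[of _ _ "te e1"]) (auto simp: \<tau>_def)
  moreover have "?t \<in> f ` carrier G" using f(2)[of e2] e2 by (intro image_eqI[of _ _ "te e2"]) (auto simp: \<tau>_def)
  ultimately have "generate ?B {?a, ?t} \<subseteq> f ` carrier G"
    using B.generate_subgroup_incl[OF _ f.img_is_subgroup] by simp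
  then have "f \<in> epi G ?B" using f(1) f.hom_closed by (auto simp: epi_def generate_BS)
  then show ?thesis by blast
qed

text \<open>Counting the stable letter of the only loop with sign is a homomorphism to the integers,
  and vertex generators and subtree letters have ratio 1.\<close>

lemma conj_ratio_one_loop:
  assumes u: "u \<in> verts \<Gamma>" and e1: "e1 \<in> arcs \<Gamma> - A" "arcs \<Gamma> - A \<subseteq> {e1, s e1}" and g: "g \<in> carrier G"
  shows "\<exists>k::int. conj_ratio (av u) g (ratio e1 powi k)"
proof -
  define \<tau> :: "'f \<Rightarrow> int" where "\<tau> e = (if e = e1 then 1 else if e = s e1 then -1 else 0)" for e
  have ne: "s e1 \<noteq> e1" using e1 \<Gamma>.arev_neq by auto
  have sA: "s e1 \<notin> A" using A_s_iff e1 by auto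
  obtain h where h: "h \<in> hom G integer_group" "\<And>v. v \<in> verts \<Gamma> \<Longrightarrow> h (av v) = 0" "\<And>e. e \<in> arcs \<Gamma> \<Longrightarrow> h (te e) = \<tau> e"
  proof (rule ex_hom[of integer_group "\<lambda>v. 0" \<tau>])
    show "\<tau> e \<otimes>\<^bsub>integer_group\<^esub> \<tau> (s e) = \<one>\<^bsub>integer_group\<^esub>" if "e \<in> arcs \<Gamma>" for e
      using ne \<Gamma>.arev_arev[of e] by (auto simp: \<tau>_def \<Gamma>.arev_eq_iff)
    show "\<tau> e = \<one>\<^bsub>integer_group\<^esub>" if "e \<in> A" for e using that e1 sA by (auto simp: \<tau>_def)
  qed auto
  have ratio: "ratio e1 powi \<tau> e = ratio e" if "e \<in> arcs \<Gamma>" for e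
    using that e1 ratio_A ratio_s[of e1] by (cases "e \<in> A") (auto simp: \<tau>_def sA power_int_minus)
  have "conj_ratio (av u) x (ratio e1 powi h x)" if "x \<in> av ` verts \<Gamma> \<union> te ` arcs \<Gamma>" for x
    using that conj_ratio_av[OF u] conj_ratio_te[OF u] by (auto simp: h(2,3) ratio)
  moreover have "g \<in> generate G (av ` verts \<Gamma> \<union> te ` arcs \<Gamma>)" using g generate_av_te by simp
  moreover have "av ` verts \<Gamma> \<union> te ` arcs \<Gamma> \<subseteq> carrier G" "ratio e1 \<noteq> 0"
    using ratio_nonzero e1 by auto
  ultimately have "conj_ratio (av u) g (ratio e1 powi h g)"
    using conj_ratio_powi[OF av_closed[OF u] _ h(1), of "av ` verts \<Gamma> \<union> te ` arcs \<Gamma>" "ratio e1" g] by simp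
  then show ?thesis by blast
qed

end

section \<open>The labelled graph and the tree action of the same group\<close>

locale gbs_presentation = gbs_action G T r \<phi> \<psi> + weighted_presentation G \<Gamma> s l A \<theta> w
  for G (structure) and T :: "('v, 'e) pre_digraph" and r \<phi> \<psi> and \<Gamma> :: "('w, 'f) pre_digraph" and s l A \<theta> w +
  assumes non_elementary: "\<not> elementary_gbs G"
begin

lemma elliptic_av:
  assumes "u \<in> verts \<Gamma>"
  shows "elliptic G T \<phi> (av u)" "av u \<noteq> \<one>"
proof -
  show "av u \<noteq> \<one>" using inf_order_av[OF assms] by (auto simp: inf_order_def dest: spec[of _ 1])
  have "\<exists>v\<in>verts T. \<phi> (av u) v = v"
  proof (rule ccontr)
    assume "\<not> (\<exists>v\<in>verts T. \<phi> (av u) v = v)"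
    then have "elementary_gbs G"
      using assms ex_conj_ratio_av[OF assms] by (intro elementary_if_commensurated_hyperbolic[of "av u"]) auto
    then show False using non_elementary by simp
  qed
  then show "elliptic G T \<phi> (av u)" using assms by (simp add: elliptic_def)
qed

lemma modular_image_eq:
  assumes u: "u \<in> verts \<Gamma>"
  shows "modular G T \<phi> ` carrier G = {q. \<exists>g\<in>carrier G. conj_ratio (av u) g q}"
proof -
  have "conj_ratio (av u) g q \<longleftrightarrow> q = modular G T \<phi> g" if "g \<in> carrier G" for g q
    using ex_conj_ratio_av[OF u that] modular_eq[OF elliptic_av[OF u] that] by metis
  then show ?thesis by blast
qed

lemma ex_friendly_epi_if_cyclic:
  assumes "betti \<Gamma> \<ge> 1" "cyclic_group (rat_units\<lparr>carrier := modular G T \<phi> ` carrier G\<rparr>)"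
  shows "\<exists>m n f. m \<noteq> 0 \<and> n \<noteq> 0 \<and> f \<in> epi G (BS m n) \<and> elliptic_friendly G T \<phi> (BS m n) f"
proof -
  obtain u where u: "u \<in> verts \<Gamma>" using verts_nonempty by blast
  have "arcs \<Gamma> - A \<noteq> {}" using betti_eq assms(1) by (metis card.empty mult_eq_0_iff not_one_le_zero of_nat_0 zero_neq_numeral)
  moreover obtain q where "q \<noteq> 0" "{q'. \<exists>g\<in>carrier G. conj_ratio (av u) g q'} = range (\<lambda>k. q powi k)"
    using assms(2) cyclic_rat_units_iff[OF subgroup_modular] unfolding modular_image_eq[OF u] by blast
  ultimately obtain m n f where f: "m \<noteq> 0" "n \<noteq> 0" "f \<in> epi G (BS m n)"
    "\<And>v. v \<in> verts \<Gamma> \<Longrightarrow> f (av v) = bs_a m n [^]\<^bsub>BS m n\<^esub> w v"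
    using ex_epi_if_cyclic[OF u] by blast
  obtain act ht where "bs_pair (BS m n) (bs_a m n) (bs_t m n) m n act ht" using bs_pair_BS[OF f(1,2)] .
  then interpret B: bs_pair "BS m n" "bs_a m n" "bs_t m n" m n act ht .
  interpret f: group_hom G "BS m n" f
    using f(3) by (simp add: group_hom_def group_hom_axioms_def is_group epi_def)
  \<comment> \<open>A non-trivial elliptic \<open>g\<close> shares a non-trivial power with
    \<open>av u\<close>, whose image is a non-zero power of \<open>a\<close> and so has infinite
    order.\<close>
  have "g = \<one>" if g: "g \<in> kernel G (BS m n) f" "elliptic G T \<phi> g" for g
  proof (rule ccontr)
    assume "g \<noteq> \<one>"
    then obtain i j :: int where ij: "i \<noteq> 0" "av u [^] i = g [^] j"
      using elliptic_commensurable[OF elliptic_av[OF u] g(2)] by (auto simp: commensurable_def)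
    have gc: "g \<in> carrier G" "f g = \<one>\<^bsub>BS m n\<^esub>" using g(1) by (auto simp: kernel_def)
    have "f (av u [^] i) = \<one>\<^bsub>BS m n\<^esub>" unfolding ij(2) using gc by (simp add: f.hom_int_pow)
    then have "bs_a m n [^]\<^bsub>BS m n\<^esub> (w u * i) = \<one>\<^bsub>BS m n\<^esub>"
      using u f(4)[OF u] by (simp add: f.hom_int_pow B.int_pow_pow)
    then have "w u * i = 0" using B.inf_order_a unfolding B.inf_order_def by blast
    then show False using ij(1) w_nonzero[OF u] by simp
  qed
  then have "elliptic_friendly G T \<phi> (BS m n) f"
    using f.homh B.torsion_free by (simp add: elliptic_friendly_def)
  then show ?thesis using f by blast
qed

text \<open>Friendliness makes \<open>f (av u)\<close> non-trivial, and \<open>f\<close> preserves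
  ratios. So the modular values are among the ratios of one element of \<open>BS m n\<close>, all
  powers of a single number.\<close>

lemma cyclic_if_friendly:
  assumes "m \<noteq> 0" "n \<noteq> 0" "f \<in> hom G (BS m n)" "elliptic_friendly G T \<phi> (BS m n) f"
  shows "cyclic_group (rat_units\<lparr>carrier := modular G T \<phi> ` carrier G\<rparr>)"
proof -
  obtain u where u: "u \<in> verts \<Gamma>" using verts_nonempty by blast
  obtain act ht where "bs_pair (BS m n) (bs_a m n) (bs_t m n) m n act ht" using bs_pair_BS[OF assms(1,2)] .
  then interpret B: bs_pair "BS m n" "bs_a m n" "bs_t m n" m n act ht .
  have f: "group_hom G (BS m n) f"
    using assms(3) by (simp add: group_hom_def group_hom_axioms_def is_group)
  interpret f: group_hom G "BS m n" f by (rule f)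
  have "f (av u) \<noteq> \<one>\<^bsub>BS m n\<^esub>"
    using assms(4) elliptic_av[OF u] u by (auto simp: elliptic_friendly_def kernel_def)
  moreover have "f (av u) \<in> carrier (BS m n)" using u by simp
  ultimately obtain x where x: "x \<noteq> 0" "\<And>g q. g \<in> carrier (BS m n) \<Longrightarrow> B.conj_ratio (f (av u)) g q \<Longrightarrow> \<exists>k::int. q = x powi k"
    using B.conj_ratio_range[of "f (av u)"] by blast
  have "modular G T \<phi> ` carrier G \<subseteq> range (\<lambda>k. x powi k)"
    unfolding modular_image_eq[OF u]
  proof
    fix q assume "q \<in> {q. \<exists>g\<in>carrier G. conj_ratio (av u) g q}"
    then obtain g where g: "g \<in> carrier G" "conj_ratio (av u) g q" by blast
    then have "\<exists>k::int. q = x powi k"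
      using x(2)[OF f.hom_closed conj_ratio_hom[OF f av_closed[OF u] g]] by blast
    then show "q \<in> range (\<lambda>k. x powi k)" by blast
  qed
  then show ?thesis by (rule cyclic_rat_units_subset[OF subgroup_modular x(1)])
qed

text \<open>With one loop all modular values are powers of its ratio, so the friendly construction
  applies; with two loops the vertex groups can be killed and the two stable letters sent to chosen
  generators.\<close>

lemma ex_epi:
  assumes "betti \<Gamma> \<ge> 1"
  shows "\<exists>m n f. m \<noteq> 0 \<and> n \<noteq> 0 \<and> f \<in> epi G (BS m n)"
proof -
  obtain u where u: "u \<in> verts \<Gamma>" using verts_nonempty by blast
  have "arcs \<Gamma> - A \<noteq> {}" using betti_eq assms by (metis card.empty mult_eq_0_iff not_one_le_zero of_nat_0 zero_neq_numeral)
  then obtain e1 where e1: "e1 \<in> arcs \<Gamma> - A" by blast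
  show ?thesis
  proof (cases "arcs \<Gamma> - A \<subseteq> {e1, s e1}")
    case True
    have "modular G T \<phi> ` carrier G \<subseteq> range (\<lambda>k. ratio e1 powi k)"
    proof
      fix q assume "q \<in> modular G T \<phi> ` carrier G"
      then obtain g where g: "g \<in> carrier G" "conj_ratio (av u) g q" using modular_image_eq[OF u] by auto
      then obtain k :: int where "conj_ratio (av u) g (ratio e1 powi k)"
        using conj_ratio_one_loop[OF u e1 True] by blast
      then show "q \<in> range (\<lambda>k. ratio e1 powi k)" using conj_ratio_unique[OF inf_order_av[OF u] g] by blast
    qed
    then have "cyclic_group (rat_units\<lparr>carrier := modular G T \<phi> ` carrier G\<rparr>)"
      using e1 ratio_nonzero by (intro cyclic_rat_units_subset[OF subgroup_modular]) auto
    then show ?thesis using ex_friendly_epi_if_cyclic[OF assms] by blast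
  next
    case False
    then obtain e2 where "e2 \<in> arcs \<Gamma> - A" "e2 \<noteq> e1" "e2 \<noteq> s e1" by blast
    then show ?thesis using ex_epi_two_loops[OF e1] by (metis zero_neq_one)
  qed
qed

end

section \<open>Quotients as epimorphic images, and the conclusion\<close>

lemma (in group) quotient_iff_epi:
  assumes "group H"
  shows "(\<exists>N. N \<lhd> G \<and> G Mod N \<cong> H) \<longleftrightarrow> (\<exists>f. f \<in> epi G H)"
proof
  assume "\<exists>N. N \<lhd> G \<and> G Mod N \<cong> H"
  then obtain N h where N: "N \<lhd> G" and h: "h \<in> iso (G Mod N) H" by (auto simp: is_iso_def)
  interpret N: normal N G by fact
  have "h \<circ> (\<lambda>g. N #> g) \<in> hom G H"
    using h by (intro Group.hom_compose[OF N.r_coset_hom_Mod]) (simp add: iso_def)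
  moreover have "(h \<circ> (\<lambda>g. N #> g)) ` carrier G = carrier H"
  proof -
    have "(\<lambda>g. N #> g) ` carrier G = carrier (G Mod N)" by (auto simp: FactGroup_def RCOSETS_def)
    moreover have "h ` carrier (G Mod N) = carrier H" using h by (simp add: iso_def bij_betw_def)
    ultimately show ?thesis by (metis image_comp)
  qed
  ultimately have "h \<circ> (\<lambda>g. N #> g) \<in> epi G H" by (simp only: epi_def mem_Collect_eq)
  then show "\<exists>f. f \<in> epi G H" by blast
next
  assume "\<exists>f. f \<in> epi G H"
  then obtain f where f: "f \<in> epi G H" ..
  then interpret f: group_hom G H f
    using assms by (simp add: group_hom_def group_hom_axioms_def is_group epi_def)
  show "\<exists>N. N \<lhd> G \<and> G Mod N \<cong> H"
    using f f.normal_kernel f.FactGroup_iso by (auto simp: epi_def)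
qed

theorem lemma3p6:
  fixes G :: "('a, 'b) monoid_scheme"
    and T :: "('v, 'e) pre_digraph" and r :: "'e \<Rightarrow> 'e"
    and \<phi> :: "'a \<Rightarrow> 'v \<Rightarrow> 'v" and \<psi> :: "'a \<Rightarrow> 'e \<Rightarrow> 'e"
    and \<Gamma> :: "('w, 'f) pre_digraph" and s :: "'f \<Rightarrow> 'f" and l :: "'f \<Rightarrow> int"
  assumes "gbs_group G T r \<phi> \<psi>"
    and "\<not> elementary_gbs G"
    and "represents \<Gamma> s l G"
  shows "(betti \<Gamma> = 0 \<longrightarrow>
      (\<forall>N m n. N \<lhd> G \<and> m \<noteq> 0 \<and> n \<noteq> 0 \<and> G Mod N \<cong> BS m n \<longrightarrow> BS m n \<cong> BS 1 (-1))) \<and>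
    (betti \<Gamma> \<ge> 1 \<longrightarrow>
      (\<exists>N m n. N \<lhd> G \<and> m \<noteq> 0 \<and> n \<noteq> 0 \<and> G Mod N \<cong> BS m n) \<and>
      ((\<exists>m n f. m \<noteq> 0 \<and> n \<noteq> 0 \<and> f \<in> epi G (BS m n) \<and> elliptic_friendly G T \<phi> (BS m n) f)
        \<longleftrightarrow> cyclic_group (rat_units\<lparr>carrier := modular G T \<phi> ` carrier G\<rparr>)))"
proof -
  interpret act: gbs_action G T r \<phi> \<psi> using gbs_group_action[OF assms(1)] .
  obtain A \<theta> where "labelled_presentation G \<Gamma> s l A \<theta>"
    using represents_presentation[OF act.is_group assms(3)] .
  then interpret pres: labelled_presentation G \<Gamma> s l A \<theta> .
  obtain w where w: "weighted_presentation G \<Gamma> s l A \<theta> w"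
  proof (rule pres.ex_weights)
    fix w assume "\<And>v. v \<in> verts \<Gamma> \<Longrightarrow> w v \<noteq> 0"
      "\<And>e. e \<in> A \<Longrightarrow> w (head \<Gamma> e) * l (s e) = w (tail \<Gamma> e) * l e"
      "\<forall>d. (\<forall>v\<in>verts \<Gamma>. d dvd w v) \<longrightarrow> is_unit d"
    then have "weighted_presentation G \<Gamma> s l A \<theta> w"
      by unfold_locales auto
    then show thesis by (rule that)
  qed
  then interpret gbs_presentation G T r \<phi> \<psi> \<Gamma> s l A \<theta> w
    using act.gbs_action_axioms assms(2) by (simp add: gbs_presentation_def gbs_presentation_axioms_def)
  have "BS m n \<cong> BS 1 (-1)" if "betti \<Gamma> = 0" "N \<lhd> G" "m \<noteq> 0" "n \<noteq> 0" "G Mod N \<cong> BS m n" for N m n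
    using quotient_of_tree[OF that(1,3,4)] act.quotient_iff_epi[OF group_BS] that(2,5) by blast
  moreover have "\<exists>N m n. N \<lhd> G \<and> m \<noteq> 0 \<and> n \<noteq> 0 \<and> G Mod N \<cong> BS m n" if "betti \<Gamma> \<ge> 1"
    using ex_epi[OF that] act.quotient_iff_epi[OF group_BS] by blast
  moreover have "(\<exists>m n f. m \<noteq> 0 \<and> n \<noteq> 0 \<and> f \<in> epi G (BS m n) \<and> elliptic_friendly G T \<phi> (BS m n) f)
      \<longleftrightarrow> cyclic_group (rat_units\<lparr>carrier := modular G T \<phi> ` carrier G\<rparr>)" if "betti \<Gamma> \<ge> 1"
    using ex_friendly_epi_if_cyclic[OF that] cyclic_if_friendly by (auto simp: epi_def)
  ultimately show ?thesis by blast
qed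

end
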